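(* Let $C=C^\infty[0,1]$, $I=(0,1)$, and let $\Phi_1=\{f\in C: f(0)=f(1)=0,\ f'(0)=2f'(1)\}$ and $\Phi_2=\{f\in C: f(0)=f(1)=f'(1)=0\}$. For $j\in\{1,2\}$ let $S_j:\Phi_j\to C$ be the operator $S_jf=(-i)^3 f'''$, i.e. the spatial differential operator of Problem $j$ (described in the context). Let $F_\lambda$ be the functionals associated with Problem $j$ and $\Gamma_0,\Gamma^+,\Gamma^-$ the contours, all as defined in the context, and let $f_x(F)=\left\{\int_{\Gamma_0}+\int_{\Gamma^+}+\int_{\Gamma^-}\right\}e^{i\lambda x}F(\lambda)\,d\lambda$ be the associated inverse transform. Then for each $j\in\{1,2\}$ the transform pair $(F_\lambda,f_x)$ of Problem $j$ provides a spectral representation of $S_j$ by type I and type II augmented eigenfunctions with eigenvalues $\lambda^3$, in the sense defined in the context, with $L=S_j$, $\Phi=\Phi_j$, $n=3$, $\gamma^{(\mathrm I)}=\Gamma_0$, $E^{(\mathrm I)}=\{F_\lambda:\lambda\in\Gamma_0\}$, $\gamma^{(\mathrm{II})}=\Gamma^+\cup\Gamma^-$ and $E^{(\mathrm{II})}=\{F_\lambda:\lambda\in\Gamma^+\cup\Gamma^-\}$.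
   Context: **Problems.** Both concern $q_t+q_{xxx}=0$ on $(0,1)\times(0,T)$ with $q(x,0)=f(x)$. Problem 1 has boundary conditions $q(0,t)=q(1,t)=0$, $q_x(1,t)=q_x(0,t)/2$. Problem 2 has boundary conditions $q(0,t)=q(1,t)=q_x(1,t)=0$. **Contours.** $\mathbb C^{\pm}$ are the open upper/lower half-planes. $\Gamma_0$ is the circle of radius $\tfrac12$ centred at $0$; $\Gamma^\pm$ is the boundary of $\{\lambda\in\mathbb C^\pm:\operatorname{Im}(\lambda^3)>0,\ |\lambda|>1\}$. Each contour is oriented so that the enclosed region (the disc, respectively the stated domain) lies to its left. Integrals along infinite contours are understood as improper integrals. **Functionals.** Let $\alpha=e^{2\pi i/3}$. Define $$F_\lambda(f)=\begin{cases}\int_0^1\phi^+(x,\lambda)f(x)\,dx,&\lambda\in\Gamma^+\cup\Gamma_0,\\ \int_0^1\phi^-(x,\lambda)f(x)\,dx,&\lambda\in\Gamma^-,\end{cases}$$ where, for Problem 1, $\Delta(\lambda)=e^{i\lambda}+\alpha e^{i\alpha\lambda}+\alpha^2e^{i\alpha^2\lambda}+2(e^{-i\lambda}+\alpha e^{-i\alpha\lambda}+\alpha^2e^{-i\alpha^2\lambda})$ and $$\phi^+(x,\lambda)=\tfrac{1}{2\pi\Delta(\lambda)}\big[e^{-i\lambda x}(e^{i\lambda}+2\alpha e^{-i\alpha\lambda}+2\alpha^2e^{-i\alpha^2\lambda})+e^{-i\alpha\lambda x}(\alpha e^{i\alpha\lambda}-2\alpha e^{-i\lambda})+e^{-i\alpha^2\lambda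 x}(\alpha^2e^{i\alpha^2\lambda}-2\alpha^2e^{-i\lambda})\big],$$ $$\phi^-(x,\lambda)=\tfrac{-e^{-i\lambda}}{2\pi\Delta(\lambda)}\big[e^{-i\lambda x}(2+\alpha^2e^{-i\alpha\lambda}+\alpha e^{-i\alpha^2\lambda})+\alpha e^{-i\alpha\lambda x}(2-e^{-i\alpha^2\lambda})+\alpha^2e^{-i\alpha^2\lambda x}(2-e^{-i\alpha\lambda})\big];$$ and, for Problem 2, $\Delta(\lambda)=e^{-i\lambda}+\alpha e^{-i\alpha\lambda}+\alpha^2e^{-i\alpha^2\lambda}$ and $$\phi^+(x,\lambda)=\tfrac{1}{2\pi\Delta(\lambda)}\big[e^{-i\lambda x}(\alpha e^{-i\alpha\lambda}+\alpha^2e^{-i\alpha^2\lambda})-(\alpha e^{-i\alpha\lambda x}+\alpha^2e^{-i\alpha^2\lambda x})e^{-i\lambda}\big],$$ $$\phi^-(x,\lambda)=\tfrac{-e^{-i\lambda}}{2\pi\Delta(\lambda)}\big[e^{-i\lambda x}+\alpha e^{-i\alpha\lambda x}+\alpha^2e^{-i\alpha^2\lambda x}\big].$$ **Augmented eigenfunctions.** Let $I$ be an open real interval, $C$ a linear topological space of functions on $\overline I$, $\Phi\subseteq C$, $L:\Phi\to C$ linear, $\gamma$ an oriented contour in $\mathbb C$, and $E=\{E_\lambda:\lambda\in\gamma\}$ a family of functionals $E_\lambda\in C'$. Suppose there are remainder functionals $R_\lambda\in\Phi'$ and eigenvalues $\lambda^n$ with $E_\lambda(L\phi)=\lambda^nE_\lambda(\phi)+R_\lambda(\phi)$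 for all $\phi\in\Phi$, $\lambda\in\gamma$. $E$ is a family of type I augmented eigenfunctions of $L$ up to integration along $\gamma$ if $\int_\gamma e^{i\lambda x}R_\lambda(\phi)\,d\lambda=0$ for all $\phi\in\Phi$, $x\in I$; it is a family of type II augmented eigenfunctions of $L$ up to integration along $\gamma$ if $\int_\gamma e^{i\lambda x}\lambda^{-n}R_\lambda(\phi)\,d\lambda=0$ for all $\phi\in\Phi$, $x\in I$. A family $E$ is complete if [$\phi\in\Phi$ and $E_\lambda\phi=0$ for all $\lambda$ in the index set] implies $\phi=0$. **Spectral representation by type I and type II augmented eigenfunctions.** Suppose $E^{(\mathrm I)}=\{E_\lambda:\lambda\in\gamma^{(\mathrm I)}\}$ is a family of type I augmented eigenfunctions of $L$ up to integration along $\gamma^{(\mathrm I)}$ and $\int_{\gamma^{(\mathrm I)}}e^{i\lambda x}E_\lambda L\phi\,d\lambda$ converges for all $\phi\in\Phi$, $x\in I$; suppose $E^{(\mathrm{II})}=\{E_\lambda:\lambda\in\gamma^{(\mathrm{II})}\}$ is a family of type II augmented eigenfunctions of $L$ up to integration along $\gamma^{(\mathrm{II})}$ and $\int_{\gamma^{(\mathrm{II})}}e^{i\lambda x}E_\lambda\phi\,d\lambda$ converges for all $\phi\in\Phi$, $x\in I$; and suppose $E=E^{(\mathrm I)}\cup E^{(\mathrm{II})}$ is complete. Then $E$ is said to provide a spectral representation of $L$, in the sense that for all $\phi\in\Phi$, $x\in I$, $$\int_{\gamma^{(\mathrm I)}}e^{i\lambda x}E_\lambda L\phi\,d\lambda=\int_{\gamma^{(\mathrm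 I)}}\lambda^ne^{i\lambda x}E_\lambda\phi\,d\lambda,\qquad \int_{\gamma^{(\mathrm{II})}}\lambda^{-n}e^{i\lambda x}E_\lambda L\phi\,d\lambda=\int_{\gamma^{(\mathrm{II})}}e^{i\lambda x}E_\lambda\phi\,d\lambda.$$ *)

theory Defs
  imports "HOL-Complex_Analysis.Complex_Analysis"
begin

section \<open>Linear topological spaces of functions and their duals\<close>

text \<open>
  A space of functions on a set \<open>S\<close> is given by its topology, whose \<open>topspace\<close> is the carrier.
  A function on \<open>S\<close> is represented by its extension by zero to the whole line, so that equality
  of functions is equality on \<open>S\<close>.
\<close>

definition funs_on :: "real set \<Rightarrow> (real \<Rightarrow> complex) set" where
  "funs_on S = {f. \<forall>x. x \<notin> S \<longrightarrow> f x = 0}"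

definition linear_subspace :: "(real \<Rightarrow> complex) set \<Rightarrow> bool" where
  "linear_subspace V \<longleftrightarrow>
     (\<lambda>x. 0) \<in> V \<and>
     (\<forall>f\<in>V. \<forall>g\<in>V. (\<lambda>x. f x + g x) \<in> V) \<and>
     (\<forall>c. \<forall>f\<in>V. (\<lambda>x. c * f x) \<in> V)"

definition linear_topological_space :: "(real \<Rightarrow> complex) topology \<Rightarrow> bool" where
  "linear_topological_space T \<longleftrightarrow>
     linear_subspace (topspace T) \<and>
     continuous_map (prod_topology T T) T (\<lambda>(f, g). (\<lambda>x. f x + g x)) \<and>
     continuous_map (prod_topology euclidean T) T (\<lambda>(c :: complex, f). (\<lambda>x. c * f x))"

definition linear_operator ::
  "(real \<Rightarrow> complex) set \<Rightarrow> (real \<Rightarrow> complex) set \<Rightarrow> ((real \<Rightarrow> complex) \<Rightarrow> (real \<Rightarrow> complex)) \<Rightarrow> bool" where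
  "linear_operator V W L \<longleftrightarrow>
     L ` V \<subseteq> W \<and>
     (\<forall>f\<in>V. \<forall>g\<in>V. L (\<lambda>x. f x + g x) = (\<lambda>x. L f x + L g x)) \<and>
     (\<forall>c. \<forall>f\<in>V. L (\<lambda>x. c * f x) = (\<lambda>x. c * L f x))"

definition dual :: "(real \<Rightarrow> complex) topology \<Rightarrow> ((real \<Rightarrow> complex) \<Rightarrow> complex) set" where
  "dual T = {l.
     (\<forall>f\<in>topspace T. \<forall>g\<in>topspace T. l (\<lambda>x. f x + g x) = l f + l g) \<and>
     (\<forall>c. \<forall>f\<in>topspace T. l (\<lambda>x. c * f x) = c * l f) \<and>
     continuous_map T euclidean l}"

section \<open>Oriented contours and improper contour integrals\<close>

text \<open>
  An oriented contour is a finite list of parametrised curves, each with its parameter interval.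
  For the interval \<open>{0..1}\<close> the integral along a curve is that of \<^const>\<open>has_contour_integral\<close>.
  For the interval \<open>UNIV\<close> the Henstock-Kurzweil integral over the whole line is the improper
  integral: it exists iff the integrals over all compact intervals \<open>{a..b}\<close> exist and converge as
  \<open>a\<close> tends to minus infinity and \<open>b\<close> to infinity independently, and it is then that limit.
\<close>

type_synonym contour = "(real set \<times> (real \<Rightarrow> complex)) list"

definition trace_of :: "contour \<Rightarrow> complex set" where
  "trace_of \<gamma> = (\<Union>(J, g)\<in>set \<gamma>. g ` J)"

definition has_integral_along :: "(complex \<Rightarrow> complex) \<Rightarrow> complex \<Rightarrow> contour \<Rightarrow> bool" where
  "has_integral_along f v \<gamma> \<longleftrightarrow>
     (\<exists>vs. list_all2
             (\<lambda>(J, g) w. ((\<lambda>t. f (g t) * vector_derivative g (at t within J)) has_integral w) J) \<gamma> vs \<and>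
           v = sum_list vs)"

section \<open>Augmented eigenfunctions\<close>

definition eigenfunction_setting ::
  "real set \<Rightarrow> (real \<Rightarrow> complex) topology \<Rightarrow> (real \<Rightarrow> complex) set \<Rightarrow>
   ((real \<Rightarrow> complex) \<Rightarrow> (real \<Rightarrow> complex)) \<Rightarrow> bool" where
  "eigenfunction_setting I T \<Phi> L \<longleftrightarrow>
     open I \<and> is_interval I \<and> I \<noteq> {} \<and>
     linear_topological_space T \<and> topspace T \<subseteq> funs_on (closure I) \<and>
     \<Phi> \<subseteq> topspace T \<and> linear_subspace \<Phi> \<and> linear_operator \<Phi> (topspace T) L"

definition remainder_functionals ::
  "(real \<Rightarrow> complex) topology \<Rightarrow> (real \<Rightarrow> complex) set \<Rightarrow>
   ((real \<Rightarrow> complex) \<Rightarrow> (real \<Rightarrow> complex)) \<Rightarrow> nat \<Rightarrow> contour \<Rightarrow>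
   (complex \<Rightarrow> (real \<Rightarrow> complex) \<Rightarrow> complex) \<Rightarrow> (complex \<Rightarrow> (real \<Rightarrow> complex) \<Rightarrow> complex) \<Rightarrow> bool" where
  "remainder_functionals T \<Phi> L n \<gamma> E R \<longleftrightarrow>
     (\<forall>\<mu>\<in>trace_of \<gamma>. R \<mu> \<in> dual (subtopology T \<Phi>)) \<and>
     (\<forall>\<phi>\<in>\<Phi>. \<forall>\<mu>\<in>trace_of \<gamma>. E \<mu> (L \<phi>) = \<mu> ^ n * E \<mu> \<phi> + R \<mu> \<phi>)"

definition type_I_augmented ::
  "real set \<Rightarrow> (real \<Rightarrow> complex) topology \<Rightarrow> (real \<Rightarrow> complex) set \<Rightarrow>
   ((real \<Rightarrow> complex) \<Rightarrow> (real \<Rightarrow> complex)) \<Rightarrow> nat \<Rightarrow> contour \<Rightarrow>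
   (complex \<Rightarrow> (real \<Rightarrow> complex) \<Rightarrow> complex) \<Rightarrow> bool" where
  "type_I_augmented I T \<Phi> L n \<gamma> E \<longleftrightarrow>
     eigenfunction_setting I T \<Phi> L \<and>
     (\<forall>\<mu>\<in>trace_of \<gamma>. E \<mu> \<in> dual T) \<and>
     (\<exists>R. remainder_functionals T \<Phi> L n \<gamma> E R \<and>
          (\<forall>\<phi>\<in>\<Phi>. \<forall>x\<in>I. has_integral_along (\<lambda>\<mu>. exp (\<i> * \<mu> * x) * R \<mu> \<phi>) 0 \<gamma>))"

definition type_II_augmented ::
  "real set \<Rightarrow> (real \<Rightarrow> complex) topology \<Rightarrow> (real \<Rightarrow> complex) set \<Rightarrow>
   ((real \<Rightarrow> complex) \<Rightarrow> (real \<Rightarrow> complex)) \<Rightarrow> nat \<Rightarrow> contour \<Rightarrow>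
   (complex \<Rightarrow> (real \<Rightarrow> complex) \<Rightarrow> complex) \<Rightarrow> bool" where
  "type_II_augmented I T \<Phi> L n \<gamma> E \<longleftrightarrow>
     eigenfunction_setting I T \<Phi> L \<and>
     (\<forall>\<mu>\<in>trace_of \<gamma>. E \<mu> \<in> dual T) \<and>
     (\<exists>R. remainder_functionals T \<Phi> L n \<gamma> E R \<and>
          (\<forall>\<phi>\<in>\<Phi>. \<forall>x\<in>I.
             has_integral_along (\<lambda>\<mu>. exp (\<i> * \<mu> * x) * inverse (\<mu> ^ n) * R \<mu> \<phi>) 0 \<gamma>))"

definition complete_family ::
  "(real \<Rightarrow> complex) set \<Rightarrow> complex set \<Rightarrow> (complex \<Rightarrow> (real \<Rightarrow> complex) \<Rightarrow> complex) \<Rightarrow> bool" where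
  "complete_family \<Phi> A E \<longleftrightarrow> (\<forall>\<phi>\<in>\<Phi>. (\<forall>\<mu>\<in>A. E \<mu> \<phi> = 0) \<longrightarrow> \<phi> = (\<lambda>x. 0))"

text \<open>
  Besides the conditions on the families, the definition contains the two resulting identities;
  each asserts that both of its integrals converge, and to the same value.
\<close>

definition spectral_representation ::
  "real set \<Rightarrow> (real \<Rightarrow> complex) topology \<Rightarrow> (real \<Rightarrow> complex) set \<Rightarrow>
   ((real \<Rightarrow> complex) \<Rightarrow> (real \<Rightarrow> complex)) \<Rightarrow> nat \<Rightarrow> contour \<Rightarrow> contour \<Rightarrow>
   (complex \<Rightarrow> (real \<Rightarrow> complex) \<Rightarrow> complex) \<Rightarrow> bool" where
  "spectral_representation I T \<Phi> L n \<gamma>1 \<gamma>2 E \<longleftrightarrow>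
     type_I_augmented I T \<Phi> L n \<gamma>1 E \<and>
     (\<forall>\<phi>\<in>\<Phi>. \<forall>x\<in>I. \<exists>v. has_integral_along (\<lambda>\<mu>. exp (\<i> * \<mu> * x) * E \<mu> (L \<phi>)) v \<gamma>1) \<and>
     type_II_augmented I T \<Phi> L n \<gamma>2 E \<and>
     (\<forall>\<phi>\<in>\<Phi>. \<forall>x\<in>I. \<exists>v. has_integral_along (\<lambda>\<mu>. exp (\<i> * \<mu> * x) * E \<mu> \<phi>) v \<gamma>2) \<and>
     complete_family \<Phi> (trace_of \<gamma>1 \<union> trace_of \<gamma>2) E \<and>
     (\<forall>\<phi>\<in>\<Phi>. \<forall>x\<in>I. \<exists>v.
        has_integral_along (\<lambda>\<mu>. exp (\<i> * \<mu> * x) * E \<mu> (L \<phi>)) v \<gamma>1 \<and>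
        has_integral_along (\<lambda>\<mu>. \<mu> ^ n * exp (\<i> * \<mu> * x) * E \<mu> \<phi>) v \<gamma>1) \<and>
     (\<forall>\<phi>\<in>\<Phi>. \<forall>x\<in>I. \<exists>v.
        has_integral_along (\<lambda>\<mu>. inverse (\<mu> ^ n) * exp (\<i> * \<mu> * x) * E \<mu> (L \<phi>)) v \<gamma>2 \<and>
        has_integral_along (\<lambda>\<mu>. exp (\<i> * \<mu> * x) * E \<mu> \<phi>) v \<gamma>2)"

section \<open>Smooth functions on the unit interval and the spatial operators\<close>

definition deriv01 :: "(real \<Rightarrow> complex) \<Rightarrow> real \<Rightarrow> complex" where
  "deriv01 f x = (if x \<in> {0..1} then vector_derivative f (at x within {0..1}) else 0)"

definition smooth01 :: "(real \<Rightarrow> complex) set" where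
  "smooth01 = {f \<in> funs_on {0..1}.
     \<forall>k. \<forall>x\<in>{0..1}. (deriv01 ^^ k) f differentiable (at x within {0..1})}"

definition smooth01_ball :: "nat \<Rightarrow> (real \<Rightarrow> complex) \<Rightarrow> real \<Rightarrow> (real \<Rightarrow> complex) set" where
  "smooth01_ball k f \<epsilon> =
     {g \<in> smooth01. \<forall>x\<in>{0..1}. norm ((deriv01 ^^ k) g x - (deriv01 ^^ k) f x) < \<epsilon>}"

text \<open>
  The usual Frechet topology, of uniform convergence of every derivative: the balls above are the
  open balls of the seminorms \<open>sup |f^(k)|\<close> (each supremum is attained).
\<close>

definition smooth01_topology :: "(real \<Rightarrow> complex) topology" where
  "smooth01_topology =
     topology_generated_by {smooth01_ball k f \<epsilon> | k f \<epsilon>. f \<in> smooth01 \<and> \<epsilon> > 0}"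

lemma topspace_smooth01_topology: "topspace smooth01_topology = smooth01"
proof -
  have "f \<in> smooth01_ball 0 f 1" if "f \<in> smooth01" for f
    using that by (auto simp: smooth01_ball_def)
  moreover have "smooth01_ball k f \<epsilon> \<subseteq> smooth01" for k f \<epsilon>
    by (auto simp: smooth01_ball_def)
  ultimately show ?thesis
    unfolding smooth01_topology_def topology_generated_by_topspace
    by (fastforce intro: zero_less_one)
qed

definition Phi1 :: "(real \<Rightarrow> complex) set" where
  "Phi1 = {f \<in> smooth01. f 0 = 0 \<and> f 1 = 0 \<and> deriv01 f 0 = 2 * deriv01 f 1}"

definition Phi2 :: "(real \<Rightarrow> complex) set" where
  "Phi2 = {f \<in> smooth01. f 0 = 0 \<and> f 1 = 0 \<and> deriv01 f 1 = 0}"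

definition S_op :: "(real \<Rightarrow> complex) \<Rightarrow> real \<Rightarrow> complex" where
  "S_op f = (\<lambda>x. (- \<i>) ^ 3 * (deriv01 ^^ 3) f x)"

section \<open>The contours\<close>

definition D_plus :: "complex set" where
  "D_plus = {\<mu>. Im \<mu> > 0 \<and> Im (\<mu> ^ 3) > 0 \<and> norm \<mu> > 1}"

definition D_minus :: "complex set" where
  "D_minus = {\<mu>. Im \<mu> < 0 \<and> Im (\<mu> ^ 3) > 0 \<and> norm \<mu> > 1}"

definition sector :: "real \<Rightarrow> real \<Rightarrow> complex set" where
  "sector a b = {of_real r * cis t | r t. r > (1 :: real) \<and> a < t \<and> t < b}"

text \<open>
  The boundary of \<open>sector a b\<close> with the sector on its left: inwards along the
  ray of argument \<open>b\<close>, clockwise along the unit circle, outwards along the ray of argument \<open>a\<close>.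
\<close>

definition sector_boundary :: "real \<Rightarrow> real \<Rightarrow> real \<Rightarrow> complex" where
  "sector_boundary a b t =
     (if t \<le> 0 then of_real (1 - t) * cis b
      else if t \<le> 1 then cis (b - t * (b - a))
      else of_real t * cis a)"

definition Gamma0 :: contour where
  "Gamma0 = [({0..1}, circlepath 0 (1/2))]"

definition Gamma_plus :: contour where
  "Gamma_plus = [(UNIV, sector_boundary 0 (pi/3)), (UNIV, sector_boundary (2*pi/3) pi)]"

definition Gamma_minus :: contour where
  "Gamma_minus = [(UNIV, sector_boundary (4*pi/3) (5*pi/3))]"

text \<open>
  The next lemmas show that the parametrised contours trace exactly the boundaries of the domains
  (\<open>D_plus\<close> consists of two sectors, \<open>D_minus\<close> of one).
\<close>

lemma sin_nonneg_cases:
  assumes "0 \<le> t" "t < 2*pi"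
  shows "sin t > 0 \<longleftrightarrow> 0 < t \<and> t < pi" "sin t < 0 \<longleftrightarrow> pi < t"
proof -
  have "t = 0 \<or> (0 < t \<and> t < pi) \<or> t = pi \<or> (pi < t \<and> t < 2*pi)" using assms by linarith
  then show "sin t > 0 \<longleftrightarrow> 0 < t \<and> t < pi" "sin t < 0 \<longleftrightarrow> pi < t"
    using sin_gt_zero[of t] sin_lt_zero[of t] by auto
qed

lemma sin3_cases:
  assumes "0 \<le> t" "t < 2*pi"
  shows "(sin (3*t) > 0 \<longleftrightarrow> 0 < t \<and> t < pi/3 \<or> 2*pi/3 < t \<and> t < pi \<or> 4*pi/3 < t \<and> t < 5*pi/3) \<and>
    (sin (3*t) < 0 \<longleftrightarrow> pi/3 < t \<and> t < 2*pi/3 \<or> pi < t \<and> t < 4*pi/3 \<or> 5*pi/3 < t)"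
proof -
  have e1: "sin (3*t) = sin (3*t - 2*pi)" by (simp add: sin_diff)
  have e2: "sin (3*t) = sin (3*t - 4*pi)"
    using sin_diff[of "3*t-2*pi" "2*pi"] e1 by (simp add: algebra_simps)
  consider "3*t < 2*pi" | "2*pi \<le> 3*t" "3*t < 4*pi" | "4*pi \<le> 3*t" by linarith
  then show ?thesis
  proof cases
    case 1
    have "0 \<le> 3*t" using assms by simp
    from sin_nonneg_cases[OF this 1] show ?thesis using 1 assms pi_gt_zero by simp argo
  next
    case 2
    then have "0 \<le> 3*t - 2*pi" "3*t - 2*pi < 2*pi" by auto
    from sin_nonneg_cases[OF this] show ?thesis unfolding e1 using 2 assms pi_gt_zero by simp argo
  next
    case 3
    then have "0 \<le> 3*t - 4*pi" "3*t - 4*pi < 2*pi" using assms by auto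
    from sin_nonneg_cases[OF this] show ?thesis unfolding e2 using 3 assms pi_gt_zero by simp argo
  qed
qed

lemma polar_cube:
  fixes z :: complex
  obtains t where "0 \<le> t" "t < 2*pi" "z = norm z * cis t"
    "Im z = norm z * sin t" "Im (z^3) = norm z ^ 3 * sin (3*t)"
proof -
  let ?t = "Arg2pi z"
  have z: "z = norm z * cis ?t"
    using Arg2pi_eq[of z] by (simp add: cis_conv_exp)
  have "z^3 = of_real (norm z ^ 3) * cis (3 * ?t)"
    by (subst z) (simp add: power_mult_distrib Complex.DeMoivre)
  then have "Im (z^3) = norm z ^ 3 * sin (3 * ?t)" by simp
  moreover have "Im z = norm z * sin ?t" by (subst z) simp
  ultimately show ?thesis using that[of ?t] Arg2pi_ge_0 Arg2pi_lt_2pi z by blast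
qed

lemma sector_boundary_closure:
  assumes "a < b" shows "range (sector_boundary a b) \<subseteq> closure (sector a b)"
proof
  fix z assume "z \<in> range (sector_boundary a b)"
  then obtain s where s: "z = sector_boundary a b s" by auto
  have "\<exists>r t. z = of_real r * cis t \<and> r \<ge> 1 \<and> a \<le> t \<and> t \<le> b"
  proof -
    consider "s \<le> 0" | "0 < s" "s \<le> 1" | "1 < s" by linarith
    then show ?thesis
    proof cases
      case 1 then show ?thesis using assms s by (intro exI[of _ "1-s"] exI[of _ b]) (auto simp: sector_boundary_def)
    next
      case 2
      have "s * (b-a) \<le> 1 * (b-a)" "0 \<le> s * (b-a)" using assms 2 by (auto intro!: mult_right_mono)
      then have "z = of_real 1 * cis (b - s*(b-a)) \<and> (1::real) \<ge> 1 \<and> a \<le> b - s*(b-a) \<and> b - s*(b-a) \<le> b"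
        using s 2 by (simp add: sector_boundary_def)
      then show ?thesis by (intro exI)
    next
      case 3 then show ?thesis using assms s by (intro exI[of _ "s"] exI[of _ a]) (auto simp: sector_boundary_def)
    qed
  qed
  then obtain r t where rt: "z = of_real r * cis t" "r \<ge> 1" "a \<le> t" "t \<le> b" by blast
  let ?h = "\<lambda>p::real\<times>real. complex_of_real (fst p) * cis (snd p)"
  have "?h ` closure ({1<..} \<times> {a<..<b}) \<subseteq> closure (sector a b)"
  proof (rule image_closure_subset)
    show "continuous_on (closure ({1<..} \<times> {a<..<b})) ?h" by (intro continuous_intros)
    show "?h ` ({1<..} \<times> {a<..<b}) \<subseteq> closure (sector a b)"
      by (rule order_trans[OF _ closure_subset]) (unfold sector_def, auto, blast)
  qed auto
  moreover have "(r,t) \<in> closure ({1<..} \<times> {a<..<b})"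
    using rt assms by (simp add: closure_Times)
  ultimately show "z \<in> closure (sector a b)" using rt by force
qed

lemma sector_boundary_mem:
  assumes "a < b" "r = 1 \<and> a \<le> t \<and> t \<le> b \<or> r \<ge> 1 \<and> (t = a \<or> t = b)"
  shows "of_real r * cis t \<in> range (sector_boundary a b)"
proof -
  consider "r = 1" "a < t" "t < b" | "t = a" "r > 1" | "t = a" "r = 1" | "t = b" "r \<ge> 1" using assms by linarith
  then show ?thesis
  proof cases
    case 1
    then have "of_real r * cis t = sector_boundary a b ((b-t)/(b-a))"
      using assms by (simp add: sector_boundary_def divide_simps)
    then show ?thesis by blast
  next
    case 2
    then have "of_real r * cis t = sector_boundary a b r"
      using assms by (simp add: sector_boundary_def)
    then show ?thesis by blast
  next
    case 3
    then have "of_real r * cis t = sector_boundary a b 1"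
      using assms by (simp add: sector_boundary_def)
    then show ?thesis by blast
  next
    case 4
    then have "of_real r * cis t = sector_boundary a b (1-r)"
      using assms by (simp add: sector_boundary_def)
    then show ?thesis by blast
  qed
qed

lemma sector_polar:
  assumes "r > 0"
  shows "norm (of_real r * cis t) = r" "Im (of_real r * cis t) = r * sin t"
    "Im ((of_real r * cis t)^3) = r^3 * sin (3*t)"
proof -
  have "(of_real r * cis t)^3 = of_real (r ^ 3) * cis (3 * t)"
    by (simp add: power_mult_distrib Complex.DeMoivre)
  then show "Im ((of_real r * cis t)^3) = r^3 * sin (3*t)" by simp
qed (use assms in \<open>simp_all add: norm_mult\<close>)

lemma sector_boundary_polar:
  assumes "a < b" "sin (3*a) = 0" "sin (3*b) = 0" "z \<in> range (sector_boundary a b)"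
  shows "norm z = 1 \<or> Im (z^3) = 0"
proof -
  obtain s where s: "z = sector_boundary a b s" using assms by auto
  consider "s \<le> 0" | "0 < s" "s \<le> 1" | "1 < s" by linarith
  then show ?thesis
  proof cases
    case 1 then show ?thesis using s assms(2,3) sector_polar[of "1-s" b] by (simp add: sector_boundary_def)
  next
    case 2 then show ?thesis using s assms(2,3) by (simp add: sector_boundary_def)
  next
    case 3 then show ?thesis using s assms(2,3) sector_polar[of "s" a] by (simp add: sector_boundary_def)
  qed
qed

lemma trace_Gamma_plus: "trace_of Gamma_plus = frontier D_plus"
proof -
  let ?B = "range (sector_boundary 0 (pi/3)) \<union> range (sector_boundary (2*pi/3) pi)"
  have op: "open D_plus" unfolding D_plus_def by (intro open_Collect_conj open_Collect_less continuous_intros)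
  have fr: "frontier D_plus = closure D_plus - D_plus"
    using op by (simp add: frontier_def interior_open)
  have sub: "sector 0 (pi/3) \<subseteq> D_plus" "sector (2*pi/3) pi \<subseteq> D_plus"
    using sin3_cases sin_nonneg_cases unfolding sector_def D_plus_def by (auto simp: sector_polar)
  have "?B \<subseteq> closure D_plus"
    using sector_boundary_closure[of 0 "pi/3"] sector_boundary_closure[of "2*pi/3" pi]
      closure_mono[OF sub(1)] closure_mono[OF sub(2)] by auto
  moreover have "?B \<inter> D_plus = {}"
  proof -
    have "sin (3 * 0) = 0" "sin (3 * (pi/3)) = 0" "sin (3 * (2*pi/3)) = 0" "sin (3*pi) = 0"
      using sin_npi[of 3] by (auto simp: mult.commute)
    then have "norm z = 1 \<or> Im (z^3) = 0" if "z \<in> ?B" for z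
      using that sector_boundary_polar[of 0 "pi/3" z] sector_boundary_polar[of "2*pi/3" pi z] by auto
    then show ?thesis by (force simp: D_plus_def)
  qed
  moreover have "frontier D_plus \<subseteq> ?B"
  proof
    fix z assume z: "z \<in> frontier D_plus"
    have "closed {z. Im z \<ge> 0 \<and> Im (z^3) \<ge> 0 \<and> norm z \<ge> 1}"
      by (intro closed_Collect_conj closed_Collect_le continuous_intros)
    then have "closure D_plus \<subseteq> {z. Im z \<ge> 0 \<and> Im (z^3) \<ge> 0 \<and> norm z \<ge> 1}"
      by (intro closure_minimal) (auto simp: D_plus_def)
    with z fr have c: "Im z \<ge> 0" "Im (z^3) \<ge> 0" "norm z \<ge> 1" by auto
    have nD: "z \<notin> D_plus" using z fr by auto
    obtain t where t: "0 \<le> t" "t < 2*pi" "z = norm z * cis t"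
      "Im z = norm z * sin t" "Im (z^3) = norm z ^ 3 * sin (3*t)" using polar_cube .
    have r: "norm z > 0" "norm z ^ 3 > 0" using c(3) by (auto intro: zero_less_power)
    have s: "\<not> sin t < 0" "\<not> sin (3*t) < 0"
      using c(1,2) r t(4,5) by (auto simp: mult_less_0_iff not_less zero_le_mult_iff)
    have n: "norm z = 1 \<or> \<not> sin t > 0 \<or> \<not> sin (3*t) > 0"
      using nD c(3) r t(4,5) by (auto simp: D_plus_def)
    have "t \<le> pi"
      using s(1) sin_nonneg_cases(2)[OF t(1,2)] by simp
    then have "t \<le> pi/3 \<or> 2*pi/3 \<le> t \<and> t \<le> pi"
      using s(2) conjunct2[OF sin3_cases[OF t(1,2)]] by auto
    moreover have "norm z = 1 \<or> (t = 0 \<or> t = pi) \<or> (t = pi/3 \<or> t = 2*pi/3)"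
    proof (rule ccontr)
      assume "\<not> ?thesis"
      with \<open>t \<le> pi\<close> \<open>t \<le> pi/3 \<or> _\<close> t(1)
      have "norm z \<noteq> 1" "0 < t \<and> t < pi" "0 < t \<and> t < pi/3 \<or> 2*pi/3 < t \<and> t < pi" by auto
      with n show False
        using sin_nonneg_cases(1)[OF t(1,2)] conjunct1[OF sin3_cases[OF t(1,2)]] by blast
    qed
    ultimately have
      "(norm z = 1 \<and> 0 \<le> t \<and> t \<le> pi/3 \<or> norm z \<ge> 1 \<and> (t = 0 \<or> t = pi/3)) \<or>
       (norm z = 1 \<and> 2*pi/3 \<le> t \<and> t \<le> pi \<or> norm z \<ge> 1 \<and> (t = 2*pi/3 \<or> t = pi))"
      using t(1) c(3) by blast
    then show "z \<in> ?B"
      using sector_boundary_mem[of 0 "pi/3" "norm z" t] sector_boundary_mem[of "2*pi/3" pi "norm z" t]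
        t(1) c(3) unfolding t(3)[symmetric] by auto
  qed
  ultimately show ?thesis unfolding fr by (auto simp: trace_of_def Gamma_plus_def)
qed

lemma trace_Gamma_minus: "trace_of Gamma_minus = frontier D_minus"
proof -
  let ?B = "range (sector_boundary (4*pi/3) (5*pi/3))"
  have op: "open D_minus" unfolding D_minus_def by (intro open_Collect_conj open_Collect_less continuous_intros)
  have fr: "frontier D_minus = closure D_minus - D_minus"
    using op by (simp add: frontier_def interior_open)
  have sub: "sector (4*pi/3) (5*pi/3) \<subseteq> D_minus"
    using sin3_cases sin_nonneg_cases unfolding sector_def D_minus_def
    by (auto simp: sector_polar mult_less_0_iff)
  have "?B \<subseteq> closure D_minus"
    using sector_boundary_closure[of "4*pi/3" "5*pi/3"] closure_mono[OF sub] by auto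
  moreover have "?B \<inter> D_minus = {}"
  proof -
    have "sin (3 * (4*pi/3)) = 0" "sin (3 * (5*pi/3)) = 0"
      using sin_npi[of 4] sin_npi[of 5] by (auto simp: mult.commute)
    then have "norm z = 1 \<or> Im (z^3) = 0" if "z \<in> ?B" for z
      using that sector_boundary_polar[of "4*pi/3" "5*pi/3" z] by auto
    then show ?thesis by (force simp: D_minus_def)
  qed
  moreover have "frontier D_minus \<subseteq> ?B"
  proof
    fix z assume z: "z \<in> frontier D_minus"
    let ?K = "{z. Im z \<le> 0 \<and> Im (z^3) \<ge> 0 \<and> norm z \<ge> 1 \<and> 3 * (Re z)^2 \<le> (Im z)^2}"
    have "closed ?K" by (intro closed_Collect_conj closed_Collect_le continuous_intros)
    moreover have "D_minus \<subseteq> ?K"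
    proof
      fix w assume w: "w \<in> D_minus"
      have "Im (w^3) = Im w * (3 * (Re w)^2 - (Im w)^2)"
        by (simp add: power3_eq_cube power2_eq_square algebra_simps)
      then have "3 * (Re w)^2 \<le> (Im w)^2"
        using w by (auto simp: D_minus_def zero_less_mult_iff)
      with w show "w \<in> ?K" by (auto simp: D_minus_def)
    qed
    ultimately have "closure D_minus \<subseteq> ?K" by (intro closure_minimal)
    with z fr have c: "Im z \<le> 0" "Im (z^3) \<ge> 0" "norm z \<ge> 1" "3 * (Re z)^2 \<le> (Im z)^2" by auto
    have "Im z \<noteq> 0"
    proof
      assume "Im z = 0"
      with c(4) have "z = 0" by (simp add: complex_eq_iff)
      with c(3) show False by simp
    qed
    have nD: "z \<notin> D_minus" using z fr by auto
    obtain t where t: "0 \<le> t" "t < 2*pi" "z = norm z * cis t"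
      "Im z = norm z * sin t" "Im (z^3) = norm z ^ 3 * sin (3*t)" using polar_cube .
    have r: "norm z > 0" "norm z ^ 3 > 0" using c(3) by (auto intro: zero_less_power)
    have s: "sin t < 0" "\<not> sin (3*t) < 0"
      using c(1,2) \<open>Im z \<noteq> 0\<close> r t(4,5) by (auto simp: mult_less_0_iff mult_le_0_iff not_less zero_le_mult_iff)
    have n: "norm z = 1 \<or> \<not> sin t < 0 \<or> \<not> sin (3*t) > 0"
      using nD c(3) r t(4,5) by (auto simp: D_minus_def mult_less_0_iff)
    have "4*pi/3 \<le> t" "t \<le> 5*pi/3"
      using s sin_nonneg_cases[OF t(1,2)] sin3_cases[OF t(1,2)] by auto
    then have "norm z = 1 \<and> (4*pi/3 \<le> t \<and> t \<le> 5*pi/3) \<or> t = 4*pi/3 \<or> t = 5*pi/3"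
      using s n sin3_cases[OF t(1,2)] by linarith
    then show "z \<in> ?B"
      using sector_boundary_mem[of "4*pi/3" "5*pi/3" "norm z" t]
        t(1) c(3) unfolding t(3)[symmetric] by auto
  qed
  ultimately show ?thesis unfolding fr by (auto simp: trace_of_def Gamma_minus_def)
qed

lemma trace_Gamma0: "trace_of Gamma0 = sphere 0 (1/2)"
proof -
  have "trace_of Gamma0 = path_image (circlepath 0 (1/2))"
    unfolding trace_of_def Gamma0_def path_image_def by auto
  then show ?thesis by simp
qed

section \<open>The transforms of the two problems\<close>

definition \<alpha> :: complex where
  "\<alpha> = exp (2 * pi * \<i> / 3)"

definition transform ::
  "(real \<Rightarrow> complex \<Rightarrow> complex) \<Rightarrow> (real \<Rightarrow> complex \<Rightarrow> complex) \<Rightarrow>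
   complex \<Rightarrow> (real \<Rightarrow> complex) \<Rightarrow> complex" where
  "transform \<phi>p \<phi>m \<mu> f =
     (if \<mu> \<in> frontier D_plus \<union> sphere 0 (1/2) then integral {0..1} (\<lambda>x. \<phi>p x \<mu> * f x)
      else if \<mu> \<in> frontier D_minus then integral {0..1} (\<lambda>x. \<phi>m x \<mu> * f x)
      else 0)"

definition Delta1 :: "complex \<Rightarrow> complex" where
  "Delta1 \<mu> =
     exp (\<i> * \<mu>) + \<alpha> * exp (\<i> * \<alpha> * \<mu>) + \<alpha>^2 * exp (\<i> * \<alpha>^2 * \<mu>)
     + 2 * (exp (- \<i> * \<mu>) + \<alpha> * exp (- \<i> * \<alpha> * \<mu>) + \<alpha>^2 * exp (- \<i> * \<alpha>^2 * \<mu>))"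

definition phi1_plus :: "real \<Rightarrow> complex \<Rightarrow> complex" where
  "phi1_plus x \<mu> = 1 / (2 * pi * Delta1 \<mu>) *
     (exp (- \<i> * \<mu> * x) *
        (exp (\<i> * \<mu>) + 2 * \<alpha> * exp (- \<i> * \<alpha> * \<mu>) + 2 * \<alpha>^2 * exp (- \<i> * \<alpha>^2 * \<mu>))
      + exp (- \<i> * \<alpha> * \<mu> * x) * (\<alpha> * exp (\<i> * \<alpha> * \<mu>) - 2 * \<alpha> * exp (- \<i> * \<mu>))
      + exp (- \<i> * \<alpha>^2 * \<mu> * x) * (\<alpha>^2 * exp (\<i> * \<alpha>^2 * \<mu>) - 2 * \<alpha>^2 * exp (- \<i> * \<mu>)))"

definition phi1_minus :: "real \<Rightarrow> complex \<Rightarrow> complex" where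
  "phi1_minus x \<mu> = - exp (- \<i> * \<mu>) / (2 * pi * Delta1 \<mu>) *
     (exp (- \<i> * \<mu> * x) *
        (2 + \<alpha>^2 * exp (- \<i> * \<alpha> * \<mu>) + \<alpha> * exp (- \<i> * \<alpha>^2 * \<mu>))
      + \<alpha> * exp (- \<i> * \<alpha> * \<mu> * x) * (2 - exp (- \<i> * \<alpha>^2 * \<mu>))
      + \<alpha>^2 * exp (- \<i> * \<alpha>^2 * \<mu> * x) * (2 - exp (- \<i> * \<alpha> * \<mu>)))"

definition F1 :: "complex \<Rightarrow> (real \<Rightarrow> complex) \<Rightarrow> complex" where
  "F1 = transform phi1_plus phi1_minus"

definition Delta2 :: "complex \<Rightarrow> complex" where
  "Delta2 \<mu> = exp (- \<i> * \<mu>) + \<alpha> * exp (- \<i> * \<alpha> * \<mu>) + \<alpha>^2 * exp (- \<i> * \<alpha>^2 * \<mu>)"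

definition phi2_plus :: "real \<Rightarrow> complex \<Rightarrow> complex" where
  "phi2_plus x \<mu> = 1 / (2 * pi * Delta2 \<mu>) *
     (exp (- \<i> * \<mu> * x) * (\<alpha> * exp (- \<i> * \<alpha> * \<mu>) + \<alpha>^2 * exp (- \<i> * \<alpha>^2 * \<mu>))
      - (\<alpha> * exp (- \<i> * \<alpha> * \<mu> * x) + \<alpha>^2 * exp (- \<i> * \<alpha>^2 * \<mu> * x)) * exp (- \<i> * \<mu>))"

definition phi2_minus :: "real \<Rightarrow> complex \<Rightarrow> complex" where
  "phi2_minus x \<mu> = - exp (- \<i> * \<mu>) / (2 * pi * Delta2 \<mu>) *
     (exp (- \<i> * \<mu> * x) + \<alpha> * exp (- \<i> * \<alpha> * \<mu> * x) + \<alpha>^2 * exp (- \<i> * \<alpha>^2 * \<mu> * x))"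

definition F2 :: "complex \<Rightarrow> (real \<Rightarrow> complex) \<Rightarrow> complex" where
  "F2 = transform phi2_plus phi2_minus"

end

theory Submission
  imports Defs
begin

text \<open>
  Integrating by parts three times, \<open>F\<^sub>\<lambda> (S f) - \<lambda>\<^sup>3 F\<^sub>\<lambda> f\<close> reduces to boundary terms. The kernels
  satisfy \<open>\<phi>\<^sup>+(0) = 1/(2\<pi>)\<close>, \<open>\<phi>\<^sup>+(1) = 0\<close> and the boundary conditions adjoint to those of the
  problem, so that on \<open>\<Gamma>\<^sub>0\<close> and \<open>\<Gamma>\<^sup>+\<close> the remainder is
  \<open>(\<lambda> f'(0) - i f''(0)) / (2\<pi>)\<close>: a polynomial in \<open>\<lambda>\<close>, in which \<open>\<Delta>\<close> no longer occurs.
  Since \<open>\<phi>\<^sup>+ - \<phi>\<^sup>- = e\<^sup>-\<^sup>i\<^sup>\<lambda>\<^sup>x / (2\<pi>)\<close>, on \<open>\<Gamma>\<^sup>-\<close> it is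
  \<open>e\<^sup>-\<^sup>i\<^sup>\<lambda> (\<lambda> f'(1) - i f''(1)) / (2\<pi>)\<close>. Cauchy's theorem on \<open>\<Gamma>\<^sub>0\<close>, and Jordan's lemma in
  the sectors after division by \<open>\<lambda>\<^sup>3\<close>, make the integrals of the remainders vanish.
  Convergence along \<open>\<Gamma>\<^sup>\<plusminus>\<close> holds because on the rays \<open>\<Delta>\<close> grows like its largest exponential,
  so that \<open>e\<^sup>i\<^sup>\<lambda>\<^sup>x F\<^sub>\<lambda> (S f)\<close> stays bounded. For completeness, the same jump relation turns the vanishing
  of all \<open>F\<^sub>\<lambda> f\<close> into the vanishing of the Fourier transform of \<open>f\<close>.
\<close>

section \<open>The Frechet space of smooth functions\<close>

text \<open>The zeros of \<open>\<Delta>\<close> shape the argument. Their positions are never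
  determined: contour deformation is applied only to the remainders, whose closed forms are free of
  \<open>\<Delta>\<close>, while the transforms themselves are controlled on the contours alone.
  Every contour point has modulus at most 1 or lies on a ray with \<open>Im (\<mu> ^ 3) = 0\<close>.
  Up to modulus 2 the Taylor series keeps \<open>\<Delta>\<close> close to a multiple of
  \<open>\<mu>\<^sup>2\<close>, hence nonzero off the origin. On a ray the three exponentials have
  moduli \<open>Y\<close>, 1 and \<open>1/Y\<close>, where
  \<open>Y = exp (sqrt 3 / 2 * norm \<mu>)\<close>, so that one of them dominates from modulus 2 on.
  The integral of \<open>exp (\<i> * \<mu> * x) * F \<mu> f\<close> along the unbounded contours is
  never estimated directly. As f is smooth, the transform can be applied to \<open>S_op f\<close>;
  the factor \<open>inverse (\<mu> ^ 3)\<close> then gives absolute convergence, and subtracting the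
  remainder integral carries convergence and value over to f. The two problems differ only in
  algebraic identities and in bounds, which a locale isolates.\<close>

lemma funpow_deriv01_has_vector_derivative:
  assumes "f \<in> smooth01" "x \<in> {0..1}"
  shows "((deriv01 ^^ k) f has_vector_derivative (deriv01 ^^ Suc k) f x) (at x within {0..1})"
proof -
  have "(deriv01 ^^ k) f differentiable (at x within {0..1})"
    using assms by (auto simp: smooth01_def)
  then show ?thesis
    using assms(2) by (simp add: vector_derivative_works deriv01_def)
qed

lemma funpow_deriv01_eq_0:
  assumes "f \<in> smooth01" "x \<notin> {0..1}"
  shows "(deriv01 ^^ k) f x = 0"
  using assms by (cases k) (auto simp: smooth01_def funs_on_def deriv01_def)

lemma continuous_on_funpow_deriv01:
  assumes "f \<in> smooth01"
  shows "continuous_on {0..1} ((deriv01 ^^ k) f)"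
  using funpow_deriv01_has_vector_derivative[OF assms]
  by (meson continuous_on_eq_continuous_within has_vector_derivative_continuous)

lemma continuous_on_smooth01: "f \<in> smooth01 \<Longrightarrow> continuous_on {0..1} f"
  using continuous_on_funpow_deriv01[of f 0] by simp

text \<open>Derivatives within \<open>{0..1}\<close> are unique even at the end points, so the
  one-sided values that \<open>deriv01\<close> takes there obey the usual rules. Sums, differences
  and multiples become special cases.\<close>

lemma funpow_deriv01_combination:
  assumes "f \<in> smooth01" "g \<in> smooth01"
  shows "(deriv01 ^^ k) (\<lambda>x. a * f x + b * g x)
       = (\<lambda>x. a * (deriv01 ^^ k) f x + b * (deriv01 ^^ k) g x)"
proof (induction k)
  case (Suc k)
  have "deriv01 (\<lambda>x. a * (deriv01 ^^ k) f x + b * (deriv01 ^^ k) g x) x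
      = a * (deriv01 ^^ Suc k) f x + b * (deriv01 ^^ Suc k) g x" for x
  proof (cases "x \<in> {0..1}")
    case True
    have "((\<lambda>x. a * (deriv01 ^^ k) f x + b * (deriv01 ^^ k) g x) has_vector_derivative
        a * (deriv01 ^^ Suc k) f x + b * (deriv01 ^^ Suc k) g x) (at x within {0..1})"
      using funpow_deriv01_has_vector_derivative[OF assms(1) True, of k]
        funpow_deriv01_has_vector_derivative[OF assms(2) True, of k]
      by (intro has_vector_derivative_add has_vector_derivative_mult_right)
    from vector_derivative_within_closed_interval[OF _ True this] True show ?thesis
      by (simp add: deriv01_def[of "\<lambda>x. a * (deriv01 ^^ k) f x + b * (deriv01 ^^ k) g x"])
  next
    case False
    then have "x \<notin> {0..1}" by simp
    then show ?thesis by (simp only: deriv01_def funpow.simps o_def if_False) simp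
  qed
  then show ?case using Suc by auto
qed simp

lemma smooth01_combination:
  assumes "f \<in> smooth01" "g \<in> smooth01"
  shows "(\<lambda>x. a * f x + b * g x) \<in> smooth01"
proof -
  have "(\<lambda>x. a * (deriv01 ^^ k) f x + b * (deriv01 ^^ k) g x) differentiable (at x within {0..1})"
    if "x \<in> {0..1}" for k x
    using assms that by (auto simp: smooth01_def)
  then show ?thesis
    using assms unfolding smooth01_def
    by (auto simp: funs_on_def funpow_deriv01_combination[OF assms])
qed

lemma smooth01_0: "(\<lambda>x. 0) \<in> smooth01"
proof -
  have "deriv01 (\<lambda>x. 0) = (\<lambda>x. 0)"
    by (auto simp: deriv01_def fun_eq_iff intro!: vector_derivative_within_closed_interval)
  then have "(deriv01 ^^ k) (\<lambda>x. 0) = (\<lambda>x. 0)" for k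
    by (induction k) auto
  then show ?thesis by (auto simp: smooth01_def funs_on_def)
qed

lemma funpow_deriv01_add:
  assumes "f \<in> smooth01" "g \<in> smooth01"
  shows "(deriv01 ^^ k) (\<lambda>x. f x + g x) = (\<lambda>x. (deriv01 ^^ k) f x + (deriv01 ^^ k) g x)"
  using funpow_deriv01_combination[OF assms, of k 1 1] by simp

lemma funpow_deriv01_diff:
  assumes "f \<in> smooth01" "g \<in> smooth01"
  shows "(deriv01 ^^ k) (\<lambda>x. f x - g x) = (\<lambda>x. (deriv01 ^^ k) f x - (deriv01 ^^ k) g x)"
  using funpow_deriv01_combination[OF assms, of k 1 "-1"] by simp

lemma funpow_deriv01_scale:
  assumes "f \<in> smooth01"
  shows "(deriv01 ^^ k) (\<lambda>x. c * f x) = (\<lambda>x. c * (deriv01 ^^ k) f x)"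
  using funpow_deriv01_combination[OF assms assms, of k c 0] by simp

lemma smooth01_add: "f \<in> smooth01 \<Longrightarrow> g \<in> smooth01 \<Longrightarrow> (\<lambda>x. f x + g x) \<in> smooth01"
  using smooth01_combination[of f g 1 1] by simp

lemma smooth01_diff: "f \<in> smooth01 \<Longrightarrow> g \<in> smooth01 \<Longrightarrow> (\<lambda>x. f x - g x) \<in> smooth01"
  using smooth01_combination[of f g 1 "-1"] by simp

lemma smooth01_scale: "f \<in> smooth01 \<Longrightarrow> (\<lambda>x. c * f x) \<in> smooth01"
  using smooth01_combination[of f f c 0] by simp

lemma smooth01_funpow_deriv01:
  assumes "f \<in> smooth01"
  shows "(deriv01 ^^ k) f \<in> smooth01"
proof -
  have "(deriv01 ^^ j) ((deriv01 ^^ k) f) = (deriv01 ^^ (j + k)) f" for j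
    by (simp add: funpow_add)
  then show ?thesis
    using assms funpow_deriv01_eq_0[OF assms] unfolding smooth01_def
    by (auto simp: funs_on_def)
qed

lemma S_op_smooth01: "f \<in> smooth01 \<Longrightarrow> S_op f \<in> smooth01"
  unfolding S_op_def by (intro smooth01_scale smooth01_funpow_deriv01)

lemma linear_subspace_smooth01: "linear_subspace smooth01"
  by (auto simp: linear_subspace_def smooth01_0 smooth01_add smooth01_scale)

lemma linear_operator_S_op:
  assumes "V \<subseteq> smooth01"
  shows "linear_operator V smooth01 S_op"
  unfolding linear_operator_def S_op_def
  using assms S_op_smooth01[unfolded S_op_def]
  by (auto simp: funpow_deriv01_add[OF subsetD subsetD] funpow_deriv01_scale[OF subsetD]
      algebra_simps simp del: power3_eq_cube power_minus_odd)

section \<open>Open balls and continuity in the Frechet topology\<close>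

lemma smooth01_ball_self: "f \<in> smooth01 \<Longrightarrow> \<epsilon> > 0 \<Longrightarrow> f \<in> smooth01_ball k f \<epsilon>"
  by (auto simp: smooth01_ball_def)

lemma openin_smooth01_ball:
  assumes "f \<in> smooth01" "\<epsilon> > 0"
  shows "openin smooth01_topology (smooth01_ball k f \<epsilon>)"
  unfolding smooth01_topology_def using assms by (auto intro!: topology_generated_by_Basis)

text \<open>Membership in a ball is a strict inequality at each point. By compactness the largest
  deviation is attained, so a positive slack remains for the triangle inequality.\<close>

lemma smooth01_ball_contains_ball:
  assumes "f \<in> smooth01" "g \<in> smooth01_ball k f \<epsilon>"
  shows "\<exists>\<delta>>0. smooth01_ball k g \<delta> \<subseteq> smooth01_ball k f \<epsilon>"
proof -
  have g: "g \<in> smooth01" using assms(2) by (simp add: smooth01_ball_def)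
  let ?n = "\<lambda>x. norm ((deriv01 ^^ k) g x - (deriv01 ^^ k) f x)"
  have "continuous_on {0..1} ?n"
    by (intro continuous_intros continuous_on_funpow_deriv01 assms g)
  then obtain m where m: "m \<in> {0..1}" "\<And>x. x \<in> {0..1} \<Longrightarrow> ?n x \<le> ?n m"
    using continuous_attains_sup[of "{0..1::real}" ?n] by auto
  have "?n m < \<epsilon>" using assms(2) m(1) by (auto simp: smooth01_ball_def)
  moreover have "smooth01_ball k g (\<epsilon> - ?n m) \<subseteq> smooth01_ball k f \<epsilon>"
  proof
    fix h assume h: "h \<in> smooth01_ball k g (\<epsilon> - ?n m)"
    have "norm ((deriv01 ^^ k) h x - (deriv01 ^^ k) f x) < \<epsilon>" if x: "x \<in> {0..1}" for x
    proof -
      have "norm ((deriv01 ^^ k) h x - (deriv01 ^^ k) g x) < \<epsilon> - ?n m"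
        using h x by (auto simp: smooth01_ball_def)
      with m(2)[OF x] norm_triangle_ineq[of "(deriv01 ^^ k) h x - (deriv01 ^^ k) g x"
          "(deriv01 ^^ k) g x - (deriv01 ^^ k) f x"]
      show ?thesis by (simp add: algebra_simps)
    qed
    then show "h \<in> smooth01_ball k f \<epsilon>" using h by (auto simp: smooth01_ball_def)
  qed
  ultimately show ?thesis by (intro exI[of _ "\<epsilon> - ?n m"]) auto
qed

text \<open>A generating set is a ball about an arbitrary centre. Recentring it at the image point
  turns continuity into a local condition on one derivative at a time.\<close>

lemma continuous_map_smooth01_topologyI:
  assumes sm: "\<And>p. p \<in> topspace X \<Longrightarrow> F p \<in> smooth01"
    and loc: "\<And>p k \<epsilon>. p \<in> topspace X \<Longrightarrow> \<epsilon> > 0 \<Longrightarrow>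
      \<exists>U. openin X U \<and> p \<in> U \<and> F ` U \<subseteq> smooth01_ball k (F p) \<epsilon>"
  shows "continuous_map X smooth01_topology F"
  unfolding smooth01_topology_def
proof (rule continuous_on_generated_topo)
  show "F ` topspace X \<subseteq> \<Union>{smooth01_ball k f \<epsilon> |k f \<epsilon>. f \<in> smooth01 \<and> 0 < \<epsilon>}"
    using sm topspace_smooth01_topology unfolding smooth01_topology_def by auto
  fix U assume "U \<in> {smooth01_ball k f \<epsilon> |k f \<epsilon>. f \<in> smooth01 \<and> 0 < \<epsilon>}"
  then obtain k f \<epsilon> where U: "U = smooth01_ball k f \<epsilon>" "f \<in> smooth01" "\<epsilon> > 0" by blast
  show "openin X (F -` U \<inter> topspace X)"
  proof (subst openin_subopen, intro ballI)
    fix p assume p: "p \<in> F -` U \<inter> topspace X"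
    then obtain \<delta> where \<delta>: "\<delta> > 0" "smooth01_ball k (F p) \<delta> \<subseteq> U"
      using smooth01_ball_contains_ball[OF U(2), of "F p" k \<epsilon>] U(1) by auto
    then obtain W where "openin X W" "p \<in> W" "F ` W \<subseteq> smooth01_ball k (F p) \<delta>"
      using loc[of p \<delta> k] p by blast
    then show "\<exists>T. openin X T \<and> p \<in> T \<and> T \<subseteq> F -` U \<inter> topspace X"
      using \<delta>(2) openin_subset by (intro exI[of _ W]) blast
  qed
qed

lemma linear_topological_space_smooth01: "linear_topological_space smooth01_topology"
proof -
  let ?T = smooth01_topology
  have add: "continuous_map (prod_topology ?T ?T) ?T (\<lambda>(f, g). (\<lambda>x. f x + g x))"
  proof (rule continuous_map_smooth01_topologyI)
    show "(case p of (f, g) \<Rightarrow> \<lambda>x. f x + g x) \<in> smooth01"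
      if "p \<in> topspace (prod_topology ?T ?T)" for p
      using that by (auto simp: topspace_smooth01_topology smooth01_add)
    fix p k and \<epsilon> :: real assume p: "p \<in> topspace (prod_topology ?T ?T)" and \<epsilon>: "\<epsilon> > 0"
    obtain f g where fg: "p = (f, g)" "f \<in> smooth01" "g \<in> smooth01"
      using p by (auto simp: topspace_smooth01_topology)
    let ?U = "smooth01_ball k f (\<epsilon>/2) \<times> smooth01_ball k g (\<epsilon>/2)"
    have "(\<lambda>x. u x + v x) \<in> smooth01_ball k (\<lambda>x. f x + g x) \<epsilon>"
      if uv: "u \<in> smooth01_ball k f (\<epsilon>/2)" "v \<in> smooth01_ball k g (\<epsilon>/2)" for u v
    proof -
      have s: "u \<in> smooth01" "v \<in> smooth01" using uv by (auto simp: smooth01_ball_def)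
      have "norm ((deriv01 ^^ k) u x + (deriv01 ^^ k) v x - ((deriv01 ^^ k) f x + (deriv01 ^^ k) g x)) < \<epsilon>"
        if "x \<in> {0..1}" for x
      proof -
        have "norm ((deriv01 ^^ k) u x - (deriv01 ^^ k) f x) < \<epsilon>/2"
          "norm ((deriv01 ^^ k) v x - (deriv01 ^^ k) g x) < \<epsilon>/2"
          using uv that by (auto simp: smooth01_ball_def)
        with norm_add_less[OF this] show ?thesis by (simp add: algebra_simps)
      qed
      then show ?thesis
        using s fg by (simp add: smooth01_ball_def funpow_deriv01_add smooth01_add)
    qed
    then show "\<exists>U. openin (prod_topology ?T ?T) U \<and> p \<in> U \<and>
        (\<lambda>(f, g). (\<lambda>x. f x + g x)) ` U \<subseteq> smooth01_ball k (case p of (f, g) \<Rightarrow> \<lambda>x. f x + g x) \<epsilon>"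
      using fg \<epsilon> by (intro exI[of _ ?U])
        (auto simp: openin_prod_Times_iff openin_smooth01_ball smooth01_ball_self)
  qed
  have scale: "continuous_map (prod_topology euclidean ?T) ?T (\<lambda>(c :: complex, f). (\<lambda>x. c * f x))"
  proof (rule continuous_map_smooth01_topologyI)
    show "(case p of (c, f) \<Rightarrow> \<lambda>x. c * f x) \<in> smooth01"
      if "p \<in> topspace (prod_topology euclidean ?T)" for p :: "complex \<times> (real \<Rightarrow> complex)"
      using that by (auto simp: topspace_smooth01_topology smooth01_scale)
    fix p :: "complex \<times> (real \<Rightarrow> complex)" and k and \<epsilon> :: real
    assume p: "p \<in> topspace (prod_topology euclidean ?T)" and \<epsilon>: "\<epsilon> > 0"
    obtain c f where cf: "p = (c, f)" "f \<in> smooth01"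
      using p by (auto simp: topspace_smooth01_topology)
    have "bounded ((deriv01 ^^ k) f ` {0..1})"
      by (intro compact_imp_bounded compact_continuous_image continuous_on_funpow_deriv01 cf) auto
    then obtain M where M: "M > 0" "\<And>x. x \<in> {0..1} \<Longrightarrow> norm ((deriv01 ^^ k) f x) \<le> M"
      by (auto simp: bounded_pos)
    \<comment> \<open>The split \<open>d * h - c * f = d * (h - f) + (d - c) * f\<close> leaves half
      of \<open>\<epsilon>\<close> for each summand. The bound 1 on \<open>\<eta>\<close> ensures
      \<open>norm d \<le> norm c + 1\<close>.\<close>
    define \<eta> where "\<eta> = min 1 (\<epsilon> / (2 * M))"
    define \<delta> where "\<delta> = \<epsilon> / (2 * (norm c + 1))"
    have c1: "norm c + 1 > 0" by (simp add: add_nonneg_pos)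
    have pos: "\<eta> > 0" "\<delta> > 0" using M(1) \<epsilon> c1 by (auto simp: \<eta>_def \<delta>_def)
    let ?U = "ball c \<eta> \<times> smooth01_ball k f \<delta>"
    have "(\<lambda>x. d * h x) \<in> smooth01_ball k (\<lambda>x. c * f x) \<epsilon>"
      if dh: "d \<in> ball c \<eta>" "h \<in> smooth01_ball k f \<delta>" for d h
    proof -
      have s: "h \<in> smooth01" using dh by (auto simp: smooth01_ball_def)
      have d: "norm (d - c) < \<eta>" using dh(1) by (simp add: dist_norm norm_minus_commute)
      then have d1: "norm d \<le> norm c + 1"
        using norm_triangle_ineq2[of d c] unfolding \<eta>_def by simp
      have "norm (d * (deriv01 ^^ k) h x - c * (deriv01 ^^ k) f x) < \<epsilon>" if x: "x \<in> {0..1}" for x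
      proof -
        let ?h = "(deriv01 ^^ k) h x" and ?f = "(deriv01 ^^ k) f x"
        have hf: "norm (?h - ?f) < \<delta>" using dh(2) x by (auto simp: smooth01_ball_def)
        have "d * ?h - c * ?f = d * (?h - ?f) + (d - c) * ?f" by (simp add: algebra_simps)
        then have "norm (d * ?h - c * ?f) \<le> norm d * norm (?h - ?f) + norm (d - c) * norm ?f"
          by (metis norm_triangle_ineq norm_mult)
        also have "\<dots> \<le> (norm c + 1) * norm (?h - ?f) + norm (d - c) * M"
          using d1 M(2)[OF x] by (intro add_mono mult_mono) auto
        also have "\<dots> < (norm c + 1) * \<delta> + \<eta> * M"
          using hf d M(1) c1 by (intro add_strict_mono mult_strict_left_mono mult_strict_right_mono) auto
        also have "\<dots> \<le> \<epsilon>/2 + \<epsilon>/2"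
          using M(1) c1 by (intro add_mono) (auto simp: \<delta>_def \<eta>_def min_def field_simps)
        finally show ?thesis by simp
      qed
      then show ?thesis
        using s cf by (simp add: smooth01_ball_def funpow_deriv01_scale smooth01_scale)
    qed
    then show "\<exists>U. openin (prod_topology euclidean ?T) U \<and> p \<in> U \<and>
        (\<lambda>(c, f). (\<lambda>x. c * f x)) ` U \<subseteq> smooth01_ball k (case p of (c, f) \<Rightarrow> \<lambda>x. c * f x) \<epsilon>"
      using cf pos by (intro exI[of _ ?U])
        (auto simp: openin_prod_Times_iff openin_smooth01_ball smooth01_ball_self)
  qed
  show ?thesis
    unfolding linear_topological_space_def topspace_smooth01_topology
    using linear_subspace_smooth01 add scale by blast
qed

text \<open>Domination by a single seminorm suffices: \<open>k = 0\<close> serves integration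
  against a kernel, and \<open>k = 3\<close> the same after \<open>S_op\<close>.\<close>

lemma dual_smooth01I:
  fixes l :: "(real \<Rightarrow> complex) \<Rightarrow> complex" and C :: real
  assumes add: "\<And>f g. f \<in> smooth01 \<Longrightarrow> g \<in> smooth01 \<Longrightarrow> l (\<lambda>x. f x + g x) = l f + l g"
    and scale: "\<And>c f. f \<in> smooth01 \<Longrightarrow> l (\<lambda>x. c * f x) = c * l f"
    and bound: "\<And>f e. f \<in> smooth01 \<Longrightarrow> (\<And>x. x \<in> {0..1} \<Longrightarrow> norm ((deriv01 ^^ k) f x) \<le> e) \<Longrightarrow>
      norm (l f) \<le> C * e"
  shows "l \<in> dual smooth01_topology"
proof -
  have diff: "l (\<lambda>x. f x - g x) = l f - l g" if "f \<in> smooth01" "g \<in> smooth01" for f g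
    using add[OF that(1) smooth01_scale[OF that(2), of "-1"]] scale[OF that(2), of "-1"] by simp
  have "continuous_map smooth01_topology euclidean l"
    unfolding continuous_map_def
  proof (intro conjI allI impI)
    fix U :: "complex set" assume "openin euclidean U"
    then have U: "open U" by simp
    show "openin smooth01_topology {f \<in> topspace smooth01_topology. l f \<in> U}"
    proof (subst openin_subopen, intro ballI)
      fix f assume f: "f \<in> {f \<in> topspace smooth01_topology. l f \<in> U}"
      then obtain \<epsilon> where \<epsilon>: "\<epsilon> > 0" "ball (l f) \<epsilon> \<subseteq> U"
        using U by (auto simp: open_contains_ball)
      have fs: "f \<in> smooth01" using f by (simp add: topspace_smooth01_topology)
      \<comment> \<open>\<open>C\<close> may be zero or negative; the denominator
        \<open>\<bar>C\<bar> + 1\<close> is positive in any case and makes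
        \<open>C * \<delta> < \<epsilon>\<close> strict.\<close>
      define \<delta> where "\<delta> = \<epsilon> / (\<bar>C\<bar> + 1)"
      have \<delta>: "\<delta> > 0" using \<epsilon>(1) by (simp add: \<delta>_def add_nonneg_pos)
      have "C * \<delta> \<le> \<bar>C\<bar> * \<delta>" using \<delta> by (intro mult_right_mono) auto
      also have "\<dots> < (\<bar>C\<bar> + 1) * \<delta>" using \<delta> by (simp add: algebra_simps)
      also have "\<dots> = \<epsilon>" by (simp add: \<delta>_def field_simps add_nonneg_pos)
      finally have C\<delta>: "C * \<delta> < \<epsilon>" .
      have "l g \<in> U \<and> g \<in> smooth01" if g: "g \<in> smooth01_ball k f \<delta>" for g
      proof -
        have gs: "g \<in> smooth01" using g by (simp add: smooth01_ball_def)
        have "norm (l (\<lambda>x. g x - f x)) \<le> C * \<delta>"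
          using g by (intro bound smooth01_diff gs fs)
            (force simp: funpow_deriv01_diff[OF gs fs] smooth01_ball_def)
        then have "dist (l f) (l g) < \<epsilon>"
          using C\<delta> by (simp add: diff gs fs dist_norm norm_minus_commute)
        then show ?thesis using \<epsilon>(2) gs by auto
      qed
      then show "\<exists>T. openin smooth01_topology T \<and> f \<in> T \<and>
          T \<subseteq> {f \<in> topspace smooth01_topology. l f \<in> U}"
        using openin_smooth01_ball[OF fs \<delta>, of k] smooth01_ball_self[OF fs \<delta>, of k]
        by (intro exI[of _ "smooth01_ball k f \<delta>"]) (auto simp: topspace_smooth01_topology)
    qed
  qed auto
  then show ?thesis
    using add scale by (auto simp: dual_def topspace_smooth01_topology)
qed

lemma dual_subtopology_smooth01:
  assumes "l \<in> dual smooth01_topology" "V \<subseteq> smooth01"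
  shows "l \<in> dual (subtopology smooth01_topology V)"
  using assms unfolding dual_def
  by (auto simp: topspace_smooth01_topology continuous_map_from_subtopology subset_iff)

lemma dual_diff:
  assumes "l \<in> dual T" "m \<in> dual T"
  shows "(\<lambda>f. l f - m f) \<in> dual T"
  using assms unfolding dual_def by (auto simp: algebra_simps continuous_map_diff)

lemma dual_scale:
  assumes "l \<in> dual T"
  shows "(\<lambda>f. c * l f) \<in> dual T"
proof -
  have "continuous_map T euclidean ((\<lambda>z. c * z) \<circ> l)"
    using assms by (intro continuous_map_compose[of _ euclidean]) (auto simp: dual_def intro!: continuous_intros)
  then show ?thesis
    using assms unfolding dual_def by (auto simp: algebra_simps o_def)
qed

section \<open>Integrals along the contours\<close>

lemma has_integral_along_Nil [simp]: "has_integral_along f v [] \<longleftrightarrow> v = 0"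
  by (simp add: has_integral_along_def)

lemma has_integral_along_Cons:
  "has_integral_along f v ((J, g) # \<gamma>) \<longleftrightarrow>
     (\<exists>a b. ((\<lambda>t. f (g t) * vector_derivative g (at t within J)) has_integral a) J \<and>
            has_integral_along f b \<gamma> \<and> v = a + b)"
proof
  assume "has_integral_along f v ((J, g) # \<gamma>)"
  then show "\<exists>a b. ((\<lambda>t. f (g t) * vector_derivative g (at t within J)) has_integral a) J \<and>
      has_integral_along f b \<gamma> \<and> v = a + b"
    unfolding has_integral_along_def by (fastforce simp: list_all2_Cons1)
next
  assume "\<exists>a b. ((\<lambda>t. f (g t) * vector_derivative g (at t within J)) has_integral a) J \<and>
      has_integral_along f b \<gamma> \<and> v = a + b"
  then obtain a vs where
    "((\<lambda>t. f (g t) * vector_derivative g (at t within J)) has_integral a) J"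
    "list_all2 (\<lambda>(J, g) w. ((\<lambda>t. f (g t) * vector_derivative g (at t within J))
      has_integral w) J) \<gamma> vs" "v = a + sum_list vs"
    unfolding has_integral_along_def by blast
  then show "has_integral_along f v ((J, g) # \<gamma>)"
    unfolding has_integral_along_def by (intro exI[of _ "a # vs"]) auto
qed

lemma trace_of_Nil [simp]: "trace_of [] = {}"
  by (simp add: trace_of_def)

lemma trace_of_Cons [simp]: "trace_of ((J, g) # \<gamma>) = g ` J \<union> trace_of \<gamma>"
  by (simp add: trace_of_def)

lemma trace_of_append [simp]: "trace_of (\<gamma> @ \<delta>) = trace_of \<gamma> \<union> trace_of \<delta>"
  by (simp add: trace_of_def)

lemma has_integral_along_append:
  assumes "has_integral_along f v \<gamma>" "has_integral_along f w \<delta>"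
  shows "has_integral_along f (v + w) (\<gamma> @ \<delta>)"
  using assms(1)
proof (induction \<gamma> arbitrary: v)
  case (Cons p \<gamma>)
  obtain J g where p: "p = (J, g)" by (cases p)
  from Cons.prems obtain a b where
    "((\<lambda>t. f (g t) * vector_derivative g (at t within J)) has_integral a) J"
    "has_integral_along f b \<gamma>" "v = a + b"
    unfolding p has_integral_along_Cons by blast
  then show ?case
    using Cons.IH[of b] unfolding p append_Cons has_integral_along_Cons
    by (intro exI[of _ a] exI[of _ "b + w"]) auto
qed (use assms(2) in simp)

lemma has_integral_along_cong:
  assumes "has_integral_along f v \<gamma>" "\<And>\<mu>. \<mu> \<in> trace_of \<gamma> \<Longrightarrow> f \<mu> = g \<mu>"
  shows "has_integral_along g v \<gamma>"
  using assms
proof (induction \<gamma> arbitrary: v)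
  case (Cons p \<gamma>)
  obtain J c where p: "p = (J, c)" by (cases p)
  from Cons.prems(1) obtain a b where
    a: "((\<lambda>t. f (c t) * vector_derivative c (at t within J)) has_integral a) J"
    and b: "has_integral_along f b \<gamma>" and v: "v = a + b"
    unfolding p has_integral_along_Cons by blast
  have "((\<lambda>t. g (c t) * vector_derivative c (at t within J)) has_integral a) J"
    by (rule has_integral_eq[OF _ a]) (simp add: Cons.prems(2) p)
  moreover have "has_integral_along g b \<gamma>"
    using Cons.IH[OF b] Cons.prems(2) by (simp add: p)
  ultimately show ?case
    unfolding p has_integral_along_Cons using v by blast
qed simp

lemma has_integral_along_diff:
  assumes "has_integral_along f v \<gamma>" "has_integral_along g w \<gamma>"
  shows "has_integral_along (\<lambda>\<mu>. f \<mu> - g \<mu>) (v - w) \<gamma>"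
  using assms
proof (induction \<gamma> arbitrary: v w)
  case (Cons p \<gamma>)
  obtain J c where p: "p = (J, c)" by (cases p)
  from Cons.prems obtain a b a' b' where
    *: "((\<lambda>t. f (c t) * vector_derivative c (at t within J)) has_integral a) J"
    "has_integral_along f b \<gamma>" "v = a + b"
    "((\<lambda>t. g (c t) * vector_derivative c (at t within J)) has_integral a') J"
    "has_integral_along g b' \<gamma>" "w = a' + b'"
    unfolding p has_integral_along_Cons by blast
  have "((\<lambda>t. (f (c t) - g (c t)) * vector_derivative c (at t within J)) has_integral (a - a')) J"
    using has_integral_diff[OF *(1,4)] by (simp add: left_diff_distrib)
  then show ?case
    unfolding p has_integral_along_Cons using Cons.IH[OF *(2,5)] *(3,6)
    by (intro exI[of _ "a - a'"] exI[of _ "b - b'"]) auto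
qed simp

lemma has_integral_along_Gamma0:
  "has_integral_along f v Gamma0 \<longleftrightarrow> (f has_contour_integral v) (circlepath 0 (1/2))"
  by (simp add: Gamma0_def has_integral_along_Cons has_contour_integral_def)

section \<open>Velocity along the boundary of a sector\<close>

definition sector_velocity :: "real \<Rightarrow> real \<Rightarrow> real \<Rightarrow> complex" where
  "sector_velocity a b t =
     (if t \<le> 0 then - cis b
      else if t \<le> 1 then - \<i> * of_real (b - a) * cis (b - t * (b - a))
      else cis a)"

lemma sector_boundary_simps:
  "t \<le> 0 \<Longrightarrow> sector_boundary a b t = of_real (1 - t) * cis b"
  "0 \<le> t \<Longrightarrow> t \<le> 1 \<Longrightarrow> sector_boundary a b t = cis (b - t * (b - a))"
  "1 \<le> t \<Longrightarrow> sector_boundary a b t = of_real t * cis a"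
  by (cases "t = 0"; cases "t = 1"; auto simp: sector_boundary_def)+

lemma norm_sector_boundary:
  "norm (sector_boundary a b t) = (if t \<le> 0 then 1 - t else if t \<le> 1 then 1 else t)"
  by (auto simp: sector_boundary_def norm_mult simp flip: of_real_diff)

lemma norm_sector_boundary_ge_1: "z \<in> range (sector_boundary a b) \<Longrightarrow> 1 \<le> norm z"
  by (auto simp: norm_sector_boundary)

lemma continuous_on_sector_boundary: "continuous_on S (sector_boundary a b)"
proof -
  have "continuous_on ({..0} \<union> ({0..1} \<union> {1..})) (sector_boundary a b)"
  proof (intro continuous_on_closed_Un)
    show "continuous_on {..0} (sector_boundary a b)"
      by (rule continuous_on_eq[of _ "\<lambda>t. of_real (1 - t) * cis b"])
        (auto intro!: continuous_intros simp: sector_boundary_simps)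
    show "continuous_on {0..1} (sector_boundary a b)"
      by (rule continuous_on_eq[of _ "\<lambda>t. cis (b - t * (b - a))"])
        (auto intro!: continuous_intros simp: sector_boundary_simps)
    show "continuous_on {1..} (sector_boundary a b)"
      by (rule continuous_on_eq[of _ "\<lambda>t. of_real t * cis a"])
        (auto intro!: continuous_intros simp: sector_boundary_simps)
  qed auto
  moreover have "{..0} \<union> ({0..1} \<union> {1..}) = (UNIV :: real set)" by auto
  ultimately show ?thesis using continuous_on_subset by (metis subset_UNIV)
qed

lemma sector_boundary_has_vector_derivative:
  assumes "t \<notin> {0, 1}"
  shows "(sector_boundary a b has_vector_derivative sector_velocity a b t) (at t)"
proof -
  consider "t < 0" | "0 < t" "t < 1" | "1 < t" using assms by fastforce
  then show ?thesis
  proof cases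
    case 1
    have "((\<lambda>t. of_real (1 - t) * cis b) has_vector_derivative - cis b) (at t)"
      by (auto intro!: derivative_eq_intros)
    then have "(sector_boundary a b has_vector_derivative - cis b) (at t)"
      by (rule has_vector_derivative_transform_within_open[of _ _ _ "{..<0}"])
        (use 1 in \<open>auto simp: sector_boundary_simps\<close>)
    then show ?thesis using 1 by (simp add: sector_velocity_def)
  next
    case 2
    have "((\<lambda>t. exp (\<i> * of_real (b - t * (b - a)))) has_vector_derivative
        - \<i> * of_real (b - a) * cis (b - t * (b - a))) (at t)"
      unfolding cis_conv_exp
      by (auto intro!: derivative_eq_intros has_vector_derivative_real_field simp: algebra_simps)
    then have "(sector_boundary a b has_vector_derivative
        - \<i> * of_real (b - a) * cis (b - t * (b - a))) (at t)"
      by (rule has_vector_derivative_transform_within_open[of _ _ _ "{0<..<1}"])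
        (use 2 in \<open>auto simp: sector_boundary_simps cis_conv_exp\<close>)
    then show ?thesis using 2 by (simp add: sector_velocity_def)
  next
    case 3
    have "((\<lambda>t. of_real t * cis a) has_vector_derivative cis a) (at t)"
      by (auto intro!: derivative_eq_intros)
    then have "(sector_boundary a b has_vector_derivative cis a) (at t)"
      by (rule has_vector_derivative_transform_within_open[of _ _ _ "{1<..}"])
        (use 3 in \<open>auto simp: sector_boundary_simps\<close>)
    then show ?thesis using 3 by (simp add: sector_velocity_def)
  qed
qed

text \<open>The curve may fail to be differentiable at its corners, where
  \<open>vector_derivative\<close> has no useful value. Two parameters do not affect the integral,
  so the explicit velocity can replace it.\<close>

lemma has_integral_vector_derivative_sector_boundary:
  "((\<lambda>t. f (sector_boundary a b t) * vector_derivative (sector_boundary a b) (at t)) has_integral v) UNIV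
   \<longleftrightarrow> ((\<lambda>t. f (sector_boundary a b t) * sector_velocity a b t) has_integral v) UNIV"
  by (rule has_integral_spike_finite_eq[of "{0, 1}"])
    (auto simp: vector_derivative_at[OF sector_boundary_has_vector_derivative])

section \<open>Absolute convergence along the boundary of a sector\<close>

lemma integrable_inverse_1_plus_square: "(\<lambda>t::real. 1 / (1 + t\<^sup>2)) integrable_on UNIV"
proof -
  have I: "((\<lambda>t. 1 / (1 + t\<^sup>2)) has_integral (arctan b - arctan a)) {a..b}" if "a \<le> b" for a b
    using that
    by (intro fundamental_theorem_of_calculus)
      (auto intro!: derivative_eq_intros simp: has_real_derivative_iff_has_vector_derivative[symmetric]
        inverse_eq_divide)
  have "((\<lambda>t::real. 1 / (1 + t\<^sup>2)) has_integral pi) UNIV"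
    unfolding has_integral_alt'
  proof (intro conjI allI impI)
    show "(\<lambda>x. if x \<in> UNIV then 1 / (1 + x\<^sup>2) else 0) integrable_on cbox a b" for a b :: real
      using I[of a b] by (cases "a \<le> b") (auto simp: integrable_on_def)
    fix e :: real assume e: "e > 0"
    have "\<forall>\<^sub>F x in at_top. dist (arctan x) (pi/2) < e/2"
      using tendstoD[OF tendsto_arctan_at_top, of "e/2"] e by simp
    then obtain B where B: "\<And>x. x \<ge> B \<Longrightarrow> dist (arctan x) (pi/2) < e/2"
      by (auto simp: eventually_at_top_linorder)
    show "\<exists>B>0. \<forall>a b. ball 0 B \<subseteq> cbox a b \<longrightarrow>
        norm (integral (cbox a b) (\<lambda>x::real. if x \<in> UNIV then 1 / (1 + x\<^sup>2) else 0) - pi) < e"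
    proof (intro exI[of _ "max B 0 + 1"] conjI allI impI)
      fix a b :: real assume sub: "ball 0 (max B 0 + 1) \<subseteq> cbox a b"
      have "max B 0 \<in> ball 0 (max B 0 + 1)" "- max B 0 \<in> ball 0 (max B 0 + 1)"
        by (auto simp: dist_norm)
      with sub have "max B 0 \<in> cbox a b" "- max B 0 \<in> cbox a b" by blast+
      then have ab: "B \<le> b" "B \<le> - a" "a \<le> b" by auto
      have "integral (cbox a b) (\<lambda>x. if x \<in> UNIV then 1 / (1 + x\<^sup>2) else 0) = arctan b - arctan a"
        using I[OF ab(3)] by (simp add: integral_unique)
      then show "norm (integral (cbox a b) (\<lambda>x. if x \<in> UNIV then 1 / (1 + x\<^sup>2) else 0) - pi) < e"
        using B[OF ab(1)] B[OF ab(2)] by (auto simp: dist_real_def arctan_minus abs_if split: if_splits)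
    qed auto
  qed
  then show ?thesis by (auto simp: integrable_on_def)
qed

text \<open>Decay is required only from modulus 2 on, where the curve consists of its rays. The
  parameters in \<open>{-1..2}\<close> cover the rest, arc included, and there continuity on a
  compact interval is enough.\<close>

lemma integrable_sector_boundary:
  assumes cont: "continuous_on (range (sector_boundary a b)) f"
    and bound: "\<And>z. z \<in> range (sector_boundary a b) \<Longrightarrow> 2 \<le> norm z \<Longrightarrow> norm (f z) \<le> C / (norm z)\<^sup>2"
  shows "(\<lambda>t. f (sector_boundary a b t) * sector_velocity a b t) integrable_on UNIV"
proof -
  let ?\<gamma> = "sector_boundary a b"
  have cont': "continuous_on S (\<lambda>t. f (?\<gamma> t))" for S
    by (intro continuous_on_compose2[OF cont continuous_on_sector_boundary]) auto
  have "bounded ((\<lambda>t. f (?\<gamma> t)) ` {-1..2})"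
    by (intro compact_imp_bounded compact_continuous_image cont') auto
  then obtain K where K: "K > 0" "\<And>t. t \<in> {-1..2} \<Longrightarrow> norm (f (?\<gamma> t)) \<le> K"
    by (auto simp: bounded_pos)
  define V where "V = 1 + \<bar>b - a\<bar>"
  \<comment> \<open>The summand with \<open>K\<close> comes from
    \<open>1 + t\<^sup>2 \<le> 5\<close> on \<open>{-1..2}\<close>, the one with \<open>C\<close>
    from \<open>1 + t\<^sup>2 \<le> 2 * (norm z)\<^sup>2\<close> at
    \<open>z = sector_boundary a b t\<close> outside that interval; \<open>V\<close> bounds the
    speed.\<close>
  define M where "M = (5 * K + 2 * \<bar>C\<bar>) * V"
  have V: "norm (sector_velocity a b t) \<le> V" for t
    by (auto simp: sector_velocity_def V_def norm_mult simp flip: of_real_diff)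
  have f: "norm (f (?\<gamma> t)) \<le> (5 * K + 2 * \<bar>C\<bar>) / (1 + t\<^sup>2)" for t
  proof (cases "t \<in> {-1..2}")
    case True
    then have "\<bar>t\<bar> \<le> \<bar>2\<bar>" by auto
    then have "t\<^sup>2 \<le> 2\<^sup>2" by (rule abs_le_square_iff[THEN iffD1])
    then have "1 + t\<^sup>2 \<le> 5" by simp
    then have "K * (1 + t\<^sup>2) \<le> K * 5" using K(1) by (intro mult_left_mono) auto
    then have "K \<le> 5 * K / (1 + t\<^sup>2)" by (simp add: pos_le_divide_eq add_pos_nonneg mult.commute)
    also have "\<dots> \<le> (5 * K + 2 * \<bar>C\<bar>) / (1 + t\<^sup>2)" by (intro divide_right_mono) auto
    finally show ?thesis using K(2)[OF True] by linarith
  next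
    case False
    let ?n = "norm (?\<gamma> t)"
    have n: "2 \<le> ?n" "\<bar>t\<bar> \<le> ?n" using False by (auto simp: norm_sector_boundary)
    have gen: "x / N \<le> y / D" if "x * D \<le> y * N" "N > 0" "D > 0" for x y N D :: real
      using that by (simp add: field_simps)
    have "\<bar>t\<bar>\<^sup>2 \<le> ?n\<^sup>2" "1\<^sup>2 \<le> ?n\<^sup>2"
      using n by (intro power_mono; simp)+
    then have "1 + t\<^sup>2 \<le> 2 * ?n\<^sup>2" by simp
    then have "\<bar>C\<bar> * (1 + t\<^sup>2) \<le> \<bar>C\<bar> * (2 * ?n\<^sup>2)" by (intro mult_left_mono) auto
    then have "\<bar>C\<bar> * (1 + t\<^sup>2) \<le> 2 * \<bar>C\<bar> * ?n\<^sup>2" by simp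
    then have "\<bar>C\<bar> / ?n\<^sup>2 \<le> 2 * \<bar>C\<bar> / (1 + t\<^sup>2)"
      using n by (intro gen) (auto simp: add_pos_nonneg)
    moreover have "norm (f (?\<gamma> t)) \<le> \<bar>C\<bar> / ?n\<^sup>2"
      by (rule order_trans[OF bound]) (use n in \<open>auto intro!: divide_right_mono\<close>)
    moreover have "2 * \<bar>C\<bar> / (1 + t\<^sup>2) \<le> (5 * K + 2 * \<bar>C\<bar>) / (1 + t\<^sup>2)"
      using K(1) by (intro divide_right_mono) auto
    ultimately show ?thesis by linarith
  qed
  show ?thesis
  proof (rule measurable_bounded_by_integrable_imp_integrable)
    have m1: "(\<lambda>t. f (?\<gamma> t)) \<in> borel_measurable borel"
      by (rule borel_measurable_continuous_onI[OF cont'])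
    have "(\<lambda>t. - \<i> * of_real (b - a) * cis (b - t * (b - a))) \<in> borel_measurable borel"
      by (intro borel_measurable_continuous_onI continuous_intros)
    then have m2: "sector_velocity a b \<in> borel_measurable borel"
      unfolding sector_velocity_def[abs_def] by (intro measurable_If) auto
    have "(\<lambda>t. f (?\<gamma> t) * sector_velocity a b t) \<in> borel_measurable borel"
      using m1 m2 by measurable
    then show "(\<lambda>t. f (?\<gamma> t) * sector_velocity a b t) \<in> borel_measurable (lebesgue_on UNIV)"
      using measurable_completion[of _ lborel] by (simp add: lebesgue_on_UNIV_eq)
    show "(\<lambda>t. M * (1 / (1 + t\<^sup>2))) integrable_on UNIV"
      by (intro integrable_on_mult_right integrable_inverse_1_plus_square)
    show "norm (f (?\<gamma> t) * sector_velocity a b t) \<le> M * (1 / (1 + t\<^sup>2))" for t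
    proof -
      have "norm (f (?\<gamma> t)) * norm (sector_velocity a b t) \<le> (5 * K + 2 * \<bar>C\<bar>) / (1 + t\<^sup>2) * V"
        using f V K(1) by (intro mult_mono) auto
      then show ?thesis by (simp add: M_def norm_mult)
    qed
  qed auto
qed

text \<open>Turning the bisector, of argument \<open>a + pi/6\<close>, onto the positive real axis
  puts the curve into the right half plane: arguments there stay within \<open>pi/6\<close> of 0.
  This half plane is convex and avoids 0, so functions holomorphic off 0 have primitives on
  it.\<close>

lemma half_plane_sector_boundary:
  assumes "b = a + pi/3"
  shows "0 < Re (sector_boundary a b t * cis (- (a + pi/6)))"
proof -
  have c: "cos (pi/6) > 0" by (simp add: cos_30)
  consider "t \<le> 0" | "0 \<le> t" "t \<le> 1" | "1 \<le> t" by linarith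
  then show ?thesis
  proof cases
    case 1
    have "sector_boundary a b t * cis (- (a + pi/6)) = of_real (1 - t) * cis (pi/6)"
      unfolding sector_boundary_simps(1)[OF 1] mult.assoc cis_mult using assms by simp
    then show ?thesis using 1 c by (simp add: mult_pos_pos)
  next
    case 2
    have e: "sector_boundary a b t * cis (- (a + pi/6)) = cis (pi/6 - t * (pi/3))"
      unfolding sector_boundary_simps(2)[OF 2] cis_mult using assms by simp
    have "t * (pi/3) \<le> 1 * (pi/3)" "0 \<le> t * (pi/3)" using 2 by (auto intro!: mult_right_mono)
    then have "- (pi/2) < pi/6 - t * (pi/3)" "pi/6 - t * (pi/3) < pi/2"
      using pi_gt_zero by linarith+
    then show ?thesis unfolding e by (auto intro: cos_gt_zero_pi)
  next
    case 3
    have "sector_boundary a b t * cis (- (a + pi/6)) = of_real t * cis (- (pi/6))"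
      unfolding sector_boundary_simps(3)[OF 3] mult.assoc cis_mult using assms by simp
    then show ?thesis using 3 c by (simp add: mult_pos_pos)
  qed
qed

text \<open>
  Jordan's lemma for the sector: a primitive on the half plane around the sector changes by
  at most \<open>O(1/T)\<close> between the two points of modulus \<open>T\<close> on its boundary rays.
\<close>

lemma has_integral_sector_boundary_0:
  assumes ab: "b = a + pi/3"
    and holo: "h holomorphic_on - {0}"
    and K: "convex K" "\<And>r. r \<ge> 1 \<Longrightarrow> of_real r * cis a \<in> K" "\<And>r. r \<ge> 1 \<Longrightarrow> of_real r * cis b \<in> K"
    and bound: "\<And>z. z \<in> K \<Longrightarrow> 1/2 \<le> norm z \<Longrightarrow> norm (h z) \<le> C / (norm z)\<^sup>2"
  shows "((\<lambda>t. h (sector_boundary a b t) * sector_velocity a b t) has_integral 0) UNIV"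
proof -
  let ?\<gamma> = "sector_boundary a b"
  let ?g = "\<lambda>t. h (?\<gamma> t) * sector_velocity a b t"
  let ?c = "cis (- (a + pi/6))"
  let ?H = "{z. 0 < Re (z * ?c)}"
  have opH: "open ?H" by (intro open_Collect_less continuous_intros)
  have coH: "convex ?H"
    using convex_linear_vimage[OF bounded_linear.linear[OF bounded_linear_mult_left[of ?c]]
        convex_halfspace_Re_gt[of 0]] by (simp add: vimage_def)
  have holH: "h holomorphic_on ?H" by (rule holomorphic_on_subset[OF holo]) auto
  obtain P where "\<And>z. z \<in> ?H \<Longrightarrow> (P has_field_derivative h z) (at z within ?H)"
    using holomorphic_convex_primitive'[OF coH opH holH] by blast
  then have P: "(P has_field_derivative h z) (at z)" if "z \<in> ?H" for z
    using that at_within_open[OF _ opH] by metis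
  have \<gamma>H: "?\<gamma> t \<in> ?H" for t using half_plane_sector_boundary[OF ab] by simp
  \<comment> \<open>The sign of \<open>C\<close> is read off from the bound at the point
    \<open>cis a\<close>.\<close>
  have C0: "C \<ge> 0"
    using bound[of "of_real 1 * cis a"] K(2)[of 1] order_trans[OF norm_ge_zero[of "h (cis a)"]]
    by simp
  have "?g integrable_on UNIV"
  proof (rule integrable_sector_boundary)
    show "continuous_on (range ?\<gamma>) h"
      by (rule continuous_on_subset[OF holomorphic_on_imp_continuous_on[OF holH]]) (use \<gamma>H in blast)
    fix z assume z: "z \<in> range ?\<gamma>" "2 \<le> norm z"
    then obtain t where t: "z = ?\<gamma> t" by blast
    have "t \<le> 0 \<or> t > 1" using z(2) unfolding t norm_sector_boundary by (auto split: if_splits)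
    then have "z \<in> K" using K(2)[of t] K(3)[of "1 - t"] t by (auto simp: sector_boundary_simps)
    then show "norm (h z) \<le> C / (norm z)\<^sup>2" using bound z(2) by simp
  qed
  then obtain I where I: "(?g has_integral I) UNIV" by (auto simp: integrable_on_def)
  have Pc: "continuous_on S (\<lambda>t. P (?\<gamma> t))" for S
  proof (rule continuous_on_compose2[OF _ continuous_on_sector_boundary])
    show "continuous_on ?H P" using P DERIV_isCont by (intro continuous_at_imp_continuous_on) blast
  qed (use \<gamma>H in blast)
  \<comment> \<open>The interval \<open>{1-T..T}\<close> is not symmetric because the ray of
    argument b is parametrised by modulus \<open>1 - t\<close>; this way both end points have
    modulus T.\<close>
  have ftc: "(?g has_integral (P (?\<gamma> T) - P (?\<gamma> (1 - T)))) {1-T..T}" if "T \<ge> 1" for T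
  proof (rule fundamental_theorem_of_calculus_strong[of "{0,1}"])
    fix t assume "t \<in> {1 - T..T} - {0, 1}"
    then have "t \<notin> {0, 1}" by auto
    from field_vector_diff_chain_at[OF sector_boundary_has_vector_derivative[OF this] P[OF \<gamma>H]]
    show "((\<lambda>t. P (?\<gamma> t)) has_vector_derivative ?g t) (at t)" by (simp add: o_def mult.commute)
  qed (use that Pc in auto)
  have small: "norm (P (?\<gamma> T) - P (?\<gamma> (1 - T))) \<le> 8 * C / T" if T: "T \<ge> 1" for T
  proof -
    define p q where "p = ?\<gamma> T" and "q = ?\<gamma> (1 - T)"
    have pq: "p = of_real T * cis a" "q = of_real T * cis b"
      using T by (auto simp: p_def q_def sector_boundary_simps)
    have pK: "p \<in> K" "q \<in> K" unfolding pq using K T by auto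
    have "p * ?c = of_real T * cis (- (pi/6))" "q * ?c = of_real T * cis (pi/6)"
      unfolding pq mult.assoc cis_mult by (auto simp: ab)
    then have Re: "Re (p * ?c) = T * (sqrt 3 / 2)" "Re (q * ?c) = T * (sqrt 3 / 2)"
      by (simp_all add: cos_30)
    \<comment> \<open>The two end points make an angle \<open>pi/6\<close> with the bisector, so
      their chord keeps distance at least \<open>T/2\<close> from 0. There h is at most
      \<open>4 * C / T\<^sup>2\<close>, and the chord has length at most
      \<open>2 * T\<close>.\<close>
    have "T * 1 \<le> T * sqrt 3" using T by (intro mult_left_mono) auto
    then have Re2: "Re (p * ?c) \<ge> T/2" "Re (q * ?c) \<ge> T/2" unfolding Re by auto
    have "convex {z. T/2 \<le> Re (z * ?c)}"
      using convex_linear_vimage[OF bounded_linear.linear[OF bounded_linear_mult_left[of ?c]]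
          convex_halfspace_Re_ge[of "T/2"]] by (simp add: vimage_def)
    \<comment> \<open>Convexity of K keeps the chord where the bound on h is available.\<close>
    then have seg: "closed_segment p q \<subseteq> {z. T/2 \<le> Re (z * ?c)} \<inter> K"
      using pK Re2 K(1) by (intro closed_segment_subset convex_Int) auto
    have "norm (P p - P q) \<le> (4 * C / T\<^sup>2) * norm (p - q)"
    proof (rule field_differentiable_bound[of "closed_segment p q" P h])
      fix z assume z: "z \<in> closed_segment p q"
      then have zK: "z \<in> K" "T/2 \<le> Re (z * ?c)" using seg by auto
      have "Re (z * ?c) \<le> norm (z * ?c)" by (rule complex_Re_le_cmod)
      with zK have zn: "T/2 \<le> norm z" by (simp add: norm_mult)
      have "z \<in> ?H" using zK T by simp
      then show "(P has_field_derivative h z) (at z within closed_segment p q)"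
        using P has_field_derivative_at_within by blast
      have "norm (h z) \<le> C / (norm z)\<^sup>2" using bound[OF zK(1)] zn T by simp
      also have "\<dots> \<le> C / (T/2)\<^sup>2"
        using zn T C0 by (intro divide_left_mono power_mono mult_pos_pos) auto
      finally show "norm (h z) \<le> 4 * C / T\<^sup>2" by (simp add: power_divide mult.commute)
    qed auto
    also have "\<dots> \<le> (4 * C / T\<^sup>2) * (2 * T)"
      using norm_triangle_ineq4[of p q] C0 T by (intro mult_left_mono) (auto simp: pq norm_mult)
    also have "\<dots> = 8 * C / T" using T by (simp add: power2_eq_square)
    finally show ?thesis by (simp add: p_def q_def)
  qed
  have "I = 0"
  proof (rule ccontr)
    assume "I \<noteq> 0"
    then have e: "norm I / 2 > 0" by simp
    have "\<forall>e>0. \<exists>B>0. \<forall>u v. ball 0 B \<subseteq> cbox u v \<longrightarrow> norm (integral (cbox u v) ?g - I) < e"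
      using I unfolding has_integral_alt' by simp
    from this[rule_format, OF e] obtain B where B: "B > 0" "\<And>u v. ball 0 B \<subseteq> cbox u v \<Longrightarrow>
        norm (integral (cbox u v) ?g - I) < norm I / 2"
      by blast
    \<comment> \<open>The first entry makes the interval contain the ball of radius B; the second
      makes the primitive's increment at most half of \<open>norm I\<close>, which contradicts the
      strict approximation.\<close>
    define T where "T = max (B + 1) (16 * C / norm I)"
    have T: "T \<ge> 1" "T \<ge> B + 1" "16 * C / norm I \<le> T" using B(1) by (auto simp: T_def)
    have "ball 0 B \<subseteq> cbox (1 - T) T" using T(2) by (auto simp: dist_norm)
    from B(2)[OF this] have "norm (P (?\<gamma> T) - P (?\<gamma> (1 - T)) - I) < norm I / 2"
      using ftc[OF T(1)] by (simp add: integral_unique)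
    moreover have "8 * C / T \<le> norm I / 2"
      using T(1,3) \<open>I \<noteq> 0\<close> by (simp add: field_simps)
    ultimately show False
      using small[OF T(1)] norm_triangle_ineq2[of I "P (?\<gamma> T) - P (?\<gamma> (1 - T))"]
      by (simp add: norm_minus_commute)
  qed
  then show ?thesis using I by simp
qed

section \<open>Kernels built from the cube roots of unity\<close>

lemma \<alpha>_eq: "\<alpha> = Complex (- 1/2) (sqrt 3 / 2)"
proof -
  have "\<alpha> = cis (2 * pi / 3)" by (simp add: \<alpha>_def cis_conv_exp mult.commute)
  also have "\<dots> = Complex (- 1/2) (sqrt 3 / 2)"
    by (simp add: complex_eq_iff cos_120 sin_120)
  finally show ?thesis .
qed

lemma \<alpha>_square: "\<alpha>\<^sup>2 = - 1 - \<alpha>"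
  by (simp add: \<alpha>_eq complex_eq_iff power2_eq_square field_simps)

lemma \<alpha>_cube: "\<alpha> ^ 3 = 1"
proof -
  have "\<alpha> ^ 3 = \<alpha> * \<alpha>\<^sup>2" by (simp add: power3_eq_cube power2_eq_square)
  also have "\<dots> = 1" by (simp add: \<alpha>_square algebra_simps flip: power2_eq_square)
  finally show ?thesis .
qed

text \<open>The frequencies are the three cube roots of \<open>\<mu> ^ 3\<close>: for nonzero
  \<open>\<mu>\<close> this is the general solution of \<open>y''' = \<i> * \<mu> ^ 3 * y\<close>,
  the equation adjoint to the eigenvalue equation. Differentiation changes only the
  coefficients.\<close>

definition root_kernel :: "complex \<Rightarrow> complex \<Rightarrow> complex \<Rightarrow> complex \<Rightarrow> real \<Rightarrow> complex" where
  "root_kernel a b c \<mu> x =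
     a * exp (- \<i> * \<mu> * x) + b * exp (- \<i> * \<alpha> * \<mu> * x) + c * exp (- \<i> * \<alpha>\<^sup>2 * \<mu> * x)"

abbreviation root_kernel_deriv :: "complex \<Rightarrow> complex \<Rightarrow> complex \<Rightarrow> complex \<Rightarrow> real \<Rightarrow> complex" where
  "root_kernel_deriv a b c \<mu> \<equiv>
     root_kernel (- \<i> * \<mu> * a) (- \<i> * \<alpha> * \<mu> * b) (- \<i> * \<alpha>\<^sup>2 * \<mu> * c) \<mu>"

lemma has_vector_derivative_root_kernel:
  "(root_kernel a b c \<mu> has_vector_derivative root_kernel_deriv a b c \<mu> x) (at x within S)"
  unfolding root_kernel_def
  by (auto intro!: derivative_eq_intros has_vector_derivative_real_field simp: algebra_simps)

lemma root_kernel_third_deriv: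
  "root_kernel (- \<i> * \<mu> * (- \<i> * \<mu> * (- \<i> * \<mu> * a)))
     (- \<i> * \<alpha> * \<mu> * (- \<i> * \<alpha> * \<mu> * (- \<i> * \<alpha> * \<mu> * b)))
     (- \<i> * \<alpha>\<^sup>2 * \<mu> * (- \<i> * \<alpha>\<^sup>2 * \<mu> * (- \<i> * \<alpha>\<^sup>2 * \<mu> * c))) \<mu> x
   = \<i> * \<mu> ^ 3 * root_kernel a b c \<mu> x"
proof -
  have 1: "- \<i> * z * (- \<i> * z * (- \<i> * z * w)) = \<i> * z ^ 3 * w" for z w
    by (simp add: power3_eq_cube algebra_simps)
  have 2: "(\<alpha> * \<mu>) ^ 3 = \<mu> ^ 3" "(\<alpha>\<^sup>2 * \<mu>) ^ 3 = \<mu> ^ 3"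
    using \<alpha>_cube power_mult[of \<alpha> 2 3] power_mult[of \<alpha> 3 2]
    by (simp_all add: power_mult_distrib)
  show ?thesis
    using 1[of \<mu> a] 1[of "\<alpha> * \<mu>" b] 1[of "\<alpha>\<^sup>2 * \<mu>" c]
    unfolding root_kernel_def by (simp add: 2 mult.assoc[symmetric]) (simp add: algebra_simps)
qed

lemma continuous_on_root_kernel: "continuous_on S (root_kernel a b c \<mu>)"
  unfolding root_kernel_def by (intro continuous_intros)

text \<open>Three integrations by parts, done at once by one antiderivative. The kernel's third
  derivative reproduces \<open>\<mu> ^ 3\<close>, and the zero boundary values of f remove the terms
  with the kernel's second derivative.\<close>

lemma integral_root_kernel_S_op:
  assumes f: "f \<in> smooth01" "f 0 = 0" "f 1 = 0"
  shows "integral {0..1} (\<lambda>x. root_kernel a b c \<mu> x * S_op f x)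
       = \<mu> ^ 3 * integral {0..1} (\<lambda>x. root_kernel a b c \<mu> x * f x)
       + \<i> * (root_kernel a b c \<mu> 1 * (deriv01 ^^ 2) f 1 - root_kernel_deriv a b c \<mu> 1 * deriv01 f 1
            - (root_kernel a b c \<mu> 0 * (deriv01 ^^ 2) f 0 - root_kernel_deriv a b c \<mu> 0 * deriv01 f 0))"
proof -
  let ?D = "\<lambda>k. (deriv01 ^^ k) f"
  let ?\<psi> = "root_kernel a b c \<mu>"
  let ?\<psi>1 = "root_kernel_deriv a b c \<mu>"
  let ?\<psi>2 = "root_kernel_deriv (- \<i> * \<mu> * a) (- \<i> * \<alpha> * \<mu> * b) (- \<i> * \<alpha>\<^sup>2 * \<mu> * c) \<mu>"
  \<comment> \<open>The bilinear concomitant: the mixed terms of its derivative telescope, leaving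
    the kernel times the third derivative of f plus the kernel's third derivative times f.\<close>
  define P where "P x = ?\<psi> x * ?D 2 x - ?\<psi>1 x * ?D 1 x + ?\<psi>2 x * ?D 0 x" for x
  have d: "(?D k has_vector_derivative ?D (Suc k) x) (at x within {0..1})" if "x \<in> {0..1}" for k x
    by (rule funpow_deriv01_has_vector_derivative[OF f(1) that])
  have "((\<lambda>x. ?\<psi> x * ?D 3 x + \<i> * \<mu> ^ 3 * (?\<psi> x * f x)) has_integral (P 1 - P 0)) {0..1}"
  proof (rule fundamental_theorem_of_calculus)
    fix x :: real assume x: "x \<in> {0..1}"
    let ?\<psi>3 = "root_kernel_deriv (- \<i> * \<mu> * (- \<i> * \<mu> * a)) (- \<i> * \<alpha> * \<mu> * (- \<i> * \<alpha> * \<mu> * b))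
      (- \<i> * \<alpha>\<^sup>2 * \<mu> * (- \<i> * \<alpha>\<^sup>2 * \<mu> * c)) \<mu>"
    have "(P has_vector_derivative (?\<psi> x * ?D (Suc 2) x + ?\<psi>1 x * ?D 2 x
        - (?\<psi>1 x * ?D (Suc 1) x + ?\<psi>2 x * ?D 1 x) + (?\<psi>2 x * ?D (Suc 0) x + ?\<psi>3 x * ?D 0 x)))
        (at x within {0..1})"
      unfolding P_def[abs_def]
      by (intro has_vector_derivative_add has_vector_derivative_diff has_vector_derivative_mult
          has_vector_derivative_root_kernel d[OF x])
    moreover have "?\<psi>3 x = \<i> * \<mu> ^ 3 * ?\<psi> x" by (rule root_kernel_third_deriv)
    moreover have "Suc 2 = 3" "Suc 1 = 2" "Suc 0 = 1" by auto
    moreover have "p * d3 + q * d2 - (q * d2 + r * d1) + (r * d1 + \<i> * m * p * y) = p * d3 + \<i> * m * (p * y)"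
      for p q r m y d1 d2 d3 :: complex by simp
    ultimately show "(P has_vector_derivative ?\<psi> x * ?D 3 x + \<i> * \<mu> ^ 3 * (?\<psi> x * f x)) (at x within {0..1})"
      by (simp only: funpow_0)
  qed auto
  then have "((\<lambda>x. \<i> * (?\<psi> x * ?D 3 x + \<i> * \<mu> ^ 3 * (?\<psi> x * f x))) has_integral \<i> * (P 1 - P 0)) {0..1}"
    by (rule has_integral_mult_right)
  moreover have "((\<lambda>x. \<mu> ^ 3 * (?\<psi> x * f x)) has_integral
      \<mu> ^ 3 * integral {0..1} (\<lambda>x. ?\<psi> x * f x)) {0..1}"
    by (intro has_integral_mult_right integrable_integral integrable_continuous_real
        continuous_intros continuous_on_root_kernel continuous_on_smooth01 f)
  ultimately have "((\<lambda>x. \<i> * (?\<psi> x * ?D 3 x + \<i> * \<mu> ^ 3 * (?\<psi> x * f x)) + \<mu> ^ 3 * (?\<psi> x * f x))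
      has_integral (\<i> * (P 1 - P 0) + \<mu> ^ 3 * integral {0..1} (\<lambda>x. ?\<psi> x * f x))) {0..1}"
    by (rule has_integral_add)
  moreover have "(\<lambda>x. \<i> * (?\<psi> x * ?D 3 x + \<i> * \<mu> ^ 3 * (?\<psi> x * f x)) + \<mu> ^ 3 * (?\<psi> x * f x))
      = (\<lambda>x. ?\<psi> x * S_op f x)"
    by (auto simp: S_op_def fun_eq_iff power3_eq_cube algebra_simps)
  ultimately show ?thesis
    using f by (simp add: integral_unique P_def algebra_simps)
qed

lemma norm_integral_root_kernel_le:
  assumes "g \<in> smooth01" "\<And>x. x \<in> {0..1} \<Longrightarrow> norm (root_kernel a b c \<mu> x) \<le> K"
    "\<And>x. x \<in> {0..1} \<Longrightarrow> norm (g x) \<le> G"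
  shows "norm (integral {0..1} (\<lambda>x. root_kernel a b c \<mu> x * g x)) \<le> K * G"
proof -
  have "norm (integral {0..1} (\<lambda>x. root_kernel a b c \<mu> x * g x)) \<le> K * G * (1 - 0)"
  proof (rule integral_bound)
    show "continuous_on {0..1} (\<lambda>x. root_kernel a b c \<mu> x * g x)"
      by (intro continuous_intros continuous_on_root_kernel continuous_on_smooth01 assms(1))
    show "norm (root_kernel a b c \<mu> x * g x) \<le> K * G" if "x \<in> {0..1}" for x
      using that assms(2,3) order_trans[OF norm_ge_zero assms(2)]
      by (auto simp: norm_mult intro!: mult_mono)
  qed auto
  then show ?thesis by simp
qed

lemma root_kernel_bounded: "\<exists>K. \<forall>x\<in>{0..1}. norm (root_kernel a b c \<mu> x) \<le> K"
proof -
  have "bounded (root_kernel a b c \<mu> ` {0..1})"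
    by (intro compact_imp_bounded compact_continuous_image continuous_on_root_kernel) auto
  then show ?thesis by (auto simp: bounded_iff)
qed

lemma integrable_root_kernel:
  "g \<in> smooth01 \<Longrightarrow> (\<lambda>x. root_kernel a b c \<mu> x * g x) integrable_on {0..1}"
  by (intro integrable_continuous_real continuous_intros continuous_on_root_kernel continuous_on_smooth01)

lemma integral_root_kernel_in_dual:
  "(\<lambda>f. integral {0..1} (\<lambda>x. root_kernel a b c \<mu> x * f x)) \<in> dual smooth01_topology"
proof -
  obtain K where K: "\<And>x. x \<in> {0..1} \<Longrightarrow> norm (root_kernel a b c \<mu> x) \<le> K"
    using root_kernel_bounded by blast
  show ?thesis
  proof (rule dual_smooth01I[where k = 0 and C = K])
    fix f g assume "f \<in> smooth01" "g \<in> smooth01"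
    then show "integral {0..1} (\<lambda>x. root_kernel a b c \<mu> x * (f x + g x)) =
        integral {0..1} (\<lambda>x. root_kernel a b c \<mu> x * f x) + integral {0..1} (\<lambda>x. root_kernel a b c \<mu> x * g x)"
      by (simp add: distrib_left integral_add integrable_root_kernel)
  next
    fix d f assume "f \<in> smooth01"
    then show "integral {0..1} (\<lambda>x. root_kernel a b c \<mu> x * (d * f x)) =
        d * integral {0..1} (\<lambda>x. root_kernel a b c \<mu> x * f x)"
      by (simp add: mult.left_commute[of _ d])
  qed (use norm_integral_root_kernel_le[OF _ K] in auto)
qed

text \<open>Differentiation is not bounded for the supremum norm; the seminorm of the third
  derivative absorbs it.\<close>

lemma integral_root_kernel_S_op_in_dual:
  "(\<lambda>f. integral {0..1} (\<lambda>x. root_kernel a b c \<mu> x * S_op f x)) \<in> dual smooth01_topology"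
proof -
  obtain K where K: "\<And>x. x \<in> {0..1} \<Longrightarrow> norm (root_kernel a b c \<mu> x) \<le> K"
    using root_kernel_bounded by blast
  have S: "S_op (\<lambda>x. f x + g x) = (\<lambda>x. S_op f x + S_op g x)" "S_op (\<lambda>x. d * f x) = (\<lambda>x. d * S_op f x)"
    if "f \<in> smooth01" "g \<in> smooth01" for f g d
    using linear_operator_S_op[of smooth01] that by (auto simp: linear_operator_def)
  show ?thesis
  proof (rule dual_smooth01I[where k = 3 and C = K])
    fix f g assume "f \<in> smooth01" "g \<in> smooth01"
    then show "integral {0..1} (\<lambda>x. root_kernel a b c \<mu> x * S_op (\<lambda>x. f x + g x) x) =
        integral {0..1} (\<lambda>x. root_kernel a b c \<mu> x * S_op f x)
        + integral {0..1} (\<lambda>x. root_kernel a b c \<mu> x * S_op g x)"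
      by (simp add: S distrib_left integral_add integrable_root_kernel S_op_smooth01)
  next
    fix d f assume "f \<in> smooth01"
    then show "integral {0..1} (\<lambda>x. root_kernel a b c \<mu> x * S_op (\<lambda>x. d * f x) x) =
        d * integral {0..1} (\<lambda>x. root_kernel a b c \<mu> x * S_op f x)"
      by (simp add: S mult.left_commute[of _ d])
  next
    fix f and e :: real assume f: "f \<in> smooth01" and e: "\<And>x. x \<in> {0..1} \<Longrightarrow> norm ((deriv01 ^^ 3) f x) \<le> e"
    show "norm (integral {0..1} (\<lambda>x. root_kernel a b c \<mu> x * S_op f x)) \<le> K * e"
      by (rule norm_integral_root_kernel_le[OF S_op_smooth01[OF f] K])
        (auto simp: S_op_def norm_mult norm_power e)
  qed
qed

section \<open>The Fourier transform on the unit interval and its injectivity\<close>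

definition fourier :: "(real \<Rightarrow> complex) \<Rightarrow> complex \<Rightarrow> complex" where
  "fourier f \<mu> = integral {0..1} (\<lambda>x. exp (- \<i> * \<mu> * x) * f x)"

lemma has_field_derivative_fourier:
  assumes "continuous_on {0..1} f"
  shows "(fourier f has_field_derivative fourier (\<lambda>x. - \<i> * x * f x) \<mu>) (at \<mu>)"
proof -
  have "((\<lambda>\<mu>. integral (cbox 0 1) (\<lambda>x. exp (- \<i> * \<mu> * of_real x) * f x)) has_field_derivative
      integral (cbox 0 1) (\<lambda>x. exp (- \<i> * \<mu> * of_real x) * (- \<i> * of_real x * f x))) (at \<mu> within UNIV)"
  proof (rule leibniz_rule_field_derivative)
    show "((\<lambda>\<mu>. exp (- \<i> * \<mu> * of_real x) * f x) has_field_derivative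
        exp (- \<i> * \<mu> * of_real x) * (- \<i> * of_real x * f x)) (at \<mu> within UNIV)" for \<mu> x
      by (auto intro!: derivative_eq_intros)
    show "(\<lambda>x. exp (- \<i> * \<mu> * of_real x) * f x) integrable_on cbox 0 1" for \<mu>
      unfolding box_real by (intro integrable_continuous_real continuous_intros assms)
    have "continuous_on (UNIV \<times> {0..1}) (\<lambda>p :: complex \<times> real. f (snd p))"
      by (rule continuous_on_compose2[OF assms]) (auto intro: continuous_intros)
    then show "continuous_on (UNIV \<times> cbox 0 1)
        (\<lambda>(\<mu>, x). exp (- \<i> * \<mu> * of_real x) * (- \<i> * of_real x * f x))"
      unfolding box_real case_prod_beta by (intro continuous_intros)
  qed auto
  then show ?thesis by (simp add: fourier_def[abs_def])
qed

lemma holomorphic_on_fourier: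
  assumes "continuous_on {0..1} f"
  shows "fourier f holomorphic_on S"
  using has_field_derivative_fourier[OF assms]
  by (meson holomorphic_onI field_differentiable_def field_differentiable_at_within)

lemma holomorphic_on_fourier_scaled:
  assumes "continuous_on {0..1} f"
  shows "(\<lambda>\<mu>. fourier f (d * \<mu>)) holomorphic_on S"
  using holomorphic_on_compose[of "(*) d" S "fourier f"] holomorphic_on_fourier[OF assms]
  by (simp add: o_def holomorphic_intros)

text \<open>Every polynomial p is orthogonal to u, so the integral of \<open>u * u\<close> equals
  that of \<open>(u - p) * u\<close>, which a Weierstrass approximation makes arbitrarily
  small.\<close>

lemma moments_eq_0_imp_eq_0:
  fixes u :: "real \<Rightarrow> real"
  assumes u: "continuous_on {0..1} u" and 0: "\<And>n. integral {0..1} (\<lambda>x. x ^ n * u x) = 0"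
    and x: "x \<in> {0..1}"
  shows "u x = 0"
proof -
  obtain M where M: "M > 0" "\<And>x. x \<in> {0..1} \<Longrightarrow> norm (u x) \<le> M"
    using compact_imp_bounded[OF compact_continuous_image[OF u]] by (auto simp: bounded_pos)
  have "\<bar>integral {0..1} (\<lambda>x. u x * u x)\<bar> \<le> M * e" if e: "e > 0" for e
  proof -
    obtain p where p: "real_polynomial_function p" "\<And>x. x \<in> {0..1} \<Longrightarrow> \<bar>u x - p x\<bar> < e"
      using Stone_Weierstrass_real_polynomial_function[OF _ u e] by auto
    obtain a n where an: "p = (\<lambda>x. \<Sum>i\<le>n. a i * x ^ i)"
      using p(1) real_polynomial_function_iff_sum by metis
    have pc: "continuous_on {0..1} p" unfolding an by (intro continuous_intros)
    have "integral {0..1} (\<lambda>x. p x * u x) = (\<Sum>i\<le>n. integral {0..1} (\<lambda>x. a i * (x ^ i * u x)))"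
      unfolding an sum_distrib_right mult.assoc
      by (intro integral_sum integrable_continuous_real continuous_intros u) auto
    then have "integral {0..1} (\<lambda>x. p x * u x) = 0" by (simp add: 0)
    moreover have "integral {0..1} (\<lambda>x. u x * u x - p x * u x)
        = integral {0..1} (\<lambda>x. u x * u x) - integral {0..1} (\<lambda>x. p x * u x)"
      by (intro integral_diff integrable_continuous_real continuous_intros u pc)
    moreover have "norm (integral {0..1} (\<lambda>x. u x * u x - p x * u x)) \<le> M * e * (1 - 0)"
    proof (rule integral_bound)
      show "norm (u x * u x - p x * u x) \<le> M * e" if x: "x \<in> {0..1}" for x
      proof -
        have "norm (u x * u x - p x * u x) = norm (u x) * \<bar>u x - p x\<bar>"
          by (simp add: abs_mult[symmetric] algebra_simps)
        then show ?thesis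
          using M p(2)[OF x] x by (auto intro!: mult_mono)
      qed
    qed (auto intro!: continuous_intros u pc)
    ultimately show ?thesis by simp
  qed
  \<comment> \<open>Rescaling the accuracy by the bound of u turns \<open>M * e\<close> into an
    arbitrary positive number.\<close>
  from this[of "e / M" for e] have "\<bar>integral {0..1} (\<lambda>x. u x * u x)\<bar> \<le> 0 + e" if "e > 0" for e
    using that M(1) by simp
  then have "\<bar>integral {0..1} (\<lambda>x. u x * u x)\<bar> \<le> 0" by (rule field_le_epsilon)
  then have "integral {0..1} (\<lambda>x. u x * u x) = 0" by simp
  then have "\<forall>x\<in>{0..1}. u x * u x = 0"
    by (subst (asm) integral_eq_0_iff) (auto intro!: continuous_intros u)
  then show ?thesis using x by simp
qed

text \<open>
  Vanishing on an open set gives, by differentiation there, the vanishing of all moments of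
  \<open>f\<close>, and the Weierstrass theorem applies.
\<close>

lemma fourier_eq_0_imp_eq_0:
  assumes f: "continuous_on {0..1} f" and 0: "\<And>\<mu>. fourier f \<mu> = 0" and x: "x \<in> {0..1}"
  shows "f x = 0"
proof -
  have cont: "continuous_on {0..1} (\<lambda>x. (- \<i> * of_real x) ^ n * f x)" for n
    by (intro continuous_intros f)
  have "fourier (\<lambda>x. (- \<i> * of_real x) ^ n * f x) \<mu> = 0" for n \<mu>
  proof (induction n arbitrary: \<mu>)
    case (Suc n)
    have "((\<lambda>\<mu>. 0) has_field_derivative
        fourier (\<lambda>x. - \<i> * of_real x * ((- \<i> * of_real x) ^ n * f x)) \<mu>) (at \<mu>)"
      using has_field_derivative_fourier[OF cont[of n], of \<mu>] Suc[abs_def] by simp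
    then have "fourier (\<lambda>x. - \<i> * of_real x * ((- \<i> * of_real x) ^ n * f x)) \<mu> = 0"
      using DERIV_unique DERIV_const by blast
    then show ?case by (simp add: mult.assoc)
  qed (simp add: 0)
  \<comment> \<open>At frequency 0 the exponential is 1, and the n-th derivative of the transform
    becomes the n-th moment up to the factor \<open>(- \<i>) ^ n\<close>.\<close>
  then have "integral {0..1} (\<lambda>x. (- \<i>) ^ n * (of_real x ^ n * f x)) = 0" for n
    using \<open>\<And>n \<mu>. fourier (\<lambda>x. (- \<i> * of_real x) ^ n * f x) \<mu> = 0\<close>[of n 0] unfolding fourier_def
    by (simp only: mult_zero_right mult_zero_left exp_zero mult_1 power_mult_distrib mult.assoc)
  then have moment: "integral {0..1} (\<lambda>x. of_real x ^ n * f x) = 0" for n by simp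
  have cont: "continuous_on {0..1} (\<lambda>x. of_real x ^ n * f x)" for n
    by (intro continuous_intros f)
  \<comment> \<open>The moment argument needs a real square, so real and imaginary parts are treated
    separately.\<close>
  have "integral {0..1} (\<lambda>x. x ^ n * Re (f x)) = Re (integral {0..1} (\<lambda>x. of_real x ^ n * f x))"
    "integral {0..1} (\<lambda>x. x ^ n * Im (f x)) = Im (integral {0..1} (\<lambda>x. of_real x ^ n * f x))" for n
    using integral_linear[OF integrable_continuous_real[OF cont] bounded_linear_Re, of n]
      integral_linear[OF integrable_continuous_real[OF cont] bounded_linear_Im, of n]
    by (simp_all add: o_def flip: of_real_power)
  then have "Re (f x) = 0" "Im (f x) = 0"
    using moment x
    by (auto intro!: moments_eq_0_imp_eq_0[of "\<lambda>x. Re (f x)"] moments_eq_0_imp_eq_0[of "\<lambda>x. Im (f x)"]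
        continuous_intros f)
  then show ?thesis by (simp add: complex_eq_iff)
qed

section \<open>Location of the contour points and integrals along whole contours\<close>

lemma sector_boundary_polar_form:
  assumes "a < b" "z \<in> range (sector_boundary a b)"
  obtains r s where "z = of_real r * cis s" "1 \<le> r" "a \<le> s" "s \<le> b"
proof -
  obtain t where t: "z = sector_boundary a b t" using assms(2) by blast
  consider "t \<le> 0" | "0 \<le> t" "t \<le> 1" | "1 \<le> t" by linarith
  then show thesis
  proof cases
    case 1
    then show thesis using assms(1) that[of "1 - t" b] t by (simp add: sector_boundary_simps)
  next
    case 2
    have "t * (b - a) \<le> 1 * (b - a)" "0 \<le> t * (b - a)"
      using 2 assms(1) by (auto intro: mult_right_mono)
    then show thesis
      using 2 that[of 1 "b - t * (b - a)"] t by (simp add: sector_boundary_simps)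
  next
    case 3
    then show thesis using assms(1) that[of t a] t by (simp add: sector_boundary_simps)
  qed
qed

lemma sin_three_multiple: "sin (3 * (real n * pi / 3)) = 0"
  by (simp add: sin_npi)

text \<open>The half plane bounds \<open>exp (\<i> * \<mu> * x)\<close>, while the alternative
  between arc and ray selects the estimate for \<open>\<Delta>\<close>. It holds because all rays
  have arguments that are multiples of \<open>pi/3\<close>.\<close>

lemma Gamma_plus_point:
  assumes "\<mu> \<in> trace_of Gamma_plus"
  shows "0 \<le> Im \<mu>" "1 \<le> norm \<mu>" "norm \<mu> = 1 \<or> Im (\<mu> ^ 3) = 0"
proof -
  have "\<exists>a b. \<mu> \<in> range (sector_boundary a b) \<and> 0 \<le> a \<and> a < b \<and> b \<le> pi \<and>
      sin (3 * a) = 0 \<and> sin (3 * b) = 0"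
    using assms sin_three_multiple[of 0] sin_three_multiple[of 1] sin_three_multiple[of 2]
      sin_three_multiple[of 3] pi_gt_zero
    unfolding Gamma_plus_def trace_of_Cons trace_of_Nil
    by (elim UnE emptyE) (intro exI conjI, assumption, simp_all)+
  then obtain a b where ab: "\<mu> \<in> range (sector_boundary a b)" "0 \<le> a" "a < b" "b \<le> pi"
    "sin (3 * a) = 0" "sin (3 * b) = 0" by blast
  obtain r s where rs: "\<mu> = of_real r * cis s" "1 \<le> r" "a \<le> s" "s \<le> b"
    using sector_boundary_polar_form[OF ab(3,1)] .
  show "0 \<le> Im \<mu>" using rs ab by (simp add: sin_ge_zero)
  show "1 \<le> norm \<mu>" using norm_sector_boundary_ge_1 ab(1) .
  show "norm \<mu> = 1 \<or> Im (\<mu> ^ 3) = 0" using sector_boundary_polar[OF ab(3,5,6,1)] .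
qed

text \<open>The inequality for the imaginary part is strict, which separates this contour from the
  other unbounded one and so determines the kernel that \<open>transform\<close> uses.\<close>

lemma Gamma_minus_point:
  assumes "\<mu> \<in> trace_of Gamma_minus"
  shows "Im \<mu> < 0" "1 \<le> norm \<mu>" "norm \<mu> = 1 \<or> Im (\<mu> ^ 3) = 0"
proof -
  have \<mu>: "\<mu> \<in> range (sector_boundary (4*pi/3) (5*pi/3))"
    using assms by (simp add: Gamma_minus_def)
  obtain r s where rs: "\<mu> = of_real r * cis s" "1 \<le> r" "4*pi/3 \<le> s" "s \<le> 5*pi/3"
    using sector_boundary_polar_form[OF _ \<mu>] by auto
  have "sin s < 0" using rs(3,4) pi_gt_zero by (intro sin_lt_zero) linarith+
  then show "Im \<mu> < 0" using rs(1,2) by (simp add: mult_pos_neg)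
  show "1 \<le> norm \<mu>" using norm_sector_boundary_ge_1 \<mu> .
  show "norm \<mu> = 1 \<or> Im (\<mu> ^ 3) = 0"
    using sector_boundary_polar[OF _ _ _ \<mu>] sin_three_multiple[of 4] sin_three_multiple[of 5] by simp
qed

lemma ex_has_integral_along_Gamma_plus:
  assumes "continuous_on (trace_of Gamma_plus) f"
    and "\<And>\<mu>. \<mu> \<in> trace_of Gamma_plus \<Longrightarrow> 2 \<le> norm \<mu> \<Longrightarrow> norm (f \<mu>) \<le> C / (norm \<mu>)\<^sup>2"
  shows "\<exists>v. has_integral_along f v Gamma_plus"
proof -
  have "(\<lambda>t. f (sector_boundary 0 (pi/3) t) * sector_velocity 0 (pi/3) t) integrable_on UNIV"
    "(\<lambda>t. f (sector_boundary (2*pi/3) pi t) * sector_velocity (2*pi/3) pi t) integrable_on UNIV"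
    using assms by (auto simp: Gamma_plus_def intro!: integrable_sector_boundary[of _ _ _ C]
        elim!: continuous_on_subset)
  then show ?thesis
    unfolding Gamma_plus_def has_integral_along_Cons has_integral_along_Nil
      has_integral_vector_derivative_sector_boundary integrable_on_def by blast
qed

lemma ex_has_integral_along_Gamma_minus:
  assumes "continuous_on (trace_of Gamma_minus) f"
    and "\<And>\<mu>. \<mu> \<in> trace_of Gamma_minus \<Longrightarrow> 2 \<le> norm \<mu> \<Longrightarrow> norm (f \<mu>) \<le> C / (norm \<mu>)\<^sup>2"
  shows "\<exists>v. has_integral_along f v Gamma_minus"
proof -
  have "(\<lambda>t. f (sector_boundary (4*pi/3) (5*pi/3) t) * sector_velocity (4*pi/3) (5*pi/3) t) integrable_on UNIV"
    using assms by (auto simp: Gamma_minus_def intro!: integrable_sector_boundary[of _ _ _ C]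
        elim!: continuous_on_subset)
  then show ?thesis
    unfolding Gamma_minus_def has_integral_along_Cons has_integral_along_Nil
      has_integral_vector_derivative_sector_boundary integrable_on_def by blast
qed

text \<open>Both sectors lie in the closed upper half plane, which serves as the convex set of the
  Jordan argument.\<close>

lemma has_integral_along_Gamma_plus_0:
  assumes "h holomorphic_on - {0}"
    and "\<And>z. 0 \<le> Im z \<Longrightarrow> 1/2 \<le> norm z \<Longrightarrow> norm (h z) \<le> C / (norm z)\<^sup>2"
  shows "has_integral_along h 0 Gamma_plus"
proof -
  have "((\<lambda>t. h (sector_boundary a b t) * sector_velocity a b t) has_integral 0) UNIV"
    if "b = a + pi/3" "0 \<le> a" "b \<le> pi" for a b
    by (rule has_integral_sector_boundary_0[OF that(1) assms(1) convex_halfspace_Im_ge[of 0], of C])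
      (use that assms(2) in \<open>auto simp: sin_ge_zero\<close>)
  from this[of "pi/3" 0] this[of pi "2*pi/3"] show ?thesis
    unfolding Gamma_plus_def has_integral_along_Cons has_integral_along_Nil
      has_integral_vector_derivative_sector_boundary
    by (intro exI conjI) auto
qed

lemma has_integral_along_Gamma_minus_0:
  assumes "h holomorphic_on - {0}"
    and "\<And>z. Im z \<le> 0 \<Longrightarrow> 1/2 \<le> norm z \<Longrightarrow> norm (h z) \<le> C / (norm z)\<^sup>2"
  shows "has_integral_along h 0 Gamma_minus"
proof -
  have "sin (4*pi/3) \<le> 0" "sin (5*pi/3) \<le> 0"
    using pi_gt_zero by (intro sin_le_zero; linarith)+
  then have "((\<lambda>t. h (sector_boundary (4*pi/3) (5*pi/3) t) * sector_velocity (4*pi/3) (5*pi/3) t)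
      has_integral 0) UNIV"
    by (intro has_integral_sector_boundary_0[OF _ assms(1) convex_halfspace_Im_le[of 0], of _ _ C])
      (use assms(2) in \<open>auto simp: mult_le_0_iff mult_nonneg_nonpos\<close>)
  then show ?thesis
    unfolding Gamma_minus_def has_integral_along_Cons has_integral_along_Nil
      has_integral_vector_derivative_sector_boundary
    by (intro exI conjI) auto
qed

section \<open>Transform pairs for the third derivative\<close>

text \<open>What the two problems have in common. \<open>A\<close>, \<open>B\<close>,
  \<open>C\<close> are the coefficients of the kernel \<open>\<phi>p\<close> cleared of its
  denominator; \<open>\<phi>m\<close> enters through its jump and its bound. Nonvanishing of
  \<open>\<Delta>\<close> is asked on a punctured disc and on the rays, which together cover the
  contours. In \<open>boundary_form\<close> the conditions on f and those on the kernel combine so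
  that a factor \<open>\<Delta>\<close> splits off.\<close>

locale cubic_transform_pair =
  fixes \<Phi> :: "(real \<Rightarrow> complex) set"
    and \<phi>p \<phi>m :: "real \<Rightarrow> complex \<Rightarrow> complex"
    and \<Delta> A B C :: "complex \<Rightarrow> complex"
    and K :: real
  assumes subspace: "linear_subspace \<Phi>"
    and smooth: "\<Phi> \<subseteq> smooth01"
    and boundary_values: "f \<in> \<Phi> \<Longrightarrow> f 0 = 0 \<and> f 1 = 0"
    and holomorphic: "\<Delta> holomorphic_on UNIV" "A holomorphic_on UNIV" "B holomorphic_on UNIV"
      "C holomorphic_on UNIV"
    and kernel_plus: "\<phi>p x \<mu> = root_kernel (A \<mu>) (B \<mu>) (C \<mu>) \<mu> x / (2 * pi * \<Delta> \<mu>)"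
    and kernel_jump: "\<Delta> \<mu> \<noteq> 0 \<Longrightarrow> \<phi>m x \<mu> = \<phi>p x \<mu> - exp (- \<i> * \<mu> * x) / (2 * pi)"
    and Delta_nonzero: "\<mu> \<noteq> 0 \<Longrightarrow> norm \<mu> \<le> 2 \<or> Im (\<mu> ^ 3) = 0 \<Longrightarrow> \<Delta> \<mu> \<noteq> 0"
    and bound_plus: "2 \<le> norm \<mu> \<Longrightarrow> Im (\<mu> ^ 3) = 0 \<Longrightarrow> x \<in> {0..1} \<Longrightarrow> norm (\<phi>p x \<mu>) \<le> K"
    and bound_minus: "2 \<le> norm \<mu> \<Longrightarrow> Im (\<mu> ^ 3) = 0 \<Longrightarrow> x \<in> {0..1} \<Longrightarrow>
      norm (\<phi>m x \<mu>) \<le> K * norm (exp (- \<i> * \<mu>))"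
    and kernel_0: "root_kernel (A \<mu>) (B \<mu>) (C \<mu>) \<mu> 0 = \<Delta> \<mu>"
    and kernel_1: "root_kernel (A \<mu>) (B \<mu>) (C \<mu>) \<mu> 1 = 0"
    and boundary_form: "f \<in> \<Phi> \<Longrightarrow>
      root_kernel_deriv (A \<mu>) (B \<mu>) (C \<mu>) \<mu> 1 * deriv01 f 1
      - root_kernel_deriv (A \<mu>) (B \<mu>) (C \<mu>) \<mu> 0 * deriv01 f 0 = \<i> * \<mu> * \<Delta> \<mu> * deriv01 f 0"
begin

abbreviation "F \<equiv> transform \<phi>p \<phi>m"

section \<open>The transform as integration against root kernels\<close>

lemma Delta_nonzero_on_contours:
  assumes "\<mu> \<in> trace_of Gamma0 \<union> trace_of Gamma_plus \<union> trace_of Gamma_minus"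
  shows "\<Delta> \<mu> \<noteq> 0" "\<mu> \<noteq> 0"
proof -
  have "\<mu> \<noteq> 0 \<and> (norm \<mu> \<le> 2 \<or> Im (\<mu> ^ 3) = 0)"
    using assms Gamma_plus_point[of \<mu>] Gamma_minus_point[of \<mu>] by (force simp: trace_Gamma0)
  then show "\<Delta> \<mu> \<noteq> 0" "\<mu> \<noteq> 0" using Delta_nonzero by auto
qed

lemma F_plus:
  "\<mu> \<in> trace_of Gamma0 \<union> trace_of Gamma_plus \<Longrightarrow> F \<mu> f = integral {0..1} (\<lambda>x. \<phi>p x \<mu> * f x)"
  by (auto simp: transform_def trace_Gamma0 trace_Gamma_plus)

lemma F_minus:
  assumes "\<mu> \<in> trace_of Gamma_minus"
  shows "F \<mu> f = integral {0..1} (\<lambda>x. \<phi>m x \<mu> * f x)"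
proof -
  \<comment> \<open>\<open>transform\<close> tests the other two contours first, so both have to be
    excluded.\<close>
  have "\<mu> \<notin> trace_of Gamma_plus" "norm \<mu> \<noteq> 1/2"
    using Gamma_plus_point(1)[of \<mu>] Gamma_minus_point(1,2)[OF assms] by auto
  then show ?thesis
    using assms by (auto simp: transform_def trace_Gamma_plus trace_Gamma_minus)
qed

lemma kernel_plus_eq:
  "\<phi>p x \<mu> = root_kernel (A \<mu> / (2 * pi * \<Delta> \<mu>)) (B \<mu> / (2 * pi * \<Delta> \<mu>)) (C \<mu> / (2 * pi * \<Delta> \<mu>)) \<mu> x"
  unfolding kernel_plus root_kernel_def by (simp add: add_divide_distrib)

lemma kernel_minus_eq:
  assumes "\<Delta> \<mu> \<noteq> 0"
  shows "\<phi>m x \<mu> = root_kernel (A \<mu> / (2 * pi * \<Delta> \<mu>) - 1 / (2 * pi)) (B \<mu> / (2 * pi * \<Delta> \<mu>))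
    (C \<mu> / (2 * pi * \<Delta> \<mu>)) \<mu> x"
  unfolding kernel_jump[OF assms] kernel_plus_eq root_kernel_def by (simp add: left_diff_distrib)

text \<open>Subtracting the Fourier kernel changes only the first coefficient, so
  \<open>\<phi>m\<close> is a root kernel as well and both kernels share one treatment.\<close>

lemma F_root_kernel:
  assumes "\<mu> \<in> trace_of Gamma0 \<union> trace_of Gamma_plus \<union> trace_of Gamma_minus"
  obtains a b c where "\<And>f. F \<mu> f = integral {0..1} (\<lambda>x. root_kernel a b c \<mu> x * f x)"
proof (cases "\<mu> \<in> trace_of Gamma_minus")
  case True
  show ?thesis
    by (rule that) (simp only: F_minus[OF True] kernel_minus_eq[OF Delta_nonzero_on_contours(1)[OF assms]])
next
  case False
  then have "\<mu> \<in> trace_of Gamma0 \<union> trace_of Gamma_plus" using assms by blast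
  then show ?thesis by (intro that) (simp only: F_plus kernel_plus_eq)
qed

lemma F_in_dual:
  assumes "\<mu> \<in> trace_of Gamma0 \<union> trace_of Gamma_plus \<union> trace_of Gamma_minus"
  shows "F \<mu> \<in> dual smooth01_topology"
proof -
  obtain a b c where "\<And>f. F \<mu> f = integral {0..1} (\<lambda>x. root_kernel a b c \<mu> x * f x)"
    using F_root_kernel[OF assms] by blast
  then have "F \<mu> = (\<lambda>f. integral {0..1} (\<lambda>x. root_kernel a b c \<mu> x * f x))" by blast
  then show ?thesis using integral_root_kernel_in_dual by metis
qed

text \<open>Taken as the defect, so that the remainder identity is automatic; the content lies in
  its closed forms on the contours.\<close>

definition R :: "complex \<Rightarrow> (real \<Rightarrow> complex) \<Rightarrow> complex" where
  "R \<mu> f = F \<mu> (S_op f) - \<mu> ^ 3 * F \<mu> f"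

lemma R_in_dual:
  assumes "\<mu> \<in> trace_of Gamma0 \<union> trace_of Gamma_plus \<union> trace_of Gamma_minus"
  shows "R \<mu> \<in> dual (subtopology smooth01_topology \<Phi>)"
proof -
  obtain a b c where F: "\<And>f. F \<mu> f = integral {0..1} (\<lambda>x. root_kernel a b c \<mu> x * f x)"
    using F_root_kernel[OF assms] by blast
  have "R \<mu> = (\<lambda>f. integral {0..1} (\<lambda>x. root_kernel a b c \<mu> x * S_op f x)
      - \<mu> ^ 3 * integral {0..1} (\<lambda>x. root_kernel a b c \<mu> x * f x))"
    by (simp add: R_def fun_eq_iff F)
  then have "R \<mu> \<in> dual smooth01_topology"
    using dual_diff[OF integral_root_kernel_S_op_in_dual dual_scale[OF integral_root_kernel_in_dual]]
    by metis
  then show ?thesis using dual_subtopology_smooth01 smooth by blast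
qed

lemma remainder_functionals_R:
  assumes "trace_of \<gamma> \<subseteq> trace_of Gamma0 \<union> trace_of Gamma_plus \<union> trace_of Gamma_minus"
  shows "remainder_functionals smooth01_topology \<Phi> S_op 3 \<gamma> F R"
  using R_in_dual assms by (auto simp: remainder_functionals_def R_def)

text \<open>The surviving boundary terms all carry the factor \<open>\<Delta>\<close>, which cancels
  the denominator. The statement concerns the kernel instead of \<open>F\<close>, so that it can
  also be used on the contour where \<open>F\<close> has the other kernel.\<close>

lemma integral_kernel_plus_S_op:
  assumes f: "f \<in> \<Phi>" and \<Delta>: "\<Delta> \<mu> \<noteq> 0"
  shows "integral {0..1} (\<lambda>x. \<phi>p x \<mu> * S_op f x) = \<mu> ^ 3 * integral {0..1} (\<lambda>x. \<phi>p x \<mu> * f x)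
    + (\<mu> * deriv01 f 0 - \<i> * (deriv01 ^^ 2) f 0) / (2 * pi)"
proof -
  let ?d = "2 * pi * \<Delta> \<mu>"
  have scale: "root_kernel (a / ?d) (b / ?d) (c / ?d) \<mu> x = root_kernel a b c \<mu> x / ?d" for a b c x
    by (simp add: root_kernel_def add_divide_distrib)
  have f': "f \<in> smooth01" "f 0 = 0" "f 1 = 0" using f smooth boundary_values by auto
  have "root_kernel_deriv (A \<mu>) (B \<mu>) (C \<mu>) \<mu> 1 / ?d * deriv01 f 1
      - root_kernel_deriv (A \<mu>) (B \<mu>) (C \<mu>) \<mu> 0 / ?d * deriv01 f 0 = \<i> * \<mu> * deriv01 f 0 / (2 * pi)"
    using arg_cong[OF boundary_form[OF f, of \<mu>], of "\<lambda>z. z / ?d"] \<Delta> by (simp add: diff_divide_distrib)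
  then have bf: "root_kernel_deriv (A \<mu>) (B \<mu>) (C \<mu>) \<mu> 1 / ?d * deriv01 f 1
      = root_kernel_deriv (A \<mu>) (B \<mu>) (C \<mu>) \<mu> 0 / ?d * deriv01 f 0 + \<i> * \<mu> * deriv01 f 0 / (2 * pi)"
    by (simp add: algebra_simps)
  have deriv: "root_kernel_deriv (A \<mu> / ?d) (B \<mu> / ?d) (C \<mu> / ?d) \<mu> x
      = root_kernel_deriv (A \<mu>) (B \<mu>) (C \<mu>) \<mu> x / ?d" for x
    by (simp only: times_divide_eq_right scale)
  have at01: "root_kernel (A \<mu> / ?d) (B \<mu> / ?d) (C \<mu> / ?d) \<mu> 1 = 0"
    "root_kernel (A \<mu> / ?d) (B \<mu> / ?d) (C \<mu> / ?d) \<mu> 0 = 1 / (2 * pi)"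
    using \<Delta> unfolding scale by (simp_all add: kernel_0 kernel_1)
  show ?thesis
    unfolding kernel_plus_eq integral_root_kernel_S_op[OF f'] at01 deriv bf
    by (simp add: algebra_simps diff_divide_distrib add_divide_distrib)
qed

lemma R_plus:
  assumes "f \<in> \<Phi>" "\<mu> \<in> trace_of Gamma0 \<union> trace_of Gamma_plus"
  shows "R \<mu> f = (\<mu> * deriv01 f 0 - \<i> * (deriv01 ^^ 2) f 0) / (2 * pi)"
  using integral_kernel_plus_S_op[OF assms(1) Delta_nonzero_on_contours(1), of \<mu>] assms(2)
  by (auto simp: R_def F_plus)

lemma integral_kernel_minus:
  assumes "\<Delta> \<mu> \<noteq> 0" "continuous_on {0..1} g"
  shows "integral {0..1} (\<lambda>x. \<phi>m x \<mu> * g x)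
    = integral {0..1} (\<lambda>x. \<phi>p x \<mu> * g x) - fourier g \<mu> / (2 * pi)"
proof -
  have "integral {0..1} (\<lambda>x. \<phi>p x \<mu> * g x - exp (- \<i> * \<mu> * x) * g x / (2 * pi))
    = integral {0..1} (\<lambda>x. \<phi>p x \<mu> * g x) - integral {0..1} (\<lambda>x. exp (- \<i> * \<mu> * x) * g x / (2 * pi))"
    unfolding kernel_plus_eq
    by (intro integral_diff integrable_continuous_real continuous_intros continuous_on_root_kernel assms) auto
  then show ?thesis
    by (simp add: kernel_jump[OF assms(1)] fourier_def left_diff_distrib)
qed

text \<open>The Fourier kernel is the root kernel with coefficients 1, 0, 0 and has boundary terms
  at both ends. Those at 0 cancel the remainder belonging to \<open>\<phi>p\<close>; those at 1 are
  left, with their factor \<open>exp (- \<i> * \<mu>)\<close>.\<close>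

lemma R_minus:
  assumes f: "f \<in> \<Phi>" and \<mu>: "\<mu> \<in> trace_of Gamma_minus"
  shows "R \<mu> f = exp (- \<i> * \<mu>) * (\<mu> * deriv01 f 1 - \<i> * (deriv01 ^^ 2) f 1) / (2 * pi)"
proof -
  have f': "f \<in> smooth01" "f 0 = 0" "f 1 = 0" using f smooth boundary_values by auto
  have \<Delta>: "\<Delta> \<mu> \<noteq> 0" using Delta_nonzero_on_contours \<mu> by auto
  have e: "root_kernel 1 0 0 \<mu> x = exp (- \<i> * \<mu> * x)" for x by (simp add: root_kernel_def)
  have fourier: "fourier (S_op f) \<mu> = \<mu> ^ 3 * fourier f \<mu>
      + \<i> * (exp (- \<i> * \<mu>) * (deriv01 ^^ 2) f 1 + \<i> * \<mu> * exp (- \<i> * \<mu>) * deriv01 f 1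
           - ((deriv01 ^^ 2) f 0 + \<i> * \<mu> * deriv01 f 0))"
    using integral_root_kernel_S_op[OF f', of 1 0 0 \<mu>] unfolding e fourier_def
    by (simp add: root_kernel_def)
  have "R \<mu> f = (\<mu> * deriv01 f 0 - \<i> * (deriv01 ^^ 2) f 0) / (2 * pi)
      - (fourier (S_op f) \<mu> - \<mu> ^ 3 * fourier f \<mu>) / (2 * pi)"
    unfolding R_def F_minus[OF \<mu>] integral_kernel_minus[OF \<Delta> continuous_on_smooth01[OF f'(1)]]
      integral_kernel_minus[OF \<Delta> continuous_on_smooth01[OF S_op_smooth01[OF f'(1)]]]
      integral_kernel_plus_S_op[OF f \<Delta>] by (simp add: field_simps)
  also have "\<dots> = ((\<mu> * deriv01 f 0 - \<i> * (deriv01 ^^ 2) f 0)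
      - (fourier (S_op f) \<mu> - \<mu> ^ 3 * fourier f \<mu>)) / (2 * pi)"
    by (rule diff_divide_distrib[symmetric])
  also have "(\<mu> * deriv01 f 0 - \<i> * (deriv01 ^^ 2) f 0) - (fourier (S_op f) \<mu> - \<mu> ^ 3 * fourier f \<mu>)
      = exp (- \<i> * \<mu>) * (\<mu> * deriv01 f 1 - \<i> * (deriv01 ^^ 2) f 1)"
    unfolding fourier by (simp add: algebra_simps)
  finally show ?thesis .
qed

text \<open>This is the integral of \<open>2 \<pi> \<Delta> \<phi>\<^sup>+ g\<close>.\<close>

definition numerator :: "(real \<Rightarrow> complex) \<Rightarrow> complex \<Rightarrow> complex" where
  "numerator g \<mu> = A \<mu> * fourier g \<mu> + B \<mu> * fourier g (\<alpha> * \<mu>) + C \<mu> * fourier g (\<alpha>\<^sup>2 * \<mu>)"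

lemma holomorphic_numerator:
  assumes "continuous_on {0..1} g"
  shows "numerator g holomorphic_on UNIV"
  unfolding numerator_def[abs_def]
  by (intro holomorphic_intros holomorphic holomorphic_on_fourier holomorphic_on_fourier_scaled assms)

lemma integral_kernel_plus:
  assumes "continuous_on {0..1} g"
  shows "integral {0..1} (\<lambda>x. \<phi>p x \<mu> * g x) = numerator g \<mu> / (2 * pi * \<Delta> \<mu>)"
proof -
  have int: "(\<lambda>x. exp (- \<i> * d * of_real x) * g x) integrable_on {0..1}" for d
    by (intro integrable_continuous_real continuous_intros assms)
  have "((\<lambda>x. A \<mu> * (exp (- \<i> * \<mu> * of_real x) * g x) + B \<mu> * (exp (- \<i> * (\<alpha> * \<mu>) * of_real x) * g x)
      + C \<mu> * (exp (- \<i> * (\<alpha>\<^sup>2 * \<mu>) * of_real x) * g x)) has_integral numerator g \<mu>) {0..1}"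
    unfolding numerator_def fourier_def
    by (intro has_integral_add has_integral_mult_right integrable_integral int)
  from has_integral_divide[OF this, of "2 * pi * \<Delta> \<mu>"]
  have "((\<lambda>x. \<phi>p x \<mu> * g x) has_integral numerator g \<mu> / (2 * pi * \<Delta> \<mu>)) {0..1}"
    by (simp add: kernel_plus root_kernel_def distrib_right mult.assoc)
  then show ?thesis by (rule integral_unique)
qed

text \<open>On each contour the transform is built from entire functions and the quotient by
  \<open>\<Delta>\<close>, which has no zeros there. Continuity takes care of the bounded parts,
  where no growth estimate is used.\<close>

lemma continuous_on_F:
  assumes "continuous_on {0..1} g"
  shows "continuous_on (trace_of Gamma0) (\<lambda>\<mu>. F \<mu> g)"
    "continuous_on (trace_of Gamma_plus) (\<lambda>\<mu>. F \<mu> g)"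
    "continuous_on (trace_of Gamma_minus) (\<lambda>\<mu>. F \<mu> g)"
proof -
  have "continuous_on S (numerator g)" "continuous_on S \<Delta>" "continuous_on S (fourier g)" for S
    using holomorphic_numerator[OF assms] holomorphic(1) holomorphic_on_fourier[OF assms, of UNIV]
    by (meson holomorphic_on_imp_continuous_on continuous_on_subset subset_UNIV)+
  then have p: "continuous_on S (\<lambda>\<mu>. numerator g \<mu> / (2 * pi * \<Delta> \<mu>))"
    and m: "continuous_on S (\<lambda>\<mu>. numerator g \<mu> / (2 * pi * \<Delta> \<mu>) - fourier g \<mu> / (2 * pi))"
    if "\<And>\<mu>. \<mu> \<in> S \<Longrightarrow> \<Delta> \<mu> \<noteq> 0" for S
    using that by (auto intro!: continuous_intros)
  show "continuous_on (trace_of Gamma0) (\<lambda>\<mu>. F \<mu> g)"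
    by (rule continuous_on_eq[OF p]) (simp_all add: Delta_nonzero_on_contours F_plus integral_kernel_plus assms)
  show "continuous_on (trace_of Gamma_plus) (\<lambda>\<mu>. F \<mu> g)"
    by (rule continuous_on_eq[OF p]) (simp_all add: Delta_nonzero_on_contours F_plus integral_kernel_plus assms)
  show "continuous_on (trace_of Gamma_minus) (\<lambda>\<mu>. F \<mu> g)"
    by (rule continuous_on_eq[OF m])
      (simp_all add: Delta_nonzero_on_contours F_minus integral_kernel_plus integral_kernel_minus assms)
qed

section \<open>Vanishing of the remainder integrals\<close>

lemma has_integral_along_remainder_Gamma0:
  assumes "f \<in> \<Phi>"
  shows "has_integral_along (\<lambda>\<mu>. exp (\<i> * \<mu> * of_real x) * R \<mu> f) 0 Gamma0"
proof (rule has_integral_along_cong)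
  have "(\<lambda>\<mu>. exp (\<i> * \<mu> * of_real x) * ((\<mu> * deriv01 f 0 - \<i> * (deriv01 ^^ 2) f 0) / (2 * pi)))
      holomorphic_on UNIV"
    by (intro holomorphic_intros) auto
  then show "has_integral_along (\<lambda>\<mu>. exp (\<i> * \<mu> * of_real x)
      * ((\<mu> * deriv01 f 0 - \<i> * (deriv01 ^^ 2) f 0) / (2 * pi))) 0 Gamma0"
    unfolding has_integral_along_Gamma0 by (rule Cauchy_theorem_convex_simple) auto
qed (simp add: R_plus[OF assms])

text \<open>The constant term is absorbed into the linear one by \<open>1 \<le> 2 * norm z\<close>,
  which is where the factor 2 comes from. The threshold \<open>1/2\<close> is that of the chords in
  the Jordan argument.\<close>

lemma norm_remainder_le:
  fixes z p q e :: complex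
  assumes "norm e \<le> 1" "1/2 \<le> norm z"
  shows "norm (e * inverse (z ^ 3) * ((z * p - \<i> * q) / (2 * pi))) \<le> (norm p + 2 * norm q) / (norm z)\<^sup>2"
proof -
  have z: "norm z > 0" using assms(2) by linarith
  have "norm ((z * p - \<i> * q) / (2 * pi)) = norm (z * p - \<i> * q) / (2 * pi)"
    by (simp add: norm_divide norm_mult)
  also have "\<dots> \<le> norm (z * p - \<i> * q) / 1"
    using pi_gt3 by (intro divide_left_mono) auto
  also have "\<dots> \<le> norm z * norm p + norm q"
    using norm_triangle_ineq4[of "z * p" "\<i> * q"] by (simp add: norm_mult)
  also have "\<dots> \<le> norm z * (norm p + 2 * norm q)"
    using mult_right_mono[OF assms(2), of "2 * norm q"] by (simp add: distrib_left)
  finally have "norm ((z * p - \<i> * q) / (2 * pi)) \<le> norm z * (norm p + 2 * norm q)" .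
  then have "norm (e * inverse (z ^ 3) * ((z * p - \<i> * q) / (2 * pi)))
      \<le> 1 * inverse (norm z ^ 3) * (norm z * (norm p + 2 * norm q))"
    unfolding norm_mult norm_inverse norm_power using assms(1) by (intro mult_mono) auto
  also have "\<dots> = (norm p + 2 * norm q) / (norm z)\<^sup>2"
    using z by (simp add: power2_eq_square power3_eq_cube divide_simps)
  finally show ?thesis .
qed

lemma has_integral_along_remainder_Gamma_pm:
  assumes f: "f \<in> \<Phi>" and x: "x \<in> {0<..<1}"
  shows "has_integral_along (\<lambda>\<mu>. exp (\<i> * \<mu> * of_real x) * inverse (\<mu> ^ 3) * R \<mu> f) 0
    (Gamma_plus @ Gamma_minus)"
proof -
  let ?p = "\<lambda>s. deriv01 f s" and ?q = "\<lambda>s. (deriv01 ^^ 2) f s"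
  have "has_integral_along (\<lambda>\<mu>. exp (\<i> * \<mu> * of_real x) * inverse (\<mu> ^ 3)
      * ((\<mu> * ?p 0 - \<i> * ?q 0) / (2 * pi))) 0 Gamma_plus"
  proof (rule has_integral_along_Gamma_plus_0)
    show "(\<lambda>\<mu>. exp (\<i> * \<mu> * of_real x) * inverse (\<mu> ^ 3) * ((\<mu> * ?p 0 - \<i> * ?q 0) / (2 * pi)))
        holomorphic_on - {0}"
      by (intro holomorphic_intros) auto
    fix z assume "0 \<le> Im z" "1/2 \<le> norm z"
    then show "norm (exp (\<i> * z * of_real x) * inverse (z ^ 3) * ((z * ?p 0 - \<i> * ?q 0) / (2 * pi)))
        \<le> (norm (?p 0) + 2 * norm (?q 0)) / (norm z)\<^sup>2"
      using x by (intro norm_remainder_le) auto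
  qed
  then have plus: "has_integral_along (\<lambda>\<mu>. exp (\<i> * \<mu> * of_real x) * inverse (\<mu> ^ 3) * R \<mu> f) 0 Gamma_plus"
    by (rule has_integral_along_cong) (simp add: R_plus[OF f])
  \<comment> \<open>The factor \<open>exp (- \<i> * \<mu>)\<close> of the remainder is merged into
    the exponential first: the exponent with \<open>x - 1 < 0\<close> is bounded in the lower half
    plane, as the one with \<open>x > 0\<close> is in the upper.\<close>
  have "has_integral_along (\<lambda>\<mu>. exp (\<i> * \<mu> * of_real (x - 1)) * inverse (\<mu> ^ 3)
      * ((\<mu> * ?p 1 - \<i> * ?q 1) / (2 * pi))) 0 Gamma_minus"
  proof (rule has_integral_along_Gamma_minus_0)
    show "(\<lambda>\<mu>. exp (\<i> * \<mu> * of_real (x - 1)) * inverse (\<mu> ^ 3) * ((\<mu> * ?p 1 - \<i> * ?q 1) / (2 * pi)))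
        holomorphic_on - {0}"
      by (intro holomorphic_intros) auto
    fix z assume "Im z \<le> 0" "1/2 \<le> norm z"
    then show "norm (exp (\<i> * z * of_real (x - 1)) * inverse (z ^ 3) * ((z * ?p 1 - \<i> * ?q 1) / (2 * pi)))
        \<le> (norm (?p 1) + 2 * norm (?q 1)) / (norm z)\<^sup>2"
      using x by (intro norm_remainder_le) (auto simp: mult_nonpos_nonpos simp del: of_real_diff)
  qed
  then have minus: "has_integral_along (\<lambda>\<mu>. exp (\<i> * \<mu> * of_real x) * inverse (\<mu> ^ 3) * R \<mu> f) 0 Gamma_minus"
  proof (rule has_integral_along_cong)
    fix \<mu> assume \<mu>: "\<mu> \<in> trace_of Gamma_minus"
    have "exp (\<i> * \<mu> * of_real (x - 1)) = exp (\<i> * \<mu> * of_real x) * exp (- \<i> * \<mu>)"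
      by (simp add: exp_add[symmetric] algebra_simps)
    then show "exp (\<i> * \<mu> * of_real (x - 1)) * inverse (\<mu> ^ 3) * ((\<mu> * ?p 1 - \<i> * ?q 1) / (2 * pi))
        = exp (\<i> * \<mu> * of_real x) * inverse (\<mu> ^ 3) * R \<mu> f"
      unfolding R_minus[OF f \<mu>] by (simp add: mult_ac)
  qed
  show ?thesis using has_integral_along_append[OF plus minus] by simp
qed

section \<open>Convergence along the unbounded contours\<close>

lemma F_bound:
  assumes "g \<in> smooth01" "\<And>y. y \<in> {0..1} \<Longrightarrow> norm (g y) \<le> G" "2 \<le> norm \<mu>"
  shows "\<mu> \<in> trace_of Gamma_plus \<Longrightarrow> norm (F \<mu> g) \<le> K * G"
    "\<mu> \<in> trace_of Gamma_minus \<Longrightarrow> norm (F \<mu> g) \<le> K * norm (exp (- \<i> * \<mu>)) * G"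
proof -
  assume \<mu>: "\<mu> \<in> trace_of Gamma_plus"
  \<comment> \<open>Modulus at least 2 rules out the unit arcs, so the point lies on a ray.\<close>
  then have "Im (\<mu> ^ 3) = 0" using Gamma_plus_point[OF \<mu>] assms(3) by auto
  note bound_plus[OF assms(3) this, unfolded kernel_plus_eq]
  from norm_integral_root_kernel_le[OF assms(1) this assms(2)]
  show "norm (F \<mu> g) \<le> K * G" using \<mu> by (simp add: F_plus kernel_plus_eq)
next
  assume \<mu>: "\<mu> \<in> trace_of Gamma_minus"
  then have "Im (\<mu> ^ 3) = 0" using Gamma_minus_point[OF \<mu>] assms(3) by auto
  moreover have \<Delta>: "\<Delta> \<mu> \<noteq> 0" using Delta_nonzero_on_contours \<mu> by auto
  ultimately have "norm (root_kernel (A \<mu> / (2 * pi * \<Delta> \<mu>) - 1 / (2 * pi)) (B \<mu> / (2 * pi * \<Delta> \<mu>))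
      (C \<mu> / (2 * pi * \<Delta> \<mu>)) \<mu> y) \<le> K * norm (exp (- \<i> * \<mu>))" if "y \<in> {0..1}" for y
    using bound_minus[OF assms(3) _ that] kernel_minus_eq[OF \<Delta>] by metis
  from norm_integral_root_kernel_le[OF assms(1) this assms(2)]
  show "norm (F \<mu> g) \<le> K * norm (exp (- \<i> * \<mu>)) * G"
    unfolding F_minus[OF \<mu>] kernel_minus_eq[OF \<Delta>] by blast
qed

text \<open>Intended for \<open>g = S_op f\<close>: the factor \<open>inverse (\<mu> ^ 3)\<close>
  supplies all the decay, and the transform only has to be bounded against the exponential.\<close>

lemma ex_has_integral_along_F:
  assumes g: "g \<in> smooth01" and x: "x \<in> {0<..<1}"
  shows "\<exists>v. has_integral_along (\<lambda>\<mu>. inverse (\<mu> ^ 3) * exp (\<i> * \<mu> * of_real x) * F \<mu> g) v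
    (Gamma_plus @ Gamma_minus)"
proof -
  let ?h = "\<lambda>\<mu>. inverse (\<mu> ^ 3) * exp (\<i> * \<mu> * of_real x) * F \<mu> g"
  have gc: "continuous_on {0..1} g" by (rule continuous_on_smooth01[OF g])
  obtain G where G: "G > 0" "\<And>y. y \<in> {0..1} \<Longrightarrow> norm (g y) \<le> G"
    using compact_imp_bounded[OF compact_continuous_image[OF gc]] by (auto simp: bounded_pos)
  have cont: "continuous_on S ?h"
    if "continuous_on S (\<lambda>\<mu>. F \<mu> g)" "\<And>\<mu>. \<mu> \<in> S \<Longrightarrow> \<mu> \<noteq> 0" for S
    using that by (intro continuous_intros) auto
  \<comment> \<open>The locale leaves the sign of \<open>K\<close> open, hence its absolute value.
    One power of the decay is given away to match the quadratic integrability criterion.\<close>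
  have le: "norm (inverse (\<mu> ^ 3) * w) \<le> \<bar>K\<bar> * G / (norm \<mu>)\<^sup>2"
    if w: "norm w \<le> K * G" and \<mu>: "2 \<le> norm \<mu>" for \<mu> w :: complex
  proof -
    have "norm (inverse (\<mu> ^ 3) * w) \<le> inverse (norm \<mu> ^ 3) * (\<bar>K\<bar> * G)"
    proof -
      have "K * G \<le> \<bar>K\<bar> * G" using G(1) by (intro mult_right_mono) auto
      then show ?thesis
        using w unfolding norm_mult norm_inverse norm_power by (intro mult_left_mono) auto
    qed
    also have "\<dots> \<le> inverse ((norm \<mu>)\<^sup>2) * (\<bar>K\<bar> * G)"
      using \<mu> G(1) by (intro mult_right_mono le_imp_inverse_le power_increasing) auto
    finally show ?thesis by (simp add: divide_inverse mult.commute)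
  qed
  have "\<exists>v. has_integral_along ?h v Gamma_plus"
  proof (rule ex_has_integral_along_Gamma_plus)
    show "continuous_on (trace_of Gamma_plus) ?h"
      using Delta_nonzero_on_contours(2) by (intro cont continuous_on_F gc) auto
    fix \<mu> assume \<mu>: "\<mu> \<in> trace_of Gamma_plus" "2 \<le> norm \<mu>"
    have "norm (exp (\<i> * \<mu> * of_real x) * F \<mu> g) \<le> 1 * (K * G)"
      unfolding norm_mult using x Gamma_plus_point(1)[OF \<mu>(1)] F_bound(1)[OF g G(2) \<mu>(2,1)]
      by (intro mult_mono) auto
    then show "norm (?h \<mu>) \<le> \<bar>K\<bar> * G / (norm \<mu>)\<^sup>2" using le[OF _ \<mu>(2)] by (simp add: mult.assoc)
  qed
  moreover have "\<exists>v. has_integral_along ?h v Gamma_minus"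
  proof (rule ex_has_integral_along_Gamma_minus)
    show "continuous_on (trace_of Gamma_minus) ?h"
      using Delta_nonzero_on_contours(2) by (intro cont continuous_on_F gc) auto
    fix \<mu> assume \<mu>: "\<mu> \<in> trace_of Gamma_minus" "2 \<le> norm \<mu>"
    have F: "norm (F \<mu> g) \<le> K * norm (exp (- \<i> * \<mu>)) * G" by (rule F_bound(2)[OF g G(2) \<mu>(2,1)])
    \<comment> \<open>An upper bound of a norm is nonnegative, which settles the sign of
      \<open>K * G\<close> for the monotonicity step below.\<close>
    have "0 \<le> K * norm (exp (- \<i> * \<mu>)) * G" using F norm_ge_zero order_trans by blast
    then have KG: "0 \<le> K * G" using G(1) by (simp add: zero_le_mult_iff)
    have "norm (exp (\<i> * \<mu> * of_real x) * F \<mu> g)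
        \<le> norm (exp (\<i> * \<mu> * of_real x)) * (K * norm (exp (- \<i> * \<mu>)) * G)"
      unfolding norm_mult using F by (intro mult_left_mono) auto
    also have "\<dots> = norm (exp (\<i> * \<mu> * of_real x) * exp (- \<i> * \<mu>)) * (K * G)"
      by (simp add: norm_mult)
    also have "exp (\<i> * \<mu> * of_real x) * exp (- \<i> * \<mu>) = exp (\<i> * \<mu> * of_real (x - 1))"
      by (simp add: exp_add[symmetric] algebra_simps)
    also have "norm \<dots> * (K * G) \<le> 1 * (K * G)"
      using x Gamma_minus_point(1)[OF \<mu>(1)] KG
      by (intro mult_right_mono) (auto simp: mult_nonpos_nonpos simp del: of_real_diff)
    finally have "norm (exp (\<i> * \<mu> * of_real x) * F \<mu> g) \<le> K * G" by simp
    then show "norm (?h \<mu>) \<le> \<bar>K\<bar> * G / (norm \<mu>)\<^sup>2" using le[OF _ \<mu>(2)] by (simp add: mult.assoc)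
  qed
  ultimately show ?thesis using has_integral_along_append by blast
qed

text \<open>
  The numerator of the transform is entire and vanishes on \<open>\<Gamma>\<^sub>0\<close>, hence everywhere. As
  \<open>\<phi>\<^sup>+ - \<phi>\<^sup>-\<close> is the Fourier kernel, the Fourier transform then vanishes on
  \<open>\<Gamma>\<^sup>-\<close>, hence everywhere.
\<close>

lemma complete_family_F:
  "complete_family \<Phi> (trace_of Gamma0 \<union> trace_of (Gamma_plus @ Gamma_minus)) F"
  unfolding complete_family_def
proof (intro ballI impI)
  fix f assume f: "f \<in> \<Phi>"
    and 0: "\<forall>\<mu>\<in>trace_of Gamma0 \<union> trace_of (Gamma_plus @ Gamma_minus). F \<mu> f = 0"
  have fs: "f \<in> smooth01" using f smooth by auto
  then have fc: "continuous_on {0..1} f" by (rule continuous_on_smooth01)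
  \<comment> \<open>A connected set with more than one point has no isolated points; this provides
    the limit point for analytic continuation.\<close>
  have limpt: "1/2 islimpt trace_of Gamma0"
    unfolding trace_Gamma0
  proof (rule connected_imp_perfect)
    fix z :: complex
    have "1/2 \<in> sphere (0::complex) (1/2)" "- 1/2 \<in> sphere (0::complex) (1/2)" by simp_all
    moreover have "(1/2::complex) \<noteq> - 1/2" by simp
    ultimately show "sphere 0 (1/2) \<noteq> {z}" by (metis singletonD)
  qed (auto intro: connected_sphere)
  have num: "numerator f \<mu> = 0" for \<mu>
  proof (rule analytic_continuation[where f = "numerator f" and S = UNIV, OF _ _ _ _ _ limpt])
    fix z assume z: "z \<in> trace_of Gamma0"
    then have "numerator f z / (2 * pi * \<Delta> z) = 0"
      using 0 F_plus[of z f] integral_kernel_plus[OF fc, of z] by simp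
    then show "numerator f z = 0" using Delta_nonzero_on_contours[of z] z by simp
  qed (use limpt in \<open>auto intro: holomorphic_numerator fc simp: trace_Gamma0\<close>)
  \<comment> \<open>A single ray of the lower contour is enough for continuation, as it is connected
    and not a single point.\<close>
  let ?ray = "(\<lambda>r. of_real r * cis (5*pi/3)) ` {1..}"
  have ray: "z \<in> trace_of Gamma_minus" if "z \<in> ?ray" for z
    using that sector_boundary_mem[of "4*pi/3" "5*pi/3" _ "5*pi/3"] by (auto simp: Gamma_minus_def)
  have "fourier f \<mu> = 0" for \<mu>
  proof (rule analytic_continuation[of "fourier f" UNIV ?ray "of_real 1 * cis (5*pi/3)"])
    have "?ray \<noteq> {z}" for z
    proof
      assume "?ray = {z}"
      then have "of_real 1 * cis (5*pi/3) = z" "of_real 2 * cis (5*pi/3) = z" by fastforce+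
      then show False by auto
    qed
    then show "of_real 1 * cis (5*pi/3) islimpt ?ray"
      by (intro connected_imp_perfect connected_continuous_image continuous_intros) auto
    fix z assume "z \<in> ?ray"
    then have z: "z \<in> trace_of Gamma_minus" by (rule ray)
    then have "integral {0..1} (\<lambda>x. \<phi>m x z * f x) = 0" using 0 F_minus[OF z, of f] by simp
    then show "fourier f z = 0"
      using integral_kernel_minus[OF Delta_nonzero_on_contours(1) fc, of z] z
        integral_kernel_plus[OF fc, of z] num by simp
  qed (auto intro: holomorphic_on_fourier fc)
  then have "f x = 0" if "x \<in> {0..1}" for x
    using fourier_eq_0_imp_eq_0[OF fc _ that] by blast
  \<comment> \<open>Off the interval f vanishes because functions are represented by their extension
    by zero.\<close>
  then show "f = (\<lambda>x. 0)"
    using funpow_deriv01_eq_0[OF fs, of _ 0] by (auto simp: fun_eq_iff)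
qed

lemma eigenfunction_setting_S_op: "eigenfunction_setting {0<..<1} smooth01_topology \<Phi> S_op"
  unfolding eigenfunction_setting_def topspace_smooth01_topology
  using linear_topological_space_smooth01 subspace smooth linear_operator_S_op[OF smooth]
  by (auto simp: is_interval_oo smooth01_def)

text \<open>Only the integrals containing \<open>S_op f\<close> are shown to converge directly. In
  each identity the other integrand is that one minus the remainder term, whose integral is 0, so it
  converges to the same value.\<close>

theorem spectral_representation_S_op:
  "spectral_representation {0<..<1} smooth01_topology \<Phi> S_op 3 Gamma0 (Gamma_plus @ Gamma_minus) F"
proof -
  have typeI: "type_I_augmented {0<..<1} smooth01_topology \<Phi> S_op 3 Gamma0 F"
    unfolding type_I_augmented_def
    using eigenfunction_setting_S_op F_in_dual remainder_functionals_R[of Gamma0]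
      has_integral_along_remainder_Gamma0 by blast
  have typeII: "type_II_augmented {0<..<1} smooth01_topology \<Phi> S_op 3 (Gamma_plus @ Gamma_minus) F"
    unfolding type_II_augmented_def
  proof (intro conjI exI[of _ R] ballI)
    show "F \<mu> \<in> dual smooth01_topology" if "\<mu> \<in> trace_of (Gamma_plus @ Gamma_minus)" for \<mu>
      using that F_in_dual[of \<mu>] by auto
    show "remainder_functionals smooth01_topology \<Phi> S_op 3 (Gamma_plus @ Gamma_minus) F R"
      by (rule remainder_functionals_R) auto
  qed (use eigenfunction_setting_S_op has_integral_along_remainder_Gamma_pm in auto)
  have convI: "\<exists>v. has_integral_along (\<lambda>\<mu>. exp (\<i> * \<mu> * of_real x) * F \<mu> (S_op f)) v Gamma0 \<and>
      has_integral_along (\<lambda>\<mu>. \<mu> ^ 3 * exp (\<i> * \<mu> * of_real x) * F \<mu> f) v Gamma0"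
    if f: "f \<in> \<Phi>" for f x
  proof -
    have "continuous_on (trace_of Gamma0) (\<lambda>\<mu>. exp (\<i> * \<mu> * of_real x) * F \<mu> (S_op f))"
      using f smooth by (intro continuous_intros continuous_on_F continuous_on_smooth01 S_op_smooth01) auto
    then obtain v where v: "has_integral_along (\<lambda>\<mu>. exp (\<i> * \<mu> * of_real x) * F \<mu> (S_op f)) v Gamma0"
      using contour_integrable_continuous_circlepath[of 0 "1/2"]
      unfolding has_integral_along_Gamma0 contour_integrable_on_def by (auto simp: trace_Gamma0)
    have "has_integral_along (\<lambda>\<mu>. \<mu> ^ 3 * exp (\<i> * \<mu> * of_real x) * F \<mu> f) (v - 0) Gamma0"
      by (rule has_integral_along_cong[OF has_integral_along_diff[OF v
            has_integral_along_remainder_Gamma0[OF f, of x]]])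
        (simp add: R_def algebra_simps)
    then show ?thesis using v by auto
  qed
  have convII: "\<exists>v. has_integral_along (\<lambda>\<mu>. inverse (\<mu> ^ 3) * exp (\<i> * \<mu> * of_real x) * F \<mu> (S_op f)) v
        (Gamma_plus @ Gamma_minus) \<and>
      has_integral_along (\<lambda>\<mu>. exp (\<i> * \<mu> * of_real x) * F \<mu> f) v (Gamma_plus @ Gamma_minus)"
    if f: "f \<in> \<Phi>" and x: "x \<in> {0<..<1}" for f x
  proof -
    obtain v where v: "has_integral_along
        (\<lambda>\<mu>. inverse (\<mu> ^ 3) * exp (\<i> * \<mu> * of_real x) * F \<mu> (S_op f)) v (Gamma_plus @ Gamma_minus)"
      using ex_has_integral_along_F[OF S_op_smooth01 x] f smooth by blast
    have "has_integral_along (\<lambda>\<mu>. exp (\<i> * \<mu> * of_real x) * F \<mu> f) (v - 0) (Gamma_plus @ Gamma_minus)"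
    proof (rule has_integral_along_cong[OF has_integral_along_diff[OF v
            has_integral_along_remainder_Gamma_pm[OF f x]]])
      fix \<mu> assume "\<mu> \<in> trace_of (Gamma_plus @ Gamma_minus)"
      then have "\<mu> \<noteq> 0" using Delta_nonzero_on_contours(2)[of \<mu>] by auto
      then show "inverse (\<mu> ^ 3) * exp (\<i> * \<mu> * of_real x) * F \<mu> (S_op f)
          - exp (\<i> * \<mu> * of_real x) * inverse (\<mu> ^ 3) * R \<mu> f = exp (\<i> * \<mu> * of_real x) * F \<mu> f"
        by (simp add: R_def field_simps)
    qed
    then show ?thesis using v by auto
  qed
  show ?thesis
    unfolding spectral_representation_def
    using typeI typeII convI convII complete_family_F by blast
qed

end

section \<open>The characteristic determinants\<close>

text \<open>The filter by cube roots of unity. The weights 1, \<open>\<alpha>\<close>,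
  \<open>\<alpha>\<^sup>2\<close> in front of the exponentials raise the exponent by one, so the
  surviving class is 2 instead of 0 modulo 3.\<close>

lemma sum_\<alpha>_powers: "1 + \<alpha> ^ Suc k + (\<alpha>\<^sup>2) ^ Suc k = (if k mod 3 = 2 then 3 else 0)"
proof -
  have p: "\<alpha> ^ Suc k = \<alpha> ^ Suc (k mod 3)"
  proof -
    have "\<alpha> ^ Suc (3 * (k div 3) + k mod 3) = \<alpha> ^ Suc (k mod 3)"
      by (simp only: power_Suc power_add power_mult \<alpha>_cube power_one mult_1)
    then show ?thesis by simp
  qed
  have sq: "(\<alpha>\<^sup>2) ^ Suc k = (\<alpha> ^ Suc k)\<^sup>2" by (simp only: power_mult[symmetric] mult.commute)
  have "k mod 3 = 0 \<or> k mod 3 = 1 \<or> k mod 3 = 2" by linarith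
  then show ?thesis
  proof (elim disjE)
    assume k: "k mod 3 = 0"
    have "\<alpha> ^ Suc k = \<alpha>" by (subst p) (simp add: k)
    then show ?thesis unfolding sq by (simp only: k) (simp add: \<alpha>_square)
  next
    assume k: "k mod 3 = 1"
    have "\<alpha> ^ Suc k = \<alpha>\<^sup>2" by (subst p) (simp add: k power2_eq_square)
    moreover have "(\<alpha>\<^sup>2)\<^sup>2 = \<alpha> ^ 3 * \<alpha>" by (simp add: power2_eq_square power3_eq_cube)
    ultimately show ?thesis unfolding sq by (simp only: k \<alpha>_cube) (simp add: \<alpha>_square)
  next
    assume k: "k mod 3 = 2"
    have "\<alpha> ^ Suc k = \<alpha> ^ 3" by (subst p) (simp add: k power3_eq_cube power2_eq_square)
    then show ?thesis unfolding sq by (simp only: k \<alpha>_cube) simp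
  qed
qed

lemma norm_\<alpha>: "norm \<alpha> = 1"
  by (simp add: \<alpha>_def norm_exp_eq_Re)

text \<open>Three times the part of the exponential series with exponents congruent to 2 modulo
  3.\<close>

definition root_exp_sum :: "complex \<Rightarrow> complex" where
  "root_exp_sum z = exp z + \<alpha> * exp (\<alpha> * z) + \<alpha>\<^sup>2 * exp (\<alpha>\<^sup>2 * z)"

lemma Delta2_eq_root_exp_sum: "Delta2 \<mu> = root_exp_sum (- \<i> * \<mu>)"
  by (simp add: Delta2_def root_exp_sum_def mult_ac)

lemma Delta1_eq_root_exp_sum: "Delta1 \<mu> = root_exp_sum (\<i> * \<mu>) + 2 * root_exp_sum (- \<i> * \<mu>)"
  by (simp add: Delta1_def root_exp_sum_def mult_ac)

text \<open>
  Only the powers \<open>z\<^sup>n\<close> with \<open>n \<equiv> 2 (mod 3)\<close> survive in the Taylor series of \<open>root_exp_sum\<close>,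
  so that \<open>root_exp_sum\<close> is close to \<open>3/2 z\<^sup>2\<close>.
\<close>

lemma norm_root_exp_sum_minus_square_le:
  assumes z: "norm z \<le> 2"
  shows "norm (root_exp_sum z - 3/2 * z\<^sup>2) \<le> 1/2 * (norm z)\<^sup>2"
proof -
  \<comment> \<open>Up to degree 7 only \<open>z\<^sup>2\<close> and \<open>z ^ 5\<close> survive,
    with coefficients \<open>3 / fact 2\<close> and \<open>3 / fact 5 = 1/40\<close>.\<close>
  define T where "T w = (\<Sum>k\<le>7. w ^ k / fact k)" for w :: complex
  have "T z + \<alpha> * T (\<alpha> * z) + \<alpha>\<^sup>2 * T (\<alpha>\<^sup>2 * z)
      = (\<Sum>k\<le>7. (1 + \<alpha> ^ Suc k + (\<alpha>\<^sup>2) ^ Suc k) * (z ^ k / fact k))"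
    by (simp add: T_def sum_distrib_left sum.distrib[symmetric] power_mult_distrib distrib_right mult.assoc
        add_divide_distrib)
  also have "\<dots> = (\<Sum>k\<le>7. (if k mod 3 = 2 then 3 else 0) * (z ^ k / fact k))"
    by (simp only: sum_\<alpha>_powers)
  also have "\<dots> = 3/2 * z\<^sup>2 + z ^ 5 / 40"
    by (simp add: atMost_nat_numeral fact_numeral)
  finally have sum: "T z + \<alpha> * T (\<alpha> * z) + \<alpha>\<^sup>2 * T (\<alpha>\<^sup>2 * z) = 3/2 * z\<^sup>2 + z ^ 5 / 40" .
  have e2: "exp 2 \<le> (7.4::real)"
  proof -
    have "exp 2 = exp (1::real) ^ 2" by (simp add: exp_of_nat_mult[symmetric] flip: exp_double)
    also have "\<dots> \<le> (272/100)\<^sup>2" using e_less_272 by (intro power_mono) auto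
    finally show ?thesis by (simp add: power2_eq_square)
  qed
  \<comment> \<open>The fraction \<open>19/200\<close> rounds up \<open>7.4 * 64 / fact 7\<close>,
    with \<open>64 = 2 ^ 6\<close> from the disc of radius 2. The total
    \<open>1/5 + 3 * 19/200\<close> stays below \<open>1/2\<close>.\<close>
  have rem: "norm (exp w - T w) \<le> 19/200 * (norm z)\<^sup>2" if w: "norm w = norm z" for w
  proof -
    have "norm (exp w - T w) \<le> exp \<bar>Re w\<bar> * norm w ^ Suc 7 / fact 7"
      unfolding T_def by (rule Taylor_exp)
    also have "\<dots> \<le> 7.4 * (2 ^ 6 * (norm z)\<^sup>2) / fact 7"
    proof (intro divide_right_mono mult_mono)
      have "\<bar>Re w\<bar> \<le> 2" using abs_Re_le_cmod[of w] w z by linarith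
      then show "exp \<bar>Re w\<bar> \<le> 7.4" using e2 by (meson exp_le_cancel_iff order_trans)
      have "norm w ^ Suc 7 = norm z ^ 6 * (norm z)\<^sup>2" by (simp add: w power_add[symmetric])
      also have "\<dots> \<le> 2 ^ 6 * (norm z)\<^sup>2" using z by (intro mult_right_mono power_mono) auto
      finally show "norm w ^ Suc 7 \<le> 2 ^ 6 * (norm z)\<^sup>2" .
    qed auto
    also have "\<dots> \<le> 19/200 * (norm z)\<^sup>2" by (simp add: fact_numeral)
    finally show ?thesis .
  qed
  have "norm (z ^ 5) = norm z ^ 3 * (norm z)\<^sup>2" by (simp add: norm_power power_add[symmetric])
  also have "\<dots> \<le> 2 ^ 3 * (norm z)\<^sup>2" using z by (intro mult_right_mono power_mono) auto
  finally have z5: "norm (z ^ 5 / 40) \<le> 1/5 * (norm z)\<^sup>2" by (simp add: norm_divide)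
  let ?r = "\<lambda>w. exp w - T w"
  have "root_exp_sum z - 3/2 * z\<^sup>2 = z ^ 5 / 40 + (?r z + \<alpha> * ?r (\<alpha> * z) + \<alpha>\<^sup>2 * ?r (\<alpha>\<^sup>2 * z))"
    unfolding root_exp_sum_def using sum by (simp add: algebra_simps)
  also have "norm \<dots> \<le> norm (z ^ 5 / 40) + (norm (?r z) + norm (\<alpha> * ?r (\<alpha> * z)) + norm (\<alpha>\<^sup>2 * ?r (\<alpha>\<^sup>2 * z)))"
    by (intro norm_triangle_le add_mono norm_triangle_ineq order_refl)
  also have "\<dots> \<le> 1/5 * (norm z)\<^sup>2 + (19/200 * (norm z)\<^sup>2 + 19/200 * (norm z)\<^sup>2 + 19/200 * (norm z)\<^sup>2)"
    using rem[of z] rem[of "\<alpha> * z"] rem[of "\<alpha>\<^sup>2 * z"]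
    by (intro add_mono z5) (simp_all add: norm_mult norm_power norm_\<alpha>)
  also have "\<dots> \<le> 1/2 * (norm z)\<^sup>2" by simp
  finally show ?thesis .
qed

lemma Delta2_nonzero_small:
  assumes "\<mu> \<noteq> 0" "norm \<mu> \<le> 2"
  shows "Delta2 \<mu> \<noteq> 0"
proof
  assume "Delta2 \<mu> = 0"
  then have "norm (3/2 * (- \<i> * \<mu>)\<^sup>2) \<le> 1/2 * (norm \<mu>)\<^sup>2"
    using norm_root_exp_sum_minus_square_le[of "- \<i> * \<mu>"] assms(2) by (simp add: Delta2_eq_root_exp_sum norm_mult)
  then show False using assms(1) by (simp add: norm_mult norm_power)
qed

text \<open>The leading terms add up to \<open>- 9/2 * \<mu>\<^sup>2\<close>, since
  \<open>\<i> * \<mu>\<close> and \<open>- \<i> * \<mu>\<close> have the same square. The errors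
  have total weight three and reach at most \<open>3/2 * (norm \<mu>)\<^sup>2\<close>.\<close>

lemma Delta1_nonzero_small:
  assumes "\<mu> \<noteq> 0" "norm \<mu> \<le> 2"
  shows "Delta1 \<mu> \<noteq> 0"
proof
  assume *: "Delta1 \<mu> = 0"
  let ?r = "\<lambda>z. root_exp_sum z - 3/2 * z\<^sup>2"
  have r: "norm (?r (\<i> * \<mu>)) \<le> 1/2 * (norm \<mu>)\<^sup>2" "norm (?r (- \<i> * \<mu>)) \<le> 1/2 * (norm \<mu>)\<^sup>2"
    using norm_root_exp_sum_minus_square_le[of "\<i> * \<mu>"] norm_root_exp_sum_minus_square_le[of "- \<i> * \<mu>"] assms(2)
    by (simp_all add: norm_mult)
  have "9/2 * \<mu>\<^sup>2 = Delta1 \<mu> + 9/2 * \<mu>\<^sup>2" using * by simp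
  also have "\<dots> = ?r (\<i> * \<mu>) + 2 * ?r (- \<i> * \<mu>)"
    by (simp add: Delta1_eq_root_exp_sum power_mult_distrib algebra_simps)
  also have "norm \<dots> \<le> norm (?r (\<i> * \<mu>)) + 2 * norm (?r (- \<i> * \<mu>))"
    by (rule norm_triangle_le) (simp only: norm_mult norm_numeral order_refl)
  finally have "norm (9/2 * \<mu>\<^sup>2) \<le> norm (?r (\<i> * \<mu>)) + 2 * norm (?r (- \<i> * \<mu>))" .
  moreover have "norm (9/2 * \<mu>\<^sup>2) = 9/2 * (norm \<mu>)\<^sup>2" by (simp add: norm_mult norm_power)
  ultimately have "9/2 * (norm \<mu>)\<^sup>2 \<le> 3/2 * (norm \<mu>)\<^sup>2" using r by linarith
  then show False using assms(1) by simp
qed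

section \<open>Growth of the determinants on the rays\<close>

lemma Im_roots_on_ray:
  assumes "Im (\<mu> ^ 3) = 0"
  obtains s where "\<bar>s\<bar> = sqrt 3 / 2 * norm \<mu>"
    "(Im \<mu>, Im (\<alpha> * \<mu>), Im (\<alpha>\<^sup>2 * \<mu>)) \<in> {(0, s, - s), (s, 0, - s), (s, - s, 0)}"
proof -
  obtain x y where \<mu>: "\<mu> = Complex x y" by (cases \<mu>)
  have I: "Im (\<alpha> * \<mu>) = sqrt 3 / 2 * x - y / 2" "Im (\<alpha>\<^sup>2 * \<mu>) = - (sqrt 3 / 2 * x) - y / 2"
    unfolding \<alpha>_square by (simp_all add: \<mu> \<alpha>_eq)
  \<comment> \<open>Up to a constant this is the product of the three imaginary parts, so one of
    them vanishes; as \<open>1 + \<alpha> + \<alpha>\<^sup>2 = 0\<close>, the other two are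
    opposite.\<close>
  have "Im (\<mu> ^ 3) = y * ((sqrt 3 * x - y) * (sqrt 3 * x + y))"
    by (simp add: \<mu> power3_eq_cube power2_eq_square algebra_simps)
  then consider "y = 0" | "y = sqrt 3 * x" | "y = - (sqrt 3 * x)" using assms by force
  then show thesis
  proof cases
    case 1
    then have "norm \<mu> = \<bar>x\<bar>" "Im \<mu> = 0" by (simp_all add: \<mu> cmod_def)
    then show thesis
      using that[of "sqrt 3 / 2 * x"] I 1 by (simp add: abs_mult)
  next
    case 2
    have "norm \<mu> = sqrt ((2 * x)\<^sup>2)" by (simp add: \<mu> 2 cmod_def power_mult_distrib)
    then have n: "norm \<mu> = 2 * \<bar>x\<bar>" by (simp only: real_sqrt_abs abs_mult abs_numeral)
    show thesis
      using that[of "sqrt 3 * x"] n I 2 by (simp add: abs_mult \<mu>)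
  next
    case 3
    have "norm \<mu> = sqrt ((2 * x)\<^sup>2)" by (simp add: \<mu> 3 cmod_def power_mult_distrib)
    then have n: "norm \<mu> = 2 * \<bar>x\<bar>" by (simp only: real_sqrt_abs abs_mult abs_numeral)
    show thesis
      using that[of "- (sqrt 3 * x)"] n I 3 by (simp add: abs_mult \<mu>)
  qed
qed

text \<open>On a ray this is the modulus of the largest of the three exponentials.\<close>

definition ray_growth :: "complex \<Rightarrow> real" where
  "ray_growth \<mu> = exp (sqrt 3 / 2 * norm \<mu>)"

lemma ray_growth_ge_4:
  assumes "2 \<le> norm \<mu>"
  shows "4 \<le> ray_growth \<mu>"
proof -
  have s: "3/2 \<le> sqrt 3" by (rule real_le_rsqrt) (simp add: power2_eq_square)
  \<comment> \<open>The quadratic term is exactly \<open>3/2\<close>, so the crude bound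
    \<open>3/2\<close> for the linear one already gives 4.\<close>
  have "4 \<le> 1 + sqrt 3 + (sqrt 3)\<^sup>2 / 2" using s by simp
  also have "\<dots> \<le> exp (sqrt 3)" by (rule exp_lower_Taylor_quadratic) simp
  also have "\<dots> \<le> ray_growth \<mu>" using assms by (simp add: ray_growth_def)
  finally show ?thesis .
qed

lemma norm_exp_minus_i: "norm (exp (- \<i> * z)) = exp (Im z)"
  by (simp add: norm_exp_eq_Re)

lemma norm_exp_i: "norm (exp (\<i> * z)) = exp (- Im z)"
  by (simp add: norm_exp_eq_Re)

lemma norm_sum3_ge:
  fixes a b c :: complex
  shows "norm a - norm b - norm c \<le> norm (a + b + c)" "norm b - norm a - norm c \<le> norm (a + b + c)"
    "norm c - norm a - norm b \<le> norm (a + b + c)"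
  using norm_triangle_ineq4[of "a + b + c" "b + c"] norm_triangle_ineq[of b c]
    norm_triangle_ineq4[of "a + b + c" "a + c"] norm_triangle_ineq[of a c]
    norm_triangle_ineq4[of "a + b + c" "a + b"] norm_triangle_ineq[of a b]
  by (simp_all add: algebra_simps)

lemma root_exponential_norms:
  assumes "2 \<le> norm \<mu>" "Im (\<mu> ^ 3) = 0"
  shows "(exp (Im \<mu>), exp (Im (\<alpha> * \<mu>)), exp (Im (\<alpha>\<^sup>2 * \<mu>))) \<in>
      (let Y = ray_growth \<mu> in
        {(1, Y, 1/Y), (1, 1/Y, Y), (Y, 1, 1/Y), (1/Y, 1, Y), (Y, 1/Y, 1), (1/Y, Y, 1)})"
proof -
  obtain s where s: "\<bar>s\<bar> = sqrt 3 / 2 * norm \<mu>"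
    "(Im \<mu>, Im (\<alpha> * \<mu>), Im (\<alpha>\<^sup>2 * \<mu>)) \<in> {(0, s, - s), (s, 0, - s), (s, - s, 0)}"
    using Im_roots_on_ray[OF assms(2)] .
  have Y: "ray_growth \<mu> = exp \<bar>s\<bar>" by (simp add: ray_growth_def s(1))
  have "exp (- s) = 1 / exp s" "exp s = 1 / exp (- s)" by (simp_all add: exp_minus inverse_eq_divide)
  then show ?thesis
    using s(2) unfolding Y Let_def by (cases "s \<ge> 0") auto
qed

text \<open>The dominant term gives \<open>N \<ge> Y - 1 - 1/Y\<close>. In the second bound M stands
  for a sum whose terms have the reciprocal moduli, at most \<open>1 + Y + 1/Y\<close>, so
  \<open>2 * N - M \<ge> Y - 3 - 3/Y\<close>. At \<open>Y = 4\<close> only \<open>1/4\<close> is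
  left, hence the small factor \<open>1/32\<close>.\<close>

lemma exponential_sum_bounds:
  fixes Y N M :: real
  assumes "4 \<le> Y"
    and "(e0, e1, e2) \<in> {(1, Y, 1/Y), (1, 1/Y, Y), (Y, 1, 1/Y), (1/Y, 1, Y), (Y, 1/Y, 1), (1/Y, Y, 1)}"
    and "e0 - e1 - e2 \<le> N" "e1 - e0 - e2 \<le> N" "e2 - e0 - e1 \<le> N"
  shows "Y / 32 \<le> N" "M \<le> 1 / e0 + 1 / e1 + 1 / e2 \<Longrightarrow> Y / 32 \<le> 2 * N - M"
proof -
  obtain Z where Z: "1 / Y = Z" "1 / Z = Y" "Z \<le> 1/4" using assms(1) by simp
  note * = assms(2)[unfolded Z]
  have N: "Y - 1 - Z \<le> N" using * assms(3-5) by auto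
  then show "Y / 32 \<le> N" using assms(1) Z(3) by linarith
  have "1 / e0 + 1 / e1 + 1 / e2 = 1 + Y + Z" using *
    by (elim insertE emptyE) (simp_all only: prod.inject Z(2) div_by_1 Z(1) ac_simps)
  then show "Y / 32 \<le> 2 * N - M" if "M \<le> 1 / e0 + 1 / e1 + 1 / e2"
    using that N assms(1) Z(3) by linarith
qed

text \<open>All three reverse triangle inequalities are kept because the dominant exponential
  changes from ray to ray.\<close>

lemma norm_exponential_sum_ge:
  fixes \<mu> :: complex
  defines "N \<equiv> norm (exp (- \<i> * \<mu>) + \<alpha> * exp (- \<i> * \<alpha> * \<mu>) + \<alpha>\<^sup>2 * exp (- \<i> * \<alpha>\<^sup>2 * \<mu>))"
  shows "exp (Im \<mu>) - exp (Im (\<alpha> * \<mu>)) - exp (Im (\<alpha>\<^sup>2 * \<mu>)) \<le> N"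
    "exp (Im (\<alpha> * \<mu>)) - exp (Im \<mu>) - exp (Im (\<alpha>\<^sup>2 * \<mu>)) \<le> N"
    "exp (Im (\<alpha>\<^sup>2 * \<mu>)) - exp (Im \<mu>) - exp (Im (\<alpha> * \<mu>)) \<le> N"
proof -
  have "norm (exp (- \<i> * \<mu>)) = exp (Im \<mu>)" "norm (\<alpha> * exp (- \<i> * \<alpha> * \<mu>)) = exp (Im (\<alpha> * \<mu>))"
    "norm (\<alpha>\<^sup>2 * exp (- \<i> * \<alpha>\<^sup>2 * \<mu>)) = exp (Im (\<alpha>\<^sup>2 * \<mu>))"
    using norm_exp_minus_i[of \<mu>] norm_exp_minus_i[of "\<alpha> * \<mu>"] norm_exp_minus_i[of "\<alpha>\<^sup>2 * \<mu>"]
    by (simp_all only: norm_mult norm_power norm_\<alpha> mult.assoc power_one mult_1)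
  then show "exp (Im \<mu>) - exp (Im (\<alpha> * \<mu>)) - exp (Im (\<alpha>\<^sup>2 * \<mu>)) \<le> N"
    "exp (Im (\<alpha> * \<mu>)) - exp (Im \<mu>) - exp (Im (\<alpha>\<^sup>2 * \<mu>)) \<le> N"
    "exp (Im (\<alpha>\<^sup>2 * \<mu>)) - exp (Im \<mu>) - exp (Im (\<alpha> * \<mu>)) \<le> N"
    unfolding N_def
    using norm_sum3_ge[where a = "exp (- \<i> * \<mu>)" and b = "\<alpha> * exp (- \<i> * \<alpha> * \<mu>)"
        and c = "\<alpha>\<^sup>2 * exp (- \<i> * \<alpha>\<^sup>2 * \<mu>)"] by simp_all
qed

lemma norm_Delta2_ge:
  assumes "2 \<le> norm \<mu>" "Im (\<mu> ^ 3) = 0"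
  shows "ray_growth \<mu> / 32 \<le> norm (Delta2 \<mu>)"
  unfolding Delta2_def
  by (rule exponential_sum_bounds(1)[OF ray_growth_ge_4[OF assms(1)]
        root_exponential_norms[OF assms, unfolded Let_def] norm_exponential_sum_ge])

text \<open>The exponentials with opposite sign have reciprocal moduli, so both sums contain a term
  of modulus \<open>ray_growth \<mu>\<close>. The coefficient 2 makes the second sum outweigh the
  first.\<close>

lemma norm_Delta1_ge:
  assumes "2 \<le> norm \<mu>" "Im (\<mu> ^ 3) = 0"
  shows "ray_growth \<mu> / 32 \<le> norm (Delta1 \<mu>)"
proof -
  let ?u = "exp (\<i> * \<mu>)" and ?v = "\<alpha> * exp (\<i> * \<alpha> * \<mu>)" and ?w = "\<alpha>\<^sup>2 * exp (\<i> * \<alpha>\<^sup>2 * \<mu>)"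
  let ?s = "exp (- \<i> * \<mu>) + \<alpha> * exp (- \<i> * \<alpha> * \<mu>) + \<alpha>\<^sup>2 * exp (- \<i> * \<alpha>\<^sup>2 * \<mu>)"
  have e: "exp (- t) = 1 / exp t" for t :: real by (simp add: exp_minus inverse_eq_divide)
  have "norm ?u = 1 / exp (Im \<mu>)" "norm ?v = 1 / exp (Im (\<alpha> * \<mu>))" "norm ?w = 1 / exp (Im (\<alpha>\<^sup>2 * \<mu>))"
    using norm_exp_i[of \<mu>] norm_exp_i[of "\<alpha> * \<mu>"] norm_exp_i[of "\<alpha>\<^sup>2 * \<mu>"]
    by (simp_all only: norm_mult norm_power norm_\<alpha> mult.assoc power_one mult_1 e)
  then have "norm (?u + ?v + ?w) \<le> 1 / exp (Im \<mu>) + 1 / exp (Im (\<alpha> * \<mu>)) + 1 / exp (Im (\<alpha>\<^sup>2 * \<mu>))"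
    using norm_triangle_ineq[of "?u + ?v" ?w] norm_triangle_ineq[of ?u ?v] by linarith
  then have "ray_growth \<mu> / 32 \<le> 2 * norm ?s - norm (?u + ?v + ?w)"
    by (rule exponential_sum_bounds(2)[OF ray_growth_ge_4[OF assms(1)]
          root_exponential_norms[OF assms, unfolded Let_def] norm_exponential_sum_ge])
  also have "2 * norm ?s - norm (?u + ?v + ?w) \<le> norm (?u + ?v + ?w + 2 * ?s)"
    using norm_triangle_ineq4[of "?u + ?v + ?w + 2 * ?s" "?u + ?v + ?w"]
    by (simp only: add_diff_cancel_left' norm_mult norm_numeral)
  finally show ?thesis by (simp only: Delta1_def)
qed

text \<open>Each exponent is affine in x, hence largest at an end point of the interval. As
  \<open>p + q + r = 0\<close>, its values there are 0, an imaginary part or the negative of one,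
  none above \<open>sqrt 3 / 2 * norm \<mu>\<close>.\<close>

lemma norm_root_exponential_products:
  assumes "2 \<le> norm \<mu>" "Im (\<mu> ^ 3) = 0" "x \<in> {0..1}"
    and m: "(p, q, r) \<in> {(Im \<mu>, Im (\<alpha> * \<mu>), Im (\<alpha>\<^sup>2 * \<mu>)), (Im (\<alpha> * \<mu>), Im \<mu>, Im (\<alpha>\<^sup>2 * \<mu>)),
      (Im (\<alpha>\<^sup>2 * \<mu>), Im \<mu>, Im (\<alpha> * \<mu>))}"
  shows "exp (p * x) \<le> ray_growth \<mu>" "exp (p * x) * exp (- p) \<le> ray_growth \<mu>"
    "exp (p * x) * exp q \<le> ray_growth \<mu>" "exp (p * x) * exp r \<le> ray_growth \<mu>"
proof -
  obtain s where s: "\<bar>s\<bar> = sqrt 3 / 2 * norm \<mu>"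
    "(Im \<mu>, Im (\<alpha> * \<mu>), Im (\<alpha>\<^sup>2 * \<mu>)) \<in> {(0, s, - s), (s, 0, - s), (s, - s, 0)}"
    using Im_roots_on_ray[OF assms(2)] .
  have Y: "ray_growth \<mu> = exp \<bar>s\<bar>" by (simp add: ray_growth_def s(1))
  have pqr: "(p, q, r) \<in> {(0, s, - s), (s, 0, - s), (s, - s, 0), (- s, 0, s), (- s, s, 0), (0, - s, s)}"
    using m s(2) by auto
  have x: "\<bar>s\<bar> * x \<le> \<bar>s\<bar>" "0 \<le> \<bar>s\<bar> * x" using assms(3) by (simp_all add: mult_left_le)
  have "p * x \<le> \<bar>s\<bar> \<and> p * x + - p \<le> \<bar>s\<bar> \<and> p * x + q \<le> \<bar>s\<bar> \<and> p * x + r \<le> \<bar>s\<bar>"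
  proof (cases "s \<ge> 0")
    case True
    then have "s * x \<le> s" "0 \<le> s * x" "\<bar>s\<bar> = s" using x by simp_all
    then show ?thesis using True pqr by (elim insertE emptyE) simp_all
  next
    case False
    then have "s \<le> s * x" "s * x \<le> 0" "\<bar>s\<bar> = - s" using x by simp_all
    then show ?thesis using False pqr by (elim insertE emptyE) simp_all
  qed
  then show "exp (p * x) \<le> ray_growth \<mu>" "exp (p * x) * exp (- p) \<le> ray_growth \<mu>"
    "exp (p * x) * exp q \<le> ray_growth \<mu>" "exp (p * x) * exp r \<le> ray_growth \<mu>"
    unfolding Y exp_add[symmetric] exp_le_cancel_iff by simp_all
qed

section \<open>The two transform pairs\<close>

text \<open>All from \<open>1 + \<alpha> + \<alpha>\<^sup>2 = 0\<close>. They express the kernels by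
  the exponentials of negative sign alone, which turns the kernel identities into polynomial
  ones.\<close>

lemma exp_i_root_products:
  "exp (\<i> * \<mu>) = exp (- \<i> * \<alpha> * \<mu>) * exp (- \<i> * \<alpha>\<^sup>2 * \<mu>)"
  "exp (\<i> * \<alpha> * \<mu>) = exp (- \<i> * \<mu>) * exp (- \<i> * \<alpha>\<^sup>2 * \<mu>)"
  "exp (\<i> * \<alpha>\<^sup>2 * \<mu>) = exp (- \<i> * \<mu>) * exp (- \<i> * \<alpha> * \<mu>)"
  by (simp_all add: exp_add[symmetric] \<alpha>_square algebra_simps)

lemma exp_minus_i_root_product:
  "exp (- \<i> * \<mu>) * exp (- \<i> * \<alpha> * \<mu>) * exp (- \<i> * \<alpha>\<^sup>2 * \<mu>) = 1"
  by (simp add: exp_add[symmetric] \<alpha>_square algebra_simps)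

lemma linear_subspace_kernel:
  assumes "\<And>f g. f \<in> smooth01 \<Longrightarrow> g \<in> smooth01 \<Longrightarrow> P f \<Longrightarrow> P g \<Longrightarrow> P (\<lambda>x. f x + g x)"
    and "\<And>c f. f \<in> smooth01 \<Longrightarrow> P f \<Longrightarrow> P (\<lambda>x. c * f x)" and "P (\<lambda>x. 0)"
  shows "linear_subspace {f \<in> smooth01. P f}"
  using assms by (auto simp: linear_subspace_def smooth01_0 smooth01_add smooth01_scale)

lemma deriv01_add: "f \<in> smooth01 \<Longrightarrow> g \<in> smooth01 \<Longrightarrow>
    deriv01 (\<lambda>x. f x + g x) = (\<lambda>x. deriv01 f x + deriv01 g x)"
  using funpow_deriv01_add[of f g 1] by simp

lemma deriv01_scale: "f \<in> smooth01 \<Longrightarrow> deriv01 (\<lambda>x. c * f x) = (\<lambda>x. c * deriv01 f x)"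
  using funpow_deriv01_scale[of f 1 c] by simp

lemma deriv01_0: "deriv01 (\<lambda>x. 0) = (\<lambda>x. 0)"
  using deriv01_scale[OF smooth01_0, of 0] by simp

lemma linear_subspace_Phi1: "linear_subspace Phi1"
  unfolding Phi1_def
  by (rule linear_subspace_kernel) (auto simp: deriv01_add deriv01_scale deriv01_0 algebra_simps)

lemma linear_subspace_Phi2: "linear_subspace Phi2"
  unfolding Phi2_def
  by (rule linear_subspace_kernel) (auto simp: deriv01_add deriv01_scale deriv01_0)

text \<open>These are the products occurring in the kernels. None pairs a root with itself in the
  same sign, which could reach the square of \<open>ray_growth \<mu>\<close>.\<close>

lemma norm_kernel_terms_le:
  assumes "2 \<le> norm \<mu>" "Im (\<mu> ^ 3) = 0" "x \<in> {0..1}"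
  defines "X0 \<equiv> exp (- \<i> * \<mu> * of_real x)" and "X1 \<equiv> exp (- \<i> * \<alpha> * \<mu> * of_real x)"
    and "X2 \<equiv> exp (- \<i> * \<alpha>\<^sup>2 * \<mu> * of_real x)"
  shows "norm X0 \<le> ray_growth \<mu>" "norm X1 \<le> ray_growth \<mu>" "norm X2 \<le> ray_growth \<mu>"
    "norm (X0 * exp (\<i> * \<mu>)) \<le> ray_growth \<mu>"
    "norm (X1 * exp (\<i> * \<alpha> * \<mu>)) \<le> ray_growth \<mu>"
    "norm (X2 * exp (\<i> * \<alpha>\<^sup>2 * \<mu>)) \<le> ray_growth \<mu>"
    "norm (X0 * exp (- \<i> * \<alpha> * \<mu>)) \<le> ray_growth \<mu>"
    "norm (X0 * exp (- \<i> * \<alpha>\<^sup>2 * \<mu>)) \<le> ray_growth \<mu>"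
    "norm (X1 * exp (- \<i> * \<mu>)) \<le> ray_growth \<mu>"
    "norm (X1 * exp (- \<i> * \<alpha>\<^sup>2 * \<mu>)) \<le> ray_growth \<mu>"
    "norm (X2 * exp (- \<i> * \<mu>)) \<le> ray_growth \<mu>"
    "norm (X2 * exp (- \<i> * \<alpha> * \<mu>)) \<le> ray_growth \<mu>"
proof -
  have X: "norm X0 = exp (Im \<mu> * x)" "norm X1 = exp (Im (\<alpha> * \<mu>) * x)" "norm X2 = exp (Im (\<alpha>\<^sup>2 * \<mu>) * x)"
    unfolding X0_def X1_def X2_def by (simp_all add: norm_exp_eq_Re algebra_simps)
  have E: "norm (exp (- \<i> * \<mu>)) = exp (Im \<mu>)" "norm (exp (- \<i> * \<alpha> * \<mu>)) = exp (Im (\<alpha> * \<mu>))"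
    "norm (exp (- \<i> * \<alpha>\<^sup>2 * \<mu>)) = exp (Im (\<alpha>\<^sup>2 * \<mu>))"
    using norm_exp_minus_i[of \<mu>] norm_exp_minus_i[of "\<alpha> * \<mu>"] norm_exp_minus_i[of "\<alpha>\<^sup>2 * \<mu>"]
    by (simp_all only: mult.assoc)
  have E': "norm (exp (\<i> * \<mu>)) = exp (- Im \<mu>)" "norm (exp (\<i> * \<alpha> * \<mu>)) = exp (- Im (\<alpha> * \<mu>))"
    "norm (exp (\<i> * \<alpha>\<^sup>2 * \<mu>)) = exp (- Im (\<alpha>\<^sup>2 * \<mu>))"
    using norm_exp_i[of \<mu>] norm_exp_i[of "\<alpha> * \<mu>"] norm_exp_i[of "\<alpha>\<^sup>2 * \<mu>"]
    by (simp_all only: mult.assoc)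
  note p = norm_root_exponential_products[OF assms(1-3)]
  note p0 = p[of "Im \<mu>" "Im (\<alpha> * \<mu>)" "Im (\<alpha>\<^sup>2 * \<mu>)"] and p1 = p[of "Im (\<alpha> * \<mu>)" "Im \<mu>" "Im (\<alpha>\<^sup>2 * \<mu>)"]
    and p2 = p[of "Im (\<alpha>\<^sup>2 * \<mu>)" "Im \<mu>" "Im (\<alpha> * \<mu>)"]
  show "norm X0 \<le> ray_growth \<mu>" "norm X1 \<le> ray_growth \<mu>" "norm X2 \<le> ray_growth \<mu>"
    "norm (X0 * exp (\<i> * \<mu>)) \<le> ray_growth \<mu>"
    "norm (X1 * exp (\<i> * \<alpha> * \<mu>)) \<le> ray_growth \<mu>"
    "norm (X2 * exp (\<i> * \<alpha>\<^sup>2 * \<mu>)) \<le> ray_growth \<mu>"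
    "norm (X0 * exp (- \<i> * \<alpha> * \<mu>)) \<le> ray_growth \<mu>"
    "norm (X0 * exp (- \<i> * \<alpha>\<^sup>2 * \<mu>)) \<le> ray_growth \<mu>"
    "norm (X1 * exp (- \<i> * \<mu>)) \<le> ray_growth \<mu>"
    "norm (X1 * exp (- \<i> * \<alpha>\<^sup>2 * \<mu>)) \<le> ray_growth \<mu>"
    "norm (X2 * exp (- \<i> * \<mu>)) \<le> ray_growth \<mu>"
    "norm (X2 * exp (- \<i> * \<alpha> * \<mu>)) \<le> ray_growth \<mu>"
    unfolding norm_mult X E E' using p0 p1 p2 by blast+
qed

lemma norm_scaled_le:
  "norm z \<le> Y \<Longrightarrow> norm (\<alpha> * z) \<le> Y" "norm z \<le> Y \<Longrightarrow> norm (\<alpha>\<^sup>2 * z) \<le> Y"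
  "norm z \<le> Y \<Longrightarrow> norm (2 * z) \<le> 2 * Y" "norm z \<le> Y \<Longrightarrow> norm (- z) \<le> Y" for z :: complex
  by (simp_all add: norm_mult norm_power norm_\<alpha>)

text \<open>The coefficients in the numerator of \<open>phi1_plus\<close> have absolute values
  adding up to 11, the largest such total among the four kernels. With the factor 32 from
  \<open>\<Delta>\<close> this gives \<open>352 / (2 * pi)\<close>, below 60 because
  \<open>pi > 3\<close>.\<close>

lemma norm_quotient_le_60:
  fixes N \<delta> :: complex
  assumes "norm N \<le> 11 * Y" "Y / 32 \<le> norm \<delta>" "0 < Y"
  shows "norm (1 / (2 * pi * \<delta>) * N) \<le> 60"
proof -
  have \<delta>: "norm \<delta> > 0" using assms(2,3) by linarith
  have "norm N \<le> 352 * norm \<delta>" using assms(1,2) by linarith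
  also have "\<dots> \<le> (60 * (2 * pi)) * norm \<delta>" using pi_gt3 by (intro mult_right_mono) auto
  finally have "norm N \<le> 60 * (2 * pi * norm \<delta>)" by simp
  then show ?thesis using \<delta> by (simp add: norm_mult norm_divide field_simps)
qed

section \<open>Problem 1, with coupled derivative conditions\<close>

definition coeff1_0 :: "complex \<Rightarrow> complex" where
  "coeff1_0 \<mu> = exp (\<i> * \<mu>) + 2 * \<alpha> * exp (- \<i> * \<alpha> * \<mu>) + 2 * \<alpha>\<^sup>2 * exp (- \<i> * \<alpha>\<^sup>2 * \<mu>)"

definition coeff1_1 :: "complex \<Rightarrow> complex" where
  "coeff1_1 \<mu> = \<alpha> * exp (\<i> * \<alpha> * \<mu>) - 2 * \<alpha> * exp (- \<i> * \<mu>)"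

definition coeff1_2 :: "complex \<Rightarrow> complex" where
  "coeff1_2 \<mu> = \<alpha>\<^sup>2 * exp (\<i> * \<alpha>\<^sup>2 * \<mu>) - 2 * \<alpha>\<^sup>2 * exp (- \<i> * \<mu>)"

lemma phi1_plus_eq:
  "phi1_plus x \<mu> = root_kernel (coeff1_0 \<mu>) (coeff1_1 \<mu>) (coeff1_2 \<mu>) \<mu> x / (2 * pi * Delta1 \<mu>)"
  by (simp add: phi1_plus_def root_kernel_def coeff1_0_def coeff1_1_def coeff1_2_def mult.commute)

lemma norm_phi1_plus_le:
  assumes "2 \<le> norm \<mu>" "Im (\<mu> ^ 3) = 0" "x \<in> {0..1}"
  shows "norm (phi1_plus x \<mu>) \<le> 60"
proof -
  note bounds = norm_kernel_terms_le[OF assms]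
  let ?Y = "ray_growth \<mu>"
  let ?X0 = "exp (- \<i> * \<mu> * of_real x)" and ?X1 = "exp (- \<i> * \<alpha> * \<mu> * of_real x)"
    and ?X2 = "exp (- \<i> * \<alpha>\<^sup>2 * \<mu> * of_real x)"
  have "norm (?X0 * exp (\<i> * \<mu>) + 2 * (\<alpha> * (?X0 * exp (- \<i> * \<alpha> * \<mu>))) + 2 * (\<alpha>\<^sup>2 * (?X0 * exp (- \<i> * \<alpha>\<^sup>2 * \<mu>)))
      + \<alpha> * (?X1 * exp (\<i> * \<alpha> * \<mu>)) + 2 * - (\<alpha> * (?X1 * exp (- \<i> * \<mu>)))
      + \<alpha>\<^sup>2 * (?X2 * exp (\<i> * \<alpha>\<^sup>2 * \<mu>)) + 2 * - (\<alpha>\<^sup>2 * (?X2 * exp (- \<i> * \<mu>))))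
    \<le> ?Y + 2 * ?Y + 2 * ?Y + ?Y + 2 * ?Y + ?Y + 2 * ?Y"
    by (intro norm_triangle_mono norm_scaled_le bounds)
  also have "\<dots> = 11 * ?Y" by simp
  finally show ?thesis
    unfolding phi1_plus_def
    by (intro norm_quotient_le_60[OF _ norm_Delta1_ge[OF assms(1,2)]]) (simp_all add: ray_growth_def algebra_simps)
qed

lemma norm_phi1_minus_le:
  assumes "2 \<le> norm \<mu>" "Im (\<mu> ^ 3) = 0" "x \<in> {0..1}"
  shows "norm (phi1_minus x \<mu>) \<le> 60 * norm (exp (- \<i> * \<mu>))"
proof -
  note bounds = norm_kernel_terms_le[OF assms]
  let ?Y = "ray_growth \<mu>"
  let ?X0 = "exp (- \<i> * \<mu> * of_real x)" and ?X1 = "exp (- \<i> * \<alpha> * \<mu> * of_real x)"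
    and ?X2 = "exp (- \<i> * \<alpha>\<^sup>2 * \<mu> * of_real x)"
  let ?N = "?X0 * (2 + \<alpha>\<^sup>2 * exp (- \<i> * \<alpha> * \<mu>) + \<alpha> * exp (- \<i> * \<alpha>\<^sup>2 * \<mu>))
      + \<alpha> * ?X1 * (2 - exp (- \<i> * \<alpha>\<^sup>2 * \<mu>)) + \<alpha>\<^sup>2 * ?X2 * (2 - exp (- \<i> * \<alpha> * \<mu>))"
  have "norm (2 * ?X0 + \<alpha>\<^sup>2 * (?X0 * exp (- \<i> * \<alpha> * \<mu>)) + \<alpha> * (?X0 * exp (- \<i> * \<alpha>\<^sup>2 * \<mu>))
      + 2 * (\<alpha> * ?X1) + - (\<alpha> * (?X1 * exp (- \<i> * \<alpha>\<^sup>2 * \<mu>)))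
      + 2 * (\<alpha>\<^sup>2 * ?X2) + - (\<alpha>\<^sup>2 * (?X2 * exp (- \<i> * \<alpha> * \<mu>))))
    \<le> 2 * ?Y + ?Y + ?Y + 2 * ?Y + ?Y + 2 * ?Y + ?Y"
    by (intro norm_triangle_mono norm_scaled_le bounds)
  also have "\<dots> \<le> 11 * ?Y" by (simp add: ray_growth_def)
  finally have "norm (1 / (2 * pi * Delta1 \<mu>) * ?N) \<le> 60"
    by (intro norm_quotient_le_60[OF _ norm_Delta1_ge[OF assms(1,2)]]) (simp_all add: ray_growth_def algebra_simps)
  then have "norm (exp (- \<i> * \<mu>)) * norm (1 / (2 * pi * Delta1 \<mu>) * ?N) \<le> norm (exp (- \<i> * \<mu>)) * 60"
    by (intro mult_left_mono) auto
  moreover have "phi1_minus x \<mu> = - (exp (- \<i> * \<mu>) * (1 / (2 * pi * Delta1 \<mu>) * ?N))"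
    by (simp add: phi1_minus_def)
  ultimately show ?thesis by (simp only: norm_minus_cancel norm_mult mult.commute)
qed

lemma Delta1_products:
  "Delta1 \<mu> = exp (- \<i> * \<alpha> * \<mu>) * exp (- \<i> * \<alpha>\<^sup>2 * \<mu>) + \<alpha> * (exp (- \<i> * \<mu>) * exp (- \<i> * \<alpha>\<^sup>2 * \<mu>))
     + \<alpha>\<^sup>2 * (exp (- \<i> * \<mu>) * exp (- \<i> * \<alpha> * \<mu>))
     + 2 * (exp (- \<i> * \<mu>) + \<alpha> * exp (- \<i> * \<alpha> * \<mu>) + \<alpha>\<^sup>2 * exp (- \<i> * \<alpha>\<^sup>2 * \<mu>))"
  unfolding Delta1_def exp_i_root_products ..

lemma root_kernel_at_0: "root_kernel a b c \<mu> 0 = a + b + c"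
  by (simp add: root_kernel_def)

lemma root_kernel_at_1: "root_kernel a b c \<mu> 1
    = a * exp (- \<i> * \<mu>) + b * exp (- \<i> * \<alpha> * \<mu>) + c * exp (- \<i> * \<alpha>\<^sup>2 * \<mu>)"
  by (simp add: root_kernel_def)

text \<open>Reduces the jump between the two kernels to an identity of numerators.\<close>

lemma quotient_jump:
  fixes \<delta> N M e :: complex
  assumes "\<delta> \<noteq> 0" "N = M - \<delta> * e"
  shows "N / (2 * pi * \<delta>) = M / (2 * pi * \<delta>) - e / (2 * pi)"
  using assms by (simp add: field_simps)

lemma cubic_transform_pair_1:
  "cubic_transform_pair Phi1 phi1_plus phi1_minus Delta1 coeff1_0 coeff1_1 coeff1_2 60"
proof
  show "linear_subspace Phi1" by (rule linear_subspace_Phi1)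
  show "Phi1 \<subseteq> smooth01" by (auto simp: Phi1_def)
  show "f 0 = 0 \<and> f 1 = 0" if "f \<in> Phi1" for f using that by (simp add: Phi1_def)
  show "Delta1 holomorphic_on UNIV" "coeff1_0 holomorphic_on UNIV" "coeff1_1 holomorphic_on UNIV"
    "coeff1_2 holomorphic_on UNIV"
    unfolding Delta1_def[abs_def] coeff1_0_def[abs_def] coeff1_1_def[abs_def] coeff1_2_def[abs_def]
    by (intro holomorphic_intros)+
  fix x \<mu>
  show "phi1_plus x \<mu> = root_kernel (coeff1_0 \<mu>) (coeff1_1 \<mu>) (coeff1_2 \<mu>) \<mu> x / (2 * pi * Delta1 \<mu>)"
    by (rule phi1_plus_eq)
  show "Delta1 \<mu> \<noteq> 0" if "\<mu> \<noteq> 0" "norm \<mu> \<le> 2 \<or> Im (\<mu> ^ 3) = 0"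
  proof (cases "norm \<mu> \<le> 2")
    case False
    then have "ray_growth \<mu> / 32 \<le> norm (Delta1 \<mu>)" using that by (intro norm_Delta1_ge) auto
    moreover have "0 < ray_growth \<mu>" by (simp add: ray_growth_def)
    ultimately show ?thesis by auto
  qed (use that Delta1_nonzero_small in blast)
  show "norm (phi1_plus x \<mu>) \<le> 60" if "2 \<le> norm \<mu>" "Im (\<mu> ^ 3) = 0" "x \<in> {0..1}"
    using that by (rule norm_phi1_plus_le)
  show "norm (phi1_minus x \<mu>) \<le> 60 * norm (exp (- \<i> * \<mu>))"
    if "2 \<le> norm \<mu>" "Im (\<mu> ^ 3) = 0" "x \<in> {0..1}"
    using that by (rule norm_phi1_minus_le)
  \<comment> \<open>In these variables the remaining conditions are polynomial identities modulo
    \<open>1 + \<alpha> + \<alpha>\<^sup>2 = 0\<close> and \<open>E0 * E1 * E2 = 1\<close>.\<close>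
  define E0 E1 E2 where E: "E0 = exp (- \<i> * \<mu>)" "E1 = exp (- \<i> * \<alpha> * \<mu>)" "E2 = exp (- \<i> * \<alpha>\<^sup>2 * \<mu>)"
  have c: "coeff1_0 \<mu> = E1 * E2 + 2 * \<alpha> * E1 + 2 * \<alpha>\<^sup>2 * E2" "coeff1_1 \<mu> = \<alpha> * (E0 * E2) - 2 * \<alpha> * E0"
    "coeff1_2 \<mu> = \<alpha>\<^sup>2 * (E0 * E1) - 2 * \<alpha>\<^sup>2 * E0"
    unfolding coeff1_0_def coeff1_1_def coeff1_2_def exp_i_root_products E by simp_all
  have \<Delta>: "Delta1 \<mu> = E1 * E2 + \<alpha> * (E0 * E2) + \<alpha>\<^sup>2 * (E0 * E1) + 2 * (E0 + \<alpha> * E1 + \<alpha>\<^sup>2 * E2)"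
    unfolding Delta1_products E ..
  have one: "E0 * E1 * E2 = 1" unfolding E by (rule exp_minus_i_root_product)
  have \<alpha>1: "1 + \<alpha> + \<alpha>\<^sup>2 = 0" by (simp add: \<alpha>_square)
  show "phi1_minus x \<mu> = phi1_plus x \<mu> - exp (- \<i> * \<mu> * x) / (2 * pi)" if "Delta1 \<mu> \<noteq> 0"
  proof -
    let ?X0 = "exp (- \<i> * \<mu> * of_real x)" and ?X1 = "exp (- \<i> * \<alpha> * \<mu> * of_real x)"
      and ?X2 = "exp (- \<i> * \<alpha>\<^sup>2 * \<mu> * of_real x)"
    have "- E0 * (?X0 * (2 + \<alpha>\<^sup>2 * E1 + \<alpha> * E2) + \<alpha> * ?X1 * (2 - E2) + \<alpha>\<^sup>2 * ?X2 * (2 - E1)) / (2 * pi * Delta1 \<mu>)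
      = (coeff1_0 \<mu> * ?X0 + coeff1_1 \<mu> * ?X1 + coeff1_2 \<mu> * ?X2) / (2 * pi * Delta1 \<mu>) - ?X0 / (2 * pi)"
      by (rule quotient_jump[OF that]) (simp only: c \<Delta>, simp add: algebra_simps)
    then show ?thesis
      unfolding phi1_plus_eq root_kernel_def phi1_minus_def E by simp
  qed
  show "root_kernel (coeff1_0 \<mu>) (coeff1_1 \<mu>) (coeff1_2 \<mu>) \<mu> 0 = Delta1 \<mu>"
    unfolding root_kernel_at_0 c \<Delta> using \<alpha>1 by algebra
  show "root_kernel (coeff1_0 \<mu>) (coeff1_1 \<mu>) (coeff1_2 \<mu>) \<mu> 1 = 0"
    unfolding root_kernel_at_1 E[symmetric] c using \<alpha>1 one by algebra
  show "root_kernel_deriv (coeff1_0 \<mu>) (coeff1_1 \<mu>) (coeff1_2 \<mu>) \<mu> 1 * deriv01 f 1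
      - root_kernel_deriv (coeff1_0 \<mu>) (coeff1_1 \<mu>) (coeff1_2 \<mu>) \<mu> 0 * deriv01 f 0
      = \<i> * \<mu> * Delta1 \<mu> * deriv01 f 0" if "f \<in> Phi1" for f
  proof -
    \<comment> \<open>The coupling leaves one condition on the cleared kernel: its derivative at 1
      minus twice its derivative at 0 equals \<open>2 * \<i> * \<mu> * Delta1 \<mu>\<close>.\<close>
    have d: "deriv01 f 0 = 2 * deriv01 f 1" using that by (simp add: Phi1_def)
    show ?thesis
      unfolding root_kernel_at_0 root_kernel_at_1 E[symmetric] c \<Delta> d using \<alpha>1 one by algebra
  qed
qed

section \<open>Problem 2, with uncoupled conditions\<close>

definition coeff2_0 :: "complex \<Rightarrow> complex" where
  "coeff2_0 \<mu> = \<alpha> * exp (- \<i> * \<alpha> * \<mu>) + \<alpha>\<^sup>2 * exp (- \<i> * \<alpha>\<^sup>2 * \<mu>)"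

lemma phi2_plus_eq:
  "phi2_plus x \<mu> = root_kernel (coeff2_0 \<mu>) (- \<alpha> * exp (- \<i> * \<mu>)) (- \<alpha>\<^sup>2 * exp (- \<i> * \<mu>)) \<mu> x
    / (2 * pi * Delta2 \<mu>)"
  by (simp add: phi2_plus_def root_kernel_def coeff2_0_def algebra_simps add_divide_distrib diff_divide_distrib)

lemma norm_phi2_plus_le:
  assumes "2 \<le> norm \<mu>" "Im (\<mu> ^ 3) = 0" "x \<in> {0..1}"
  shows "norm (phi2_plus x \<mu>) \<le> 60"
proof -
  note bounds = norm_kernel_terms_le[OF assms]
  let ?Y = "ray_growth \<mu>"
  let ?X0 = "exp (- \<i> * \<mu> * of_real x)" and ?X1 = "exp (- \<i> * \<alpha> * \<mu> * of_real x)"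
    and ?X2 = "exp (- \<i> * \<alpha>\<^sup>2 * \<mu> * of_real x)"
  have "norm (\<alpha> * (?X0 * exp (- \<i> * \<alpha> * \<mu>)) + \<alpha>\<^sup>2 * (?X0 * exp (- \<i> * \<alpha>\<^sup>2 * \<mu>))
      + - (\<alpha> * (?X1 * exp (- \<i> * \<mu>))) + - (\<alpha>\<^sup>2 * (?X2 * exp (- \<i> * \<mu>)))) \<le> ?Y + ?Y + ?Y + ?Y"
    by (intro norm_triangle_mono norm_scaled_le bounds)
  also have "\<dots> \<le> 11 * ?Y" by (simp add: ray_growth_def)
  finally show ?thesis
    unfolding phi2_plus_def
    by (intro norm_quotient_le_60[OF _ norm_Delta2_ge[OF assms(1,2)]]) (simp_all add: ray_growth_def algebra_simps)
qed

lemma norm_phi2_minus_le: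
  assumes "2 \<le> norm \<mu>" "Im (\<mu> ^ 3) = 0" "x \<in> {0..1}"
  shows "norm (phi2_minus x \<mu>) \<le> 60 * norm (exp (- \<i> * \<mu>))"
proof -
  note bounds = norm_kernel_terms_le[OF assms]
  let ?Y = "ray_growth \<mu>"
  let ?N = "exp (- \<i> * \<mu> * of_real x) + \<alpha> * exp (- \<i> * \<alpha> * \<mu> * of_real x)
      + \<alpha>\<^sup>2 * exp (- \<i> * \<alpha>\<^sup>2 * \<mu> * of_real x)"
  have "norm ?N \<le> ?Y + ?Y + ?Y"
    by (intro norm_triangle_mono norm_scaled_le bounds)
  also have "\<dots> \<le> 11 * ?Y" by (simp add: ray_growth_def)
  finally have "norm (1 / (2 * pi * Delta2 \<mu>) * ?N) \<le> 60"
    by (intro norm_quotient_le_60[OF _ norm_Delta2_ge[OF assms(1,2)]]) (simp_all add: ray_growth_def)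
  then have "norm (exp (- \<i> * \<mu>)) * norm (1 / (2 * pi * Delta2 \<mu>) * ?N) \<le> norm (exp (- \<i> * \<mu>)) * 60"
    by (intro mult_left_mono) auto
  moreover have "phi2_minus x \<mu> = - (exp (- \<i> * \<mu>) * (1 / (2 * pi * Delta2 \<mu>) * ?N))"
    by (simp add: phi2_minus_def)
  ultimately show ?thesis by (simp only: norm_minus_cancel norm_mult mult.commute)
qed

lemma cubic_transform_pair_2:
  "cubic_transform_pair Phi2 phi2_plus phi2_minus Delta2 coeff2_0
    (\<lambda>\<mu>. - \<alpha> * exp (- \<i> * \<mu>)) (\<lambda>\<mu>. - \<alpha>\<^sup>2 * exp (- \<i> * \<mu>)) 60"
proof
  show "linear_subspace Phi2" by (rule linear_subspace_Phi2)
  show "Phi2 \<subseteq> smooth01" by (auto simp: Phi2_def)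
  show "f 0 = 0 \<and> f 1 = 0" if "f \<in> Phi2" for f using that by (simp add: Phi2_def)
  show "Delta2 holomorphic_on UNIV" "coeff2_0 holomorphic_on UNIV"
    "(\<lambda>\<mu>. - \<alpha> * exp (- \<i> * \<mu>)) holomorphic_on UNIV" "(\<lambda>\<mu>. - \<alpha>\<^sup>2 * exp (- \<i> * \<mu>)) holomorphic_on UNIV"
    unfolding Delta2_def[abs_def] coeff2_0_def[abs_def] by (intro holomorphic_intros)+
  fix x \<mu>
  show "phi2_plus x \<mu> = root_kernel (coeff2_0 \<mu>) (- \<alpha> * exp (- \<i> * \<mu>)) (- \<alpha>\<^sup>2 * exp (- \<i> * \<mu>)) \<mu> x
      / (2 * pi * Delta2 \<mu>)"
    by (rule phi2_plus_eq)
  show "Delta2 \<mu> \<noteq> 0" if "\<mu> \<noteq> 0" "norm \<mu> \<le> 2 \<or> Im (\<mu> ^ 3) = 0"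
  proof (cases "norm \<mu> \<le> 2")
    case False
    then have "ray_growth \<mu> / 32 \<le> norm (Delta2 \<mu>)" using that by (intro norm_Delta2_ge) auto
    moreover have "0 < ray_growth \<mu>" by (simp add: ray_growth_def)
    ultimately show ?thesis by auto
  qed (use that Delta2_nonzero_small in blast)
  show "norm (phi2_plus x \<mu>) \<le> 60" if "2 \<le> norm \<mu>" "Im (\<mu> ^ 3) = 0" "x \<in> {0..1}"
    using that by (rule norm_phi2_plus_le)
  show "norm (phi2_minus x \<mu>) \<le> 60 * norm (exp (- \<i> * \<mu>))"
    if "2 \<le> norm \<mu>" "Im (\<mu> ^ 3) = 0" "x \<in> {0..1}"
    using that by (rule norm_phi2_minus_le)
  define E0 E1 E2 where E: "E0 = exp (- \<i> * \<mu>)" "E1 = exp (- \<i> * \<alpha> * \<mu>)" "E2 = exp (- \<i> * \<alpha>\<^sup>2 * \<mu>)"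
  have c: "coeff2_0 \<mu> = \<alpha> * E1 + \<alpha>\<^sup>2 * E2" unfolding coeff2_0_def E ..
  have \<Delta>: "Delta2 \<mu> = E0 + \<alpha> * E1 + \<alpha>\<^sup>2 * E2" unfolding Delta2_def E ..
  have \<alpha>1: "1 + \<alpha> + \<alpha>\<^sup>2 = 0" by (simp add: \<alpha>_square)
  show "phi2_minus x \<mu> = phi2_plus x \<mu> - exp (- \<i> * \<mu> * x) / (2 * pi)" if "Delta2 \<mu> \<noteq> 0"
  proof -
    let ?X0 = "exp (- \<i> * \<mu> * of_real x)" and ?X1 = "exp (- \<i> * \<alpha> * \<mu> * of_real x)"
      and ?X2 = "exp (- \<i> * \<alpha>\<^sup>2 * \<mu> * of_real x)"
    have "- E0 * (?X0 + \<alpha> * ?X1 + \<alpha>\<^sup>2 * ?X2) / (2 * pi * Delta2 \<mu>)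
      = (coeff2_0 \<mu> * ?X0 + - \<alpha> * E0 * ?X1 + - \<alpha>\<^sup>2 * E0 * ?X2) / (2 * pi * Delta2 \<mu>) - ?X0 / (2 * pi)"
      by (rule quotient_jump[OF that]) (simp only: c \<Delta>, simp add: algebra_simps)
    then show ?thesis
      unfolding phi2_plus_eq root_kernel_def phi2_minus_def E by simp
  qed
  show "root_kernel (coeff2_0 \<mu>) (- \<alpha> * exp (- \<i> * \<mu>)) (- \<alpha>\<^sup>2 * exp (- \<i> * \<mu>)) \<mu> 0 = Delta2 \<mu>"
    unfolding root_kernel_at_0 E[symmetric] c \<Delta> using \<alpha>1 by algebra
  show "root_kernel (coeff2_0 \<mu>) (- \<alpha> * exp (- \<i> * \<mu>)) (- \<alpha>\<^sup>2 * exp (- \<i> * \<mu>)) \<mu> 1 = 0"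
    unfolding root_kernel_at_1 E[symmetric] c by algebra
  show "root_kernel_deriv (coeff2_0 \<mu>) (- \<alpha> * exp (- \<i> * \<mu>)) (- \<alpha>\<^sup>2 * exp (- \<i> * \<mu>)) \<mu> 1 * deriv01 f 1
      - root_kernel_deriv (coeff2_0 \<mu>) (- \<alpha> * exp (- \<i> * \<mu>)) (- \<alpha>\<^sup>2 * exp (- \<i> * \<mu>)) \<mu> 0 * deriv01 f 0
      = \<i> * \<mu> * Delta2 \<mu> * deriv01 f 0" if "f \<in> Phi2" for f
  proof -
    \<comment> \<open>Only the end point 0 contributes: the cleared kernel has derivative
      \<open>- \<i> * \<mu> * Delta2 \<mu>\<close> there.\<close>
    have d: "deriv01 f 1 = 0" using that by (simp add: Phi2_def)
    show ?thesis
      unfolding root_kernel_at_0 E[symmetric] c \<Delta> d using \<alpha>1 by algebra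
  qed
qed

theorem theorem1p5:
  shows "spectral_representation {0<..<1} smooth01_topology Phi1 S_op 3
           Gamma0 (Gamma_plus @ Gamma_minus) F1
       \<and> spectral_representation {0<..<1} smooth01_topology Phi2 S_op 3
           Gamma0 (Gamma_plus @ Gamma_minus) F2"
  unfolding F1_def F2_def
  using cubic_transform_pair.spectral_representation_S_op[OF cubic_transform_pair_1]
    cubic_transform_pair.spectral_representation_S_op[OF cubic_transform_pair_2] by blast

end
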